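(* Suppose that $\Theta=(\theta_m)_{m\in\mathbb{N}}$ satisfies the standing assumptions (A) stated in the context (with the integer $k\ge1$ appearing there) and that $\mathfrak{S}_n$ is endowed with $\mathbb{P}_\Theta$. Let $(Y_m)_{m\ge1}$ be mutually independent Poisson random variables with $\mathbb{E}[Y_m]=\frac{\theta_m}{m}$, and for $1\le b\le n$ let $$d_b(n):=d_{\mathrm{TV}}\bigl(\mathcal{L}(C_1,C_2,\ldots,C_b),\ \mathcal{L}(Y_1,Y_2,\ldots,Y_b)\bigr)$$ be the total variation distance. Let $(b(n))_{n\in\mathbb{N}}$ be a sequence of integers with $1\le b(n)\le n$ such that $b(n)=o(n^c)$ with $0<c<(3k+3)^{-\frac{1}{k+1}}$. Then $$d_{b(n)}(n)=o(1)\qquad\text{as } n\to\infty .$$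
   Context: $\mathfrak{S}_n$ is the symmetric group on $\{1,\dots,n\}$, and for $\sigma\in\mathfrak{S}_n$, $C_m=C_m(\sigma)$ is the number of cycles of length $m$ in the cycle decomposition of $\sigma$. For $\Theta=(\theta_m)_{m\ge1}$ with $\theta_m\ge 0$, the probability measure $\mathbb{P}_\Theta$ on $\mathfrak{S}_n$ is $\mathbb{P}_\Theta[\sigma]=\frac{1}{h_n n!}\prod_{m=1}^n\theta_m^{C_m(\sigma)}$, with $h_n=h_n(\Theta)$ the normalization constant and $h_0:=1$. Put $g_\Theta(t)=\sum_{m\ge1}\frac{\theta_m}{m}t^m$. $\mathcal{L}(X)$ denotes the law of $X$; for laws on a countable set, $d_{\mathrm{TV}}(\mu,\nu)=\frac12\sum_{a}|\mu(a)-\nu(a)|$. Standing assumptions (A): $\theta_m\ge0$ for all $m\ge 1$; $g_\Theta$ is holomorphic for $|t|<1$; $g_\Theta$ is continuous (extends continuously) in the punctured disc $\{|t|\le1,\ t\ne1\}$; and there exist an integer $k\ge1$ and a polynomial $P(r)=\frac{r^{k+1}}{k+1}+\sum_{j=0}^k c_jr^j$ with real $c_j$ such that $g_\Theta(e^{-w})=P(-\log w)+O(w)$ as $w\to0$, $\mathrm{Re}(w)\ge0$ (principal branch of $\log$). *)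

theory Defs
  imports
    "HOL-Probability.Probability"
    "HOL-Combinatorics.Orbits"
    "HOL-Library.Landau_Symbols"
begin

section \<open>Weighted random permutations\<close>

text \<open>A sequence \<open>(\<theta>\<^sub>m)\<close>, \<open>m \<ge> 1\<close>, is a function on \<^typ>\<open>nat\<close> whose value at 0 is never used.\<close>

text \<open>
  The underlying set is an argument of the cycle count because a permutation of \<open>{1..n}\<close> is a total
  function on \<^typ>\<open>nat\<close> that fixes everything outside \<open>{1..n}\<close>; only the cycles inside \<open>{1..n}\<close> count.
\<close>

definition cycle_count :: "nat \<Rightarrow> (nat \<Rightarrow> nat) \<Rightarrow> nat \<Rightarrow> nat" where
  "cycle_count n \<sigma> m = card {S \<in> orbit \<sigma> ` {1..n}. card S = m}"

definition cycle_weight :: "(nat \<Rightarrow> real) \<Rightarrow> nat \<Rightarrow> (nat \<Rightarrow> nat) \<Rightarrow> real" where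
  "cycle_weight \<theta> n \<sigma> = (\<Prod>m=1..n. \<theta> m ^ cycle_count n \<sigma> m)"

definition norm_const :: "(nat \<Rightarrow> real) \<Rightarrow> nat \<Rightarrow> real" where
  "norm_const \<theta> n = (\<Sum>\<sigma> | \<sigma> permutes {1..n}. cycle_weight \<theta> n \<sigma>) / fact n"

text \<open>
  If the normalization constant vanishes (which is possible for some \<open>n\<close> when many \<open>\<theta>\<^sub>m\<close> are 0), the
  quotient below is 0 and this is the null measure; otherwise it is a probability measure.
\<close>

definition perm_measure :: "(nat \<Rightarrow> real) \<Rightarrow> nat \<Rightarrow> (nat \<Rightarrow> nat) measure" where
  "perm_measure \<theta> n = point_measure {\<sigma>. \<sigma> permutes {1..n}}
     (\<lambda>\<sigma>. ennreal (cycle_weight \<theta> n \<sigma> / (norm_const \<theta> n * fact n)))"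

lemma norm_const_0: "norm_const \<theta> 0 = 1"
  by (simp add: norm_const_def cycle_weight_def)

lemma prob_space_perm_measure:
  assumes "\<And>m. 1 \<le> m \<Longrightarrow> 0 \<le> \<theta> m" and "norm_const \<theta> n \<noteq> 0"
  shows "prob_space (perm_measure \<theta> n)"
proof
  have w: "0 \<le> cycle_weight \<theta> n \<sigma>" for \<sigma>
    unfolding cycle_weight_def using assms(1) by (intro prod_nonneg) auto
  hence h: "0 \<le> norm_const \<theta> n"
    unfolding norm_const_def by (intro divide_nonneg_nonneg sum_nonneg) auto
  have "(\<Sum>\<sigma> | \<sigma> permutes {1..n}. cycle_weight \<theta> n \<sigma> / (norm_const \<theta> n * fact n)) = 1"
    using assms(2) by (simp add: sum_divide_distrib[symmetric] norm_const_def)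
  thus "emeasure (perm_measure \<theta> n) (space (perm_measure \<theta> n)) = 1"
    unfolding perm_measure_def space_point_measure
    by (subst emeasure_point_measure_finite)
       (auto simp: finite_permutations sum_ennreal w h)
qed

section \<open>Standing assumptions\<close>

definition cycle_gf :: "(nat \<Rightarrow> real) \<Rightarrow> complex \<Rightarrow> complex" where
  "cycle_gf \<theta> t = (\<Sum>m. of_real (\<theta> (Suc m) / real (Suc m)) * t ^ Suc m)"

text \<open>
  Summability is required explicitly, since \<^const>\<open>suminf\<close> is also defined on divergent series.
  \<open>G\<close> is the (unique) continuous extension of the generating function to the punctured closed disc;
  the expansion at \<open>w = 0\<close> includes the points with \<open>Re w = 0\<close>, which \<open>exp (-w)\<close> maps to the unit circle.
\<close>

definition standing_assumptions :: "(nat \<Rightarrow> real) \<Rightarrow> nat \<Rightarrow> bool" where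
  "standing_assumptions \<theta> k \<longleftrightarrow>
     (\<forall>m\<ge>1. 0 \<le> \<theta> m) \<and>
     (\<forall>t::complex. norm t < 1 \<longrightarrow> summable (\<lambda>m. of_real (\<theta> (Suc m) / real (Suc m)) * t ^ Suc m)) \<and>
     cycle_gf \<theta> holomorphic_on ball 0 1 \<and>
     1 \<le> k \<and>
     (\<exists>(G :: complex \<Rightarrow> complex) (c :: nat \<Rightarrow> real).
        (\<forall>t\<in>ball 0 1. G t = cycle_gf \<theta> t) \<and>
        continuous_on (cball 0 1 - {1}) G \<and>
        (\<lambda>w. G (exp (- w)) -
             ((- Ln w) ^ (k + 1) / of_nat (k + 1) + (\<Sum>j\<le>k. of_real (c j) * (- Ln w) ^ j)))
          \<in> O[at 0 within {w. 0 \<le> Re w}](\<lambda>w. w))"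

section \<open>Laws, Poisson variables and total variation\<close>

definition law :: "'a measure \<Rightarrow> ('a \<Rightarrow> 'b) \<Rightarrow> 'b measure" where
  "law M X = distr M (count_space UNIV) X"

definition total_variation :: "'b::countable measure \<Rightarrow> 'b measure \<Rightarrow> real" where
  "total_variation \<mu> \<nu> = (\<Sum>\<^sub>\<infinity>a. \<bar>measure \<mu> {a} - measure \<nu> {a}\<bar>) / 2"

text \<open>
  Rate 0 must be allowed (\<open>\<theta>\<^sub>m = 0\<close>), whereas \<^const>\<open>poisson_pmf\<close> is specified for positive rates only.
  With \<open>0 ^ 0 = 1\<close> the formula below gives the point mass at 0 in that case.
\<close>

definition poisson_distributed :: "'a measure \<Rightarrow> ('a \<Rightarrow> nat) \<Rightarrow> real \<Rightarrow> bool" where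
  "poisson_distributed M X r \<longleftrightarrow> X \<in> measurable M (count_space UNIV) \<and>
     (\<forall>j. measure (law M X) {j} = r ^ j / fact j * exp (- r))"

text \<open>The random vectors \<open>(C\<^sub>1, \<dots>, C\<^sub>b)\<close> and \<open>(Y\<^sub>1, \<dots>, Y\<^sub>b)\<close> are lists of length \<open>b\<close>.\<close>

definition tv_cycles_poisson ::
  "(nat \<Rightarrow> real) \<Rightarrow> 'a measure \<Rightarrow> (nat \<Rightarrow> 'a \<Rightarrow> nat) \<Rightarrow> nat \<Rightarrow> nat \<Rightarrow> real" where
  "tv_cycles_poisson \<theta> M Y b n =
     total_variation
       (law (perm_measure \<theta> n) (\<lambda>\<sigma>. map (\<lambda>m. cycle_count n \<sigma> m) [1..<Suc b]))
       (law M (\<lambda>\<omega>. map (\<lambda>m. Y m \<omega>) [1..<Suc b]))"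

end

theory Submission
  imports
    Defs
    "HOL-Complex_Analysis.Complex_Analysis"
    "HOL-Real_Asymp.Real_Asymp"
begin

text \<open>
  By Cauchy's formula for cycle types, the law of \<open>(C\<^sub>1, \<dots>, C\<^sub>b)\<close> has, with respect to the Poisson
  law, the density \<open>exp (\<Sum>\<^sub>m\<^sub>\<le>\<^sub>b \<theta>\<^sub>m / m) * h'\<^sub>n\<^sub>-\<^sub>r / h\<^sub>n\<close> at a point with \<open>r = \<Sum> m a\<^sub>m\<close>, where \<open>h'\<close> belongs to
  the weights with \<open>\<theta>\<^sub>1, \<dots>, \<theta>\<^sub>b\<close> set to 0. By Markov's inequality \<open>r \<le> n powr c2\<close> with high probability for
  every \<open>c2 > c\<close>, so it suffices that this density tends to 1 uniformly for such \<open>r\<close>.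

  Both \<open>h\<^sub>n\<close> and \<open>h'\<^sub>n\<^sub>-\<^sub>r\<close> are integrals of \<open>exp (g t) / t ^ n\<close> over the same circle through the saddle point of
  \<open>P (- ln w) + n w\<close>, where \<open>t = exp (- w)\<close>; the second integrand carries the extra factor
  \<open>t ^ r * exp (g\<^sub>b 1 - g\<^sub>b t)\<close>. For \<open>\<bar>Im w\<bar> \<le> n powr (- d)\<close> with \<open>c2 < d\<close> this factor is close to 1, and
  dominated convergence yields the same Gaussian limit for both integrals. On the rest of the circle the
  factor is at most \<open>exp (2 * g\<^sub>b 1)\<close>, which is beaten by the saddle value \<open>exp (P (ln n))\<close> because \<open>d\<close> can
  be chosen with \<open>5 * d ^ (k + 1) < 1\<close>.
\<close>

text \<open>Let \<open>Q\<close> be the polynomial \<open>P\<close> with its coefficients replaced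
  by absolute values. The 5 counts multiples of \<open>Q (d * ln n)\<close>: away from the window
  the integrand costs one, and as \<open>g\<^sub>b 1\<close> is at most about
  \<open>2 * Q (d * ln n)\<close>, the extra factor costs four more. Since
  \<open>Q (d * ln n)\<close> grows like \<open>d ^ (k + 1)\<close> times the saddle exponent
  \<open>P (L n)\<close>, the condition on \<open>d\<close> is what is required; the hypothesis on
  \<open>c\<close> leaves room for it because \<open>3 * k + 3 \<ge> 6\<close>. No asymptotic
  formula for \<open>h\<^sub>n\<close> is derived. Keeping the saddle point of
  \<open>h\<^sub>n\<close> for all truncations and all shifts \<open>r\<close> gives every integral
  the same prefactor, which cancels in the ratio. The limit is proved along arbitrary sequences
  \<open>r n\<close>; uniformity follows by choosing the worst \<open>r\<close> for each
  \<open>n\<close>. A lower bound for the density is enough, because both laws have total mass 1: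
  where the cycle law has too much mass, it is compensated by a deficit elsewhere.\<close>

section \<open>Cycle types of permutations\<close>

text \<open>Composing with the transposition splices \<open>N\<close> into the cycle of
  \<open>j\<close>: the element that \<tau> sent to \<open>j\<close> now goes to \<open>N\<close>,
  and \<open>N\<close> goes to \<open>j\<close>. All other arrows are kept. This is how permutations
  of \<open>n + 1\<close> points are built from those of \<open>n\<close>.\<close>

lemma orbit_insert_transpose:
  assumes \<tau>: "\<tau> permutes A" and A: "finite A" "N \<notin> A" and j: "j \<in> A"
  shows "x \<in> insert N (orbit \<tau> j) \<Longrightarrow> orbit (Transposition.transpose N j \<circ> \<tau>) x = insert N (orbit \<tau> j)"
    and "x \<in> A - orbit \<tau> j \<Longrightarrow> orbit (Transposition.transpose N j \<circ> \<tau>) x = orbit \<tau> x"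
proof -
  define \<sigma> where "\<sigma> = Transposition.transpose N j \<circ> \<tau>"
  let ?D = "orbit \<tau> j"
  have perm\<tau>: "permutation \<tau>" using \<tau> A by (auto simp: permutation_permutes)
  have self: "y \<in> orbit \<tau> y" for y by (rule permutation_self_in_orbit[OF perm\<tau>])
  have sub: "orbit \<tau> y \<subseteq> A" if "y \<in> A" for y using permutes_orbit_subset[OF \<tau> that] .
  have \<tau>N: "\<tau> N = N" using \<tau> A by (meson permutes_not_in)
  have \<sigma>N: "\<sigma> N = j" using \<tau>N by (simp add: \<sigma>_def)
  have \<sigma>: "\<sigma> y = (if \<tau> y = j then N else \<tau> y)" if "y \<in> A" for y
    using permutes_in_image[OF \<tau>, of y] that A by (auto simp: \<sigma>_def Transposition.transpose_def)
  have perm\<sigma>: "permutation \<sigma>" unfolding \<sigma>_def by (intro permutation_compose perm\<tau> permutation_swap_id)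
  have "orbit \<sigma> N = insert N ?D"
  proof
    show "orbit \<sigma> N \<subseteq> insert N ?D"
    proof
      fix y assume "y \<in> orbit \<sigma> N"
      then show "y \<in> insert N ?D"
      proof (induction rule: orbit.induct)
        case base then show ?case using \<sigma>N self[of j] by auto
      next
        case (step y)
        then show ?case using \<sigma>N \<sigma>[of y] sub[OF j] self[of j] orbit.step[of y \<tau> j] by (auto split: if_splits)
      qed
    qed
    have jin: "j \<in> orbit \<sigma> N" using orbit.base[of \<sigma> N] \<sigma>N by simp
    \<comment> \<open>Along the \<tau>-orbit of \<open>j\<close> the two maps differ only at the
      return to \<open>j\<close>, and \<open>j\<close> has been reached already.\<close>
    have "y \<in> orbit \<sigma> N" if "y \<in> ?D" for y
      using that
    proof (induction rule: orbit.induct)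
      case base then show ?case using jin orbit.step[OF jin] \<sigma>[OF j] by (auto split: if_splits)
    next
      case (step y)
      then show ?case using jin orbit.step[of y \<sigma> N] \<sigma>[of y] sub[OF j] by (auto split: if_splits)
    qed
    then show "insert N ?D \<subseteq> orbit \<sigma> N" using permutation_self_in_orbit[OF perm\<sigma>] by auto
  qed
  moreover have "cyclic_on \<sigma> (orbit \<sigma> N)"
    using permutation_self_in_orbit[OF perm\<sigma>] by (auto simp: cyclic_on_def)
  ultimately have "cyclic_on \<sigma> (insert N ?D)" by simp
  then show "x \<in> insert N ?D \<Longrightarrow> orbit (Transposition.transpose N j \<circ> \<tau>) x = insert N ?D"
    unfolding \<sigma>_def using orbit_cyclic_eq3 by metis
  assume x: "x \<in> A - orbit \<tau> j"
  have nj: "j \<notin> orbit \<tau> x"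
    using x orbit_swap[OF self[of x]] by blast
  have "orbit \<tau> x = orbit \<sigma> x"
  proof (rule orbit_cong0[of x "orbit \<tau> x"])
    show "x \<in> orbit \<tau> x" by (rule self)
    show "\<tau> \<in> orbit \<tau> x \<rightarrow> orbit \<tau> x" by (auto intro: orbit.step)
    fix y assume y: "y \<in> orbit \<tau> x"
    then have "\<tau> y \<noteq> j" using nj orbit.step[OF y] by auto
    then show "\<tau> y = \<sigma> y" using \<sigma>[of y] y sub[of x] x by auto
  qed
  then show "orbit (Transposition.transpose N j \<circ> \<tau>) x = orbit \<tau> x" unfolding \<sigma>_def ..
qed

text \<open>The insertion with \<open>j = Suc n\<close>, where the transposition is the identity and
  a 1-cycle appears.\<close>

lemma cycle_count_insert_fixpoint:
  assumes \<tau>: "\<tau> permutes {1..n}"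
  shows "cycle_count (Suc n) \<tau> = (cycle_count n \<tau>)(1 := Suc (cycle_count n \<tau> 1))"
proof
  fix m
  let ?O = "orbit \<tau> ` {1..n}"
  have "\<tau> (Suc n) = Suc n" using \<tau> by (auto simp: permutes_def)
  then have orb: "orbit \<tau> (Suc n) = {Suc n}" by (simp add: orbit_eq_singleton_iff)
  have sub: "S \<subseteq> {1..n}" if "S \<in> ?O" for S using permutes_orbit_subset[OF \<tau>] that by (metis imageE)
  have "orbit \<tau> ` {1..Suc n} = insert {Suc n} ?O"
    using orb by (auto simp: atLeastAtMostSuc_conv)
  then have "{S \<in> orbit \<tau> ` {1..Suc n}. card S = m} =
      (if m = 1 then insert {Suc n} else id) {S \<in> ?O. card S = m}"
    by auto
  moreover have "{Suc n} \<notin> {S \<in> ?O. card S = m}" using sub by fastforce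
  ultimately show "cycle_count (Suc n) \<tau> m = ((cycle_count n \<tau>)(1 := Suc (cycle_count n \<tau> 1))) m"
    by (auto simp: cycle_count_def)
qed

text \<open>One cycle grows from length \<open>l\<close> to \<open>Suc l\<close>. The truncated
  subtraction is exact because the cycle of \<open>j\<close> is itself among those counted.\<close>

lemma cycle_count_insert_transpose:
  assumes \<tau>: "\<tau> permutes {1..n}" and j: "j \<in> {1..n}"
  defines "l \<equiv> card (orbit \<tau> j)"
  shows "cycle_count (Suc n) (Transposition.transpose (Suc n) j \<circ> \<tau>) =
    (cycle_count n \<tau>)(l := cycle_count n \<tau> l - 1, Suc l := Suc (cycle_count n \<tau> (Suc l)))"
proof
  fix m
  let ?O = "orbit \<tau> ` {1..n}" and ?\<sigma> = "Transposition.transpose (Suc n) j \<circ> \<tau>" and ?D = "orbit \<tau> j"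
  let ?E = "insert (Suc n) ?D"
  have perm\<tau>: "permutation \<tau>" using \<tau> by (auto simp: permutation_permutes)
  have self: "y \<in> orbit \<tau> y" for y by (rule permutation_self_in_orbit[OF perm\<tau>])
  have sub: "S \<subseteq> {1..n}" if "S \<in> ?O" for S using permutes_orbit_subset[OF \<tau>] that by (metis imageE)
  have D: "?D \<in> ?O" using j by auto
  note ins = orbit_insert_transpose[OF \<tau> _ _ j, of "Suc n", simplified]
  have eqD: "orbit \<tau> y = ?D" if "y \<in> ?D" for y
    using orbit_swap[OF self that] that by (meson orbit_trans subsetI subset_antisym)
  have img: "orbit ?\<sigma> ` {1..Suc n} = insert ?E (?O - {?D})"
  proof -
    have "orbit ?\<sigma> ` {1..Suc n} = orbit ?\<sigma> ` ?E \<union> orbit ?\<sigma> ` ({1..n} - ?D)"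
      using sub[OF D] by (auto simp: atLeastAtMostSuc_conv)
    also have "orbit ?\<sigma> ` ?E = {?E}" using ins(1) by auto
    also have "orbit ?\<sigma> ` ({1..n} - ?D) = orbit \<tau> ` ({1..n} - ?D)"
      by (rule image_cong) (use ins(2) in auto)
    also have "orbit \<tau> ` ({1..n} - ?D) = ?O - {?D}" using eqD self by blast
    finally show ?thesis unfolding insert_is_Un[of ?E "?O - {?D}"] .
  qed
  have fD: "finite ?D" using sub[OF D] finite_subset by blast
  have cE: "card ?E = Suc l" using sub[OF D] fD unfolding l_def by (subst card_insert_disjoint) auto
  have notin: "?E \<notin> ?O" using sub by fastforce
  have fin: "finite {S \<in> ?O. card S = m}" for m by auto
  have "{S \<in> orbit ?\<sigma> ` {1..Suc n}. card S = m} =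
      (if m = Suc l then insert ?E {S \<in> ?O. card S = m}
       else if m = l then {S \<in> ?O. card S = m} - {?D} else {S \<in> ?O. card S = m})"
    unfolding img using cE by (auto simp: l_def)
  moreover have "card ({S \<in> ?O. card S = l} - {?D}) = cycle_count n \<tau> l - 1"
    unfolding cycle_count_def using D by (subst card_Diff_singleton) (auto simp: l_def)
  moreover have "card (insert ?E {S \<in> ?O. card S = m}) = Suc (cycle_count n \<tau> m)"
    unfolding cycle_count_def using notin by (subst card_insert_disjoint) auto
  ultimately show "cycle_count (Suc n) ?\<sigma> m =
      ((cycle_count n \<tau>)(l := cycle_count n \<tau> l - 1, Suc l := Suc (cycle_count n \<tau> (Suc l)))) m"
    by (auto simp: cycle_count_def)
qed

text \<open>A cycle of length \<open>m\<close> is the orbit of exactly \<open>m\<close> points. This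
  turns the sum over insertion points into one that sees only the cycle type.\<close>

lemma sum_card_orbit:
  fixes h :: "nat \<Rightarrow> real"
  assumes \<tau>: "\<tau> permutes {1..n}"
  shows "(\<Sum>j=1..n. h (card (orbit \<tau> j))) = (\<Sum>m=1..n. real (m * cycle_count n \<tau> m) * h m)"
proof -
  let ?O = "orbit \<tau> ` {1..n}"
  have perm\<tau>: "permutation \<tau>" using \<tau> by (auto simp: permutation_permutes)
  have self: "y \<in> orbit \<tau> y" for y by (rule permutation_self_in_orbit[OF perm\<tau>])
  have sub: "S \<subseteq> {1..n}" if "S \<in> ?O" for S using permutes_orbit_subset[OF \<tau>] that by (metis imageE)
  have eqD: "orbit \<tau> y = orbit \<tau> j" if "y \<in> orbit \<tau> j" for y j
    using orbit_swap[OF self that] that by (meson orbit_trans subsetI subset_antisym)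
  have cls: "{j \<in> {1..n}. orbit \<tau> j = S} = S" if "S \<in> ?O" for S
    using that sub[OF that] eqD self by auto
  have crd: "card S \<in> {1..n}" if "S \<in> ?O" for S
    using that sub[OF that] self finite_subset[OF sub[OF that]] card_mono[OF _ sub[OF that]]
    by (auto simp: Suc_le_eq card_gt_0_iff)
  have "(\<Sum>j=1..n. h (card (orbit \<tau> j))) = (\<Sum>S\<in>?O. \<Sum>j | j \<in> {1..n} \<and> orbit \<tau> j = S. h (card (orbit \<tau> j)))"
    by (rule sum.group[symmetric]) auto
  also have "\<dots> = (\<Sum>S\<in>?O. real (card S) * h (card S))"
  proof (rule sum.cong[OF refl])
    fix S assume S: "S \<in> ?O"
    have "(\<Sum>j | j \<in> {1..n} \<and> orbit \<tau> j = S. h (card (orbit \<tau> j))) =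
        (\<Sum>j | j \<in> {1..n} \<and> orbit \<tau> j = S. h (card S))"
      by (intro sum.cong) auto
    then show "(\<Sum>j | j \<in> {1..n} \<and> orbit \<tau> j = S. h (card (orbit \<tau> j))) = real (card S) * h (card S)"
      unfolding cls[OF S] by simp
  qed
  also have "\<dots> = (\<Sum>m=1..n. \<Sum>S | S \<in> ?O \<and> card S = m. real (card S) * h (card S))"
    using crd by (intro sum.group[symmetric]) auto
  also have "\<dots> = (\<Sum>m=1..n. real (m * cycle_count n \<tau> m) * h m)"
    by (intro sum.cong refl) (simp add: cycle_count_def)
  finally show ?thesis .
qed

section \<open>Cycle types and their recursions\<close>

definition cycle_types :: "nat \<Rightarrow> (nat \<Rightarrow> nat) set" where
  "cycle_types n = {a. (\<forall>m. m = 0 \<or> n < m \<longrightarrow> a m = 0) \<and> (\<Sum>m=1..n. m * a m) = n}"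

text \<open>Cauchy's count of the permutations with cycle type \<open>a\<close>, divided by
  \<open>n!\<close>.\<close>

definition type_weight :: "nat \<Rightarrow> (nat \<Rightarrow> nat) \<Rightarrow> real" where
  "type_weight n a = (\<Prod>m=1..n. 1 / (real m ^ a m * fact (a m)))"

lemma cycle_types_le:
  assumes a: "a \<in> cycle_types n"
  shows "a m \<le> n"
proof (cases "m \<in> {1..n}")
  case True
  from a have "(\<Sum>m=1..n. m * a m) = n" by (simp add: cycle_types_def)
  moreover have "m * a m \<le> (\<Sum>m=1..n. m * a m)" using True by (intro member_le_sum) auto
  moreover have "a m \<le> m * a m" using True by auto
  ultimately show ?thesis by linarith
next
  case False
  then have "m = 0 \<or> n < m" by auto
  then show ?thesis using a by (auto simp: cycle_types_def)
qed

lemma finite_cycle_types [simp]: "finite (cycle_types n)"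
proof (rule finite_subset)
  show "cycle_types n \<subseteq> {a. \<forall>m. (m \<in> {1..n} \<longrightarrow> a m \<in> {..n}) \<and> (m \<notin> {1..n} \<longrightarrow> a m = 0)}"
  proof (intro subsetI CollectI allI conjI impI)
    fix a m assume a: "a \<in> cycle_types n"
    show "a m \<in> {..n}" using cycle_types_le[OF a] by simp
    assume "m \<notin> {1..n}"
    then have "m = 0 \<or> n < m" by auto
    then show "a m = 0" using a by (auto simp: cycle_types_def)
  qed
  show "finite {a. \<forall>m. (m \<in> {1..n} \<longrightarrow> a m \<in> {..n}) \<and> (m \<notin> {1..n} \<longrightarrow> a m = (0::nat))}"
    by (rule finite_set_of_finite_funs) auto
qed

text \<open>A nonzero count at some \<open>m > n\<close> would already make the sum exceed
  \<open>n\<close>. Hence types of different sizes can be compared over one common index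
  range.\<close>

lemma cycle_types_ext:
  assumes "n \<le> N"
  shows "a \<in> cycle_types n \<longleftrightarrow> (\<forall>m. m = 0 \<or> N < m \<longrightarrow> a m = 0) \<and> (\<Sum>m=1..N. m * a m) = n"
proof
  assume a: "a \<in> cycle_types n"
  then have "(\<Sum>m=1..N. m * a m) = (\<Sum>m=1..n. m * a m)"
    using assms by (intro sum.mono_neutral_right) (auto simp: cycle_types_def)
  then show "(\<forall>m. m = 0 \<or> N < m \<longrightarrow> a m = 0) \<and> (\<Sum>m=1..N. m * a m) = n"
    using a assms by (auto simp: cycle_types_def)
next
  assume a: "(\<forall>m. m = 0 \<or> N < m \<longrightarrow> a m = 0) \<and> (\<Sum>m=1..N. m * a m) = n"
  have z: "a m = 0" if "n < m" for m
  proof (cases "m \<le> N")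
    case True
    have "m * a m \<le> (\<Sum>m=1..N. m * a m)" using True that by (intro member_le_sum) auto
    then have "m * a m \<le> n" using a by simp
    show ?thesis
    proof (rule ccontr)
      assume "a m \<noteq> 0"
      then have "m \<le> m * a m" by simp
      with \<open>m * a m \<le> n\<close> that show False by linarith
    qed
  qed (use a in auto)
  then have "(\<Sum>m=1..N. m * a m) = (\<Sum>m=1..n. m * a m)"
    using assms by (intro sum.mono_neutral_right) auto
  then show "a \<in> cycle_types n" using a z by (auto simp: cycle_types_def)
qed

lemma type_weight_ext:
  assumes "n \<le> N" "a \<in> cycle_types n"
  shows "type_weight n a = (\<Prod>m=1..N. 1 / (real m ^ a m * fact (a m)))"
  unfolding type_weight_def using assms
  by (intro prod.mono_neutral_left) (auto simp: cycle_types_def)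

lemma type_weight_factor_Suc:
  assumes "m > 0"
  shows "real (m * Suc c) * (1 / (real m ^ Suc c * fact (Suc c))) = 1 / (real m ^ c * fact c)"
proof -
  have "real m ^ Suc c * fact (Suc c) = real (m * Suc c) * (real m ^ c * fact c)"
    by (simp only: fact_Suc power_Suc of_nat_mult mult_ac)
  moreover have "real (m * Suc c) \<noteq> 0" using assms by (simp del: of_nat_mult of_nat_Suc)
  ultimately show ?thesis by (simp del: of_nat_mult of_nat_Suc fact_Suc power_Suc)
qed

text \<open>The factor \<open>m * a m\<close> cancels one \<open>m\<close> and one factor of the
  factorial in the weight, leaving the weight of the type with one \<open>m\<close>-cycle
  fewer.\<close>

lemma sum_cycle_types_remove_cycle:
  fixes F :: "(nat \<Rightarrow> nat) \<Rightarrow> real"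
  assumes m: "m \<in> {1..n}"
  shows "(\<Sum>a\<in>cycle_types n. real (m * a m) * (type_weight n a * F a)) =
    (\<Sum>a\<in>cycle_types (n - m). type_weight (n - m) a * F (a(m := Suc (a m))))"
proof -
  let ?u = "\<lambda>m c. 1 / (real m ^ c * fact c)"
  let ?up = "\<lambda>a. a(m := Suc (a m))" and ?dn = "\<lambda>a. a(m := a m - 1)"
  have split: "(\<Sum>i=1..n. f i) = f m + (\<Sum>i\<in>{1..n} - {m}. f i)" for f :: "nat \<Rightarrow> nat"
    by (rule sum.remove) (use m in auto)
  have psplit: "(\<Prod>i=1..n. f i) = f m * (\<Prod>i\<in>{1..n} - {m}. f i)" for f :: "nat \<Rightarrow> real"
    by (rule prod.remove) (use m in auto)
  have up: "?up a \<in> cycle_types n" if a: "a \<in> cycle_types (n - m)" for a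
  proof -
    have "(\<Sum>i=1..n. i * ?up a i) = (\<Sum>i=1..n. i * a i) + m"
      unfolding split by simp
    then show ?thesis using a m cycle_types_ext[of "n - m" n a] by (auto simp: cycle_types_def[of n])
  qed
  have dn: "?dn a \<in> cycle_types (n - m)" if a: "a \<in> cycle_types n" "a m > 0" for a
  proof -
    obtain c where c: "a m = Suc c" using a(2) gr0_conv_Suc by auto
    have "(\<Sum>i=1..n. i * ?dn a i) + m = (\<Sum>i=1..n. i * a i)"
      unfolding split using c by simp
    then show ?thesis using a m by (subst cycle_types_ext[of "n - m" n]) (auto simp: cycle_types_def)
  qed
  \<comment> \<open>The factor \<open>m * a m\<close> kills the types without an
    \<open>m\<close>-cycle; on the others \<open>?dn\<close> is a true inverse of
    \<open>?up\<close>.\<close>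
  have "(\<Sum>a\<in>cycle_types n. real (m * a m) * (type_weight n a * F a)) =
      (\<Sum>a | a \<in> cycle_types n \<and> a m > 0. real (m * a m) * (type_weight n a * F a))"
    by (intro sum.mono_neutral_right) auto
  also have "\<dots> = (\<Sum>a\<in>cycle_types (n - m). type_weight (n - m) a * F (?up a))"
  proof (rule sum.reindex_bij_witness[of _ ?up ?dn], goal_cases)
    case (5 a)
    obtain c where c: "a m = Suc c" using 5 gr0_conv_Suc by auto
    have "type_weight (n - m) (?dn a) = (\<Prod>i=1..n. ?u i (?dn a i))"
      by (intro type_weight_ext dn) (use 5 in auto)
    also have "\<dots> = ?u m c * (\<Prod>i\<in>{1..n} - {m}. ?u i (a i))"
      unfolding psplit using c by simp
    finally have 1: "type_weight (n - m) (?dn a) = \<dots>" .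
    have "real (m * Suc c) * ?u m (Suc c) = ?u m c"
      by (rule type_weight_factor_Suc) (use m in simp)
    then have 2: "real (m * a m) * type_weight n a = ?u m c * (\<Prod>i\<in>{1..n} - {m}. ?u i (a i))"
      unfolding type_weight_def psplit c by (simp only: mult.assoc[symmetric])
    have up_dn: "?up (?dn a) = a" using c by auto
    show ?case unfolding up_dn 1 2[symmetric] by (simp only: mult.assoc)
  qed (use up dn in auto)
  finally show ?thesis .
qed

text \<open>On a cycle type \<open>n\<close> equals the sum of the \<open>m * a m\<close>; each
  summand removes one cycle.\<close>

lemma sum_cycle_types_rec:
  fixes F :: "(nat \<Rightarrow> nat) \<Rightarrow> real"
  shows "real n * (\<Sum>a\<in>cycle_types n. type_weight n a * F a) =
    (\<Sum>m=1..n. \<Sum>a\<in>cycle_types (n - m). type_weight (n - m) a * F (a(m := Suc (a m))))"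
proof -
  have "real n * (\<Sum>a\<in>cycle_types n. type_weight n a * F a)
      = (\<Sum>a\<in>cycle_types n. (\<Sum>m=1..n. real (m * a m)) * (type_weight n a * F a))"
    unfolding sum_distrib_left
  proof (intro sum.cong refl)
    fix a assume "a \<in> cycle_types n"
    then have "(\<Sum>m=1..n. m * a m) = n" by (simp add: cycle_types_def)
    then have "(\<Sum>m=1..n. real (m * a m)) = real n"
      by (metis of_nat_sum)
    then show "real n * (type_weight n a * F a) = (\<Sum>m=1..n. real (m * a m)) * (type_weight n a * F a)" by simp
  qed
  also have "\<dots> = (\<Sum>m=1..n. \<Sum>a\<in>cycle_types n. real (m * a m) * (type_weight n a * F a))"
    by (simp only: sum_distrib_right) (rule sum.swap)
  also have "\<dots> = (\<Sum>m=1..n. \<Sum>a\<in>cycle_types (n - m). type_weight (n - m) a * F (a(m := Suc (a m))))"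
    by (rule sum.cong[OF refl sum_cycle_types_remove_cycle])
  finally show ?thesis .
qed

text \<open>The right-hand side has the shape of the insertion of one more point into a permutation:
  a new fixed point, or one of the \<open>m * a m\<close> places in cycles of length
  \<open>m\<close>.\<close>

lemma sum_cycle_types_Suc:
  fixes F :: "(nat \<Rightarrow> nat) \<Rightarrow> real"
  shows "real (Suc n) * (\<Sum>a\<in>cycle_types (Suc n). type_weight (Suc n) a * F a) =
    (\<Sum>a\<in>cycle_types n. type_weight n a * (F (a(1 := Suc (a 1))) +
       (\<Sum>m=1..n. real (m * a m) * F (a(m := a m - 1, Suc m := Suc (a (Suc m)))))))"
proof -
  let ?f = "\<lambda>m. \<Sum>a\<in>cycle_types (Suc n - m). type_weight (Suc n - m) a * F (a(m := Suc (a m)))"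
  let ?up = "\<lambda>m a. a(m := a m - 1, Suc m := Suc (a (Suc m)))"
  have "real (Suc n) * (\<Sum>a\<in>cycle_types (Suc n). type_weight (Suc n) a * F a) = (\<Sum>m=1..Suc n. ?f m)"
    by (rule sum_cycle_types_rec)
  also have "\<dots> = ?f 1 + (\<Sum>m=Suc 1..Suc n. ?f m)" by (rule sum.atLeast_Suc_atMost) auto
  also have "(\<Sum>m=Suc 1..Suc n. ?f m) = (\<Sum>m=1..n. ?f (Suc m))" by (rule sum.shift_bounds_cl_Suc_ivl)
  also have "\<dots> = (\<Sum>m=1..n. \<Sum>a\<in>cycle_types n. real (m * a m) * (type_weight n a * F (?up m a)))"
  proof (rule sum.cong[OF refl])
    \<comment> \<open>Size \<open>n - m\<close> remains both after removing a cycle of length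
      \<open>Suc m\<close> from size \<open>Suc n\<close> and after removing an
      \<open>m\<close>-cycle from size \<open>n\<close>; the removal lemma is read
      backwards.\<close>
    fix m assume m: "m \<in> {1..n}"
    show "?f (Suc m) = (\<Sum>a\<in>cycle_types n. real (m * a m) * (type_weight n a * F (?up m a)))"
      unfolding sum_cycle_types_remove_cycle[OF m, of "\<lambda>a. F (?up m a)"] by (simp add: fun_upd_idem)
  qed
  also have "\<dots> = (\<Sum>a\<in>cycle_types n. \<Sum>m=1..n. type_weight n a * (real (m * a m) * F (?up m a)))"
    by (subst sum.swap) (simp only: mult.left_commute)
  finally show ?thesis
    by (simp only: sum.distrib[symmetric] distrib_left sum_distrib_left diff_Suc_1)
qed

text \<open>Cauchy's formula for the number of permutations of a given cycle type, as an identity of sums.\<close>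

lemma sum_permutations_cycle_count:
  fixes F :: "(nat \<Rightarrow> nat) \<Rightarrow> real"
  shows "(\<Sum>\<sigma> | \<sigma> permutes {1..n}. F (cycle_count n \<sigma>)) =
    fact n * (\<Sum>a\<in>cycle_types n. type_weight n a * F a)"
proof (induction n arbitrary: F)
  case 0
  have "cycle_count 0 \<sigma> = (\<lambda>_. 0)" for \<sigma> by (auto simp: cycle_count_def)
  moreover have "cycle_types 0 = {\<lambda>_. 0}" by (auto simp: cycle_types_def)
  ultimately show ?case by (simp add: type_weight_def)
next
  case (Suc n)
  let ?G = "\<lambda>a. F (a(1 := Suc (a 1))) +
       (\<Sum>m=1..n. real (m * a m) * F (a(m := a m - 1, Suc m := Suc (a (Suc m)))))"
  have ins: "{1..Suc n} = insert (Suc n) {1..n}" by auto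
  \<comment> \<open>Every permutation of \<open>{1..Suc n}\<close> arises from exactly one insertion
    of \<open>Suc n\<close>.\<close>
  have "(\<Sum>\<sigma> | \<sigma> permutes {1..Suc n}. F (cycle_count (Suc n) \<sigma>)) =
      (\<Sum>j\<in>{1..Suc n}. \<Sum>\<tau> | \<tau> permutes {1..n}. F (cycle_count (Suc n) (Transposition.transpose (Suc n) j \<circ> \<tau>)))"
    unfolding ins by (rule sum_over_permutations_insert) auto
  also have "\<dots> = (\<Sum>\<tau> | \<tau> permutes {1..n}. \<Sum>j\<in>{1..Suc n}. F (cycle_count (Suc n) (Transposition.transpose (Suc n) j \<circ> \<tau>)))"
    by (rule sum.swap)
  also have "\<dots> = (\<Sum>\<tau> | \<tau> permutes {1..n}. ?G (cycle_count n \<tau>))"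
  proof (intro sum.cong refl)
    fix \<tau> assume "\<tau> \<in> {\<tau>. \<tau> permutes {1..n}}"
    then have \<tau>: "\<tau> permutes {1..n}" by simp
    let ?c = "cycle_count n \<tau>"
    let ?h = "\<lambda>m. F (?c(m := ?c m - 1, Suc m := Suc (?c (Suc m))))"
    have "(\<Sum>j\<in>{1..Suc n}. F (cycle_count (Suc n) (Transposition.transpose (Suc n) j \<circ> \<tau>))) =
        F (cycle_count (Suc n) \<tau>) + (\<Sum>j=1..n. F (cycle_count (Suc n) (Transposition.transpose (Suc n) j \<circ> \<tau>)))"
      unfolding ins by (subst sum.insert) auto
    also have "(\<Sum>j=1..n. F (cycle_count (Suc n) (Transposition.transpose (Suc n) j \<circ> \<tau>))) = (\<Sum>j=1..n. ?h (card (orbit \<tau> j)))"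
      using cycle_count_insert_transpose[OF \<tau>] by (intro sum.cong refl) simp
    also have "\<dots> = (\<Sum>m=1..n. real (m * ?c m) * ?h m)" by (rule sum_card_orbit[OF \<tau>])
    finally show "(\<Sum>j\<in>{1..Suc n}. F (cycle_count (Suc n) (Transposition.transpose (Suc n) j \<circ> \<tau>))) =
      ?G ?c"
      by (simp only: cycle_count_insert_fixpoint[OF \<tau>])
  qed
  also have "\<dots> = fact n * (\<Sum>a\<in>cycle_types n. type_weight n a * ?G a)" by (rule Suc.IH)
  also have "\<dots> = fact n * (real (Suc n) * (\<Sum>a\<in>cycle_types (Suc n). type_weight (Suc n) a * F a))"
    by (simp only: sum_cycle_types_Suc)
  finally show ?case by (simp add: algebra_simps)
qed

lemma cycle_types_weighted_ext:
  fixes x :: "nat \<Rightarrow> real"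
  assumes "n \<le> N" "a \<in> cycle_types n"
  shows "(\<Prod>m=1..n. (x m / real m) ^ a m / fact (a m)) = (\<Prod>m=1..N. (x m / real m) ^ a m / fact (a m))"
  using assms by (intro prod.mono_neutral_left) (auto simp: cycle_types_def)

lemma type_weight_prod:
  fixes x :: "nat \<Rightarrow> real"
  shows "type_weight n a * (\<Prod>m=1..n. x m ^ a m) = (\<Prod>m=1..n. (x m / real m) ^ a m / fact (a m))"
  unfolding type_weight_def prod.distrib[symmetric] by (intro prod.cong refl) (simp add: power_divide)

lemma norm_const_eq_sum_type_weight:
  "norm_const x n = (\<Sum>a\<in>cycle_types n. type_weight n a * (\<Prod>m=1..n. x m ^ a m))"
  unfolding norm_const_def cycle_weight_def
  using sum_permutations_cycle_count[of "\<lambda>a. \<Prod>m=1..n. x m ^ a m" n] by simp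

lemma norm_const_eq_sum_cycle_types:
  "norm_const x n = (\<Sum>a\<in>cycle_types n. \<Prod>m=1..n. (x m / real m) ^ a m / fact (a m))"
  unfolding norm_const_eq_sum_type_weight type_weight_prod ..

text \<open>The coefficient form of \<open>H' = g' * H\<close> for the generating function
  \<open>H\<close> of the normalization constants; with \<open>norm_const_0\<close> it yields
  \<open>H = exp g\<close>.\<close>

lemma norm_const_rec:
  "real n * norm_const x n = (\<Sum>m=1..n. x m * norm_const x (n - m))"
  unfolding norm_const_eq_sum_type_weight sum_cycle_types_rec
proof (rule sum.cong[OF refl])
  fix m assume m: "m \<in> {1..n}"
  have "(\<Prod>i=1..n. x i ^ (a(m := Suc (a m))) i) = x m * (\<Prod>i=1..n - m. x i ^ a i)"
    if a: "a \<in> cycle_types (n - m)" for a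
  proof -
    have "(\<Prod>i=1..n. x i ^ (a(m := Suc (a m))) i) = x m ^ Suc (a m) * (\<Prod>i\<in>{1..n} - {m}. x i ^ a i)"
      using m by (subst prod.remove[of _ m]) auto
    also have "\<dots> = x m * (\<Prod>i=1..n. x i ^ a i)"
      using m by (subst (2) prod.remove[of _ m]) auto
    also have "(\<Prod>i=1..n. x i ^ a i) = (\<Prod>i=1..n - m. x i ^ a i)"
      using a by (intro prod.mono_neutral_right) (auto simp: cycle_types_def)
    finally show ?thesis .
  qed
  then show "(\<Sum>a\<in>cycle_types (n - m). type_weight (n - m) a * (\<Prod>i=1..n. x i ^ (a(m := Suc (a m))) i)) =
      x m * (\<Sum>a\<in>cycle_types (n - m). type_weight (n - m) a * (\<Prod>i=1..n - m. x i ^ a i))"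
    unfolding sum_distrib_left by (intro sum.cong refl) simp
qed

text \<open>Erasing the prescribed small cycles maps these types bijectively to the types of size
  \<open>n - r\<close> without cycles of length at most \<open>b\<close>, and the weight factorizes.
  Setting the small weights to 0 selects those types.\<close>

lemma sum_cycle_weight_fixed_small_counts:
  assumes b: "b \<le> n" and r: "(\<Sum>m=1..b. m * \<alpha> m) \<le> n"
  shows "(\<Sum>\<sigma> | \<sigma> permutes {1..n} \<and> (\<forall>m\<in>{1..b}. cycle_count n \<sigma> m = \<alpha> m). cycle_weight \<theta> n \<sigma>) =
    fact n * ((\<Prod>m=1..b. (\<theta> m / real m) ^ \<alpha> m / fact (\<alpha> m)) *
      norm_const (\<lambda>m. if m \<le> b then 0 else \<theta> m) (n - (\<Sum>m=1..b. m * \<alpha> m)))"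
proof -
  let ?r = "\<Sum>m=1..b. m * \<alpha> m" and ?x = "\<lambda>m. if m \<le> b then 0 else \<theta> m"
  let ?f = "\<lambda>y m c. (y m / real m) ^ c / fact c :: real"
  let ?F = "\<lambda>a. (if \<forall>m\<in>{1..b}. a m = \<alpha> m then 1 else 0) * (\<Prod>m=1..n. \<theta> m ^ a m)"
  let ?i = "\<lambda>a m. if m \<in> {1..b} then \<alpha> m else a m" and ?j = "\<lambda>a m. if m \<in> {1..b} then 0 else a m"
  have split: "{1..n} = {1..b} \<union> {b<..n}" using b by auto
  have ssplit: "(\<Sum>m=1..n. f m) = (\<Sum>m=1..b. f m) + (\<Sum>m\<in>{b<..n}. f m)" for f :: "nat \<Rightarrow> nat"
    unfolding split by (rule sum.union_disjoint) auto
  have psplit: "(\<Prod>m=1..n. f m) = (\<Prod>m=1..b. f m) * (\<Prod>m\<in>{b<..n}. f m)" for f :: "nat \<Rightarrow> real"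
    unfolding split by (rule prod.union_disjoint) auto
  have j_type: "?j a \<in> cycle_types (n - ?r)" if a: "a \<in> cycle_types n" "\<forall>m\<in>{1..b}. a m = \<alpha> m" for a
  proof -
    have "(\<Sum>m=1..b. m * a m) = ?r" using a by (intro sum.cong) auto
    moreover have "(\<Sum>m\<in>{b<..n}. m * ?j a m) = (\<Sum>m\<in>{b<..n}. m * a m)" by (intro sum.cong) auto
    moreover have "(\<Sum>m=1..b. m * ?j a m) = 0" by simp
    ultimately have "(\<Sum>m=1..n. m * ?j a m) + ?r = (\<Sum>m=1..n. m * a m)" unfolding ssplit by linarith
    then show ?thesis
      using a by (subst cycle_types_ext[of "n - ?r" n]) (auto simp: cycle_types_def[of n])
  qed
  have "(\<Sum>\<sigma> | \<sigma> permutes {1..n} \<and> (\<forall>m\<in>{1..b}. cycle_count n \<sigma> m = \<alpha> m). cycle_weight \<theta> n \<sigma>) =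
      (\<Sum>\<sigma> | \<sigma> permutes {1..n}. ?F (cycle_count n \<sigma>))"
    by (intro sum.mono_neutral_cong_left) (auto simp: finite_permutations cycle_weight_def)
  also have "\<dots> = fact n * (\<Sum>a\<in>cycle_types n. type_weight n a * ?F a)"
    by (rule sum_permutations_cycle_count)
  also have "(\<Sum>a\<in>cycle_types n. type_weight n a * ?F a) =
      (\<Sum>a | a \<in> cycle_types n \<and> (\<forall>m\<in>{1..b}. a m = \<alpha> m). \<Prod>m=1..n. ?f \<theta> m (a m))"
    by (intro sum.mono_neutral_cong_right) (auto simp: type_weight_prod[unfolded One_nat_def])
  also have "\<dots> = (\<Sum>a | a \<in> cycle_types (n - ?r) \<and> (\<forall>m\<in>{1..b}. a m = 0).
      (\<Prod>m=1..b. ?f \<theta> m (\<alpha> m)) * (\<Prod>m=1..n - ?r. ?f ?x m (a m)))"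
  proof (rule sum.reindex_bij_witness[of _ ?i ?j], goal_cases)
    case (1 a) then show ?case by auto
  next
    case (2 a) then show ?case using j_type[of a] by auto
  next
    case (3 a) then show ?case by auto
  next
    case (4 a)
    have "(\<Sum>m=1..n. m * ?i a m) = (\<Sum>m=1..n. m * a m) + ?r"
    proof -
      have "(\<Sum>m=1..b. m * ?i a m) = ?r" by (intro sum.cong) auto
      moreover have "(\<Sum>m\<in>{b<..n}. m * ?i a m) = (\<Sum>m\<in>{b<..n}. m * a m)" by (intro sum.cong) auto
      moreover have "(\<Sum>m=1..b. m * a m) = 0" using 4 by simp
      ultimately show ?thesis unfolding ssplit by linarith
    qed
    moreover have "(\<Sum>m=1..n. m * a m) = n - ?r" "\<forall>m. m = 0 \<or> n < m \<longrightarrow> a m = 0"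
      using 4 cycle_types_ext[of "n - ?r" n a] by auto
    ultimately have "?i a \<in> cycle_types n"
      using r b by (auto simp: cycle_types_def[of n])
    then show ?case by auto
  next
    case (5 a)
    have "?j a \<in> cycle_types (n - ?r)" using 5 j_type[of a] by auto
    then have "(\<Prod>m=1..n - ?r. ?f ?x m (?j a m)) = (\<Prod>m=1..n. ?f ?x m (?j a m))"
      by (intro cycle_types_weighted_ext) auto
    also have "\<dots> = (\<Prod>m\<in>{b<..n}. ?f \<theta> m (a m))"
    proof -
      \<comment> \<open>Each of these factors is \<open>0 ^ 0 / fact 0\<close>.\<close>
      have "(\<Prod>m=1..b. ?f ?x m (?j a m)) = 1" by (intro prod.neutral) auto
      moreover have "(\<Prod>m\<in>{b<..n}. ?f ?x m (?j a m)) = (\<Prod>m\<in>{b<..n}. ?f \<theta> m (a m))"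
        by (intro prod.cong) auto
      ultimately show ?thesis unfolding psplit by simp
    qed
    finally have "(\<Prod>m=1..n - ?r. ?f ?x m (?j a m)) = \<dots>" .
    moreover have "(\<Prod>m=1..b. ?f \<theta> m (a m)) = (\<Prod>m=1..b. ?f \<theta> m (\<alpha> m))"
      using 5 by (intro prod.cong) auto
    ultimately show ?case by (simp only: psplit)
  qed
  \<comment> \<open>Types that do contain a small cycle may be added: they carry a factor
    \<open>0 ^ a m\<close> with \<open>a m > 0\<close>.\<close>
  also have "\<dots> = (\<Sum>a\<in>cycle_types (n - ?r). (\<Prod>m=1..b. ?f \<theta> m (\<alpha> m)) * (\<Prod>m=1..n - ?r. ?f ?x m (a m)))"
  proof (rule sum.mono_neutral_left)
    show "\<forall>a\<in>cycle_types (n - ?r) - {a \<in> cycle_types (n - ?r). \<forall>m\<in>{1..b}. a m = 0}.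
        (\<Prod>m=1..b. ?f \<theta> m (\<alpha> m)) * (\<Prod>m=1..n - ?r. ?f ?x m (a m)) = 0"
    proof
      fix a assume "a \<in> cycle_types (n - ?r) - {a \<in> cycle_types (n - ?r). \<forall>m\<in>{1..b}. a m = 0}"
      then obtain m where m: "a \<in> cycle_types (n - ?r)" "m \<in> {1..b}" "a m \<noteq> 0" by auto
      then have "m \<in> {1..n - ?r}" unfolding cycle_types_def by (auto simp: not_less[symmetric])
      moreover have "?f ?x m (a m) = 0" using m by auto
      ultimately have "(\<Prod>m=1..n - ?r. ?f ?x m (a m)) = 0" by (intro prod_zero) auto
      then show "(\<Prod>m=1..b. ?f \<theta> m (\<alpha> m)) * (\<Prod>m=1..n - ?r. ?f ?x m (a m)) = 0" by simp
    qed
  qed auto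
  also have "\<dots> = (\<Prod>m=1..b. ?f \<theta> m (\<alpha> m)) * norm_const ?x (n - ?r)"
    by (simp only: norm_const_eq_sum_cycle_types sum_distrib_left)
  finally show ?thesis .
qed

section \<open>The generating function of the normalization constants\<close>

text \<open>Both series have constant term 1 and satisfy \<open>E' = E * A'\<close>, which
  determines the coefficients successively.\<close>

lemma fps_exp_compose_rec:
  fixes z h :: "nat \<Rightarrow> complex"
  assumes h0: "h 0 = 1" and rec: "\<And>n. of_nat n * h n = (\<Sum>m=1..n. z m * h (n - m))"
  shows "fps_exp 1 oo Abs_fps (\<lambda>m. z m / of_nat m) = Abs_fps h"
proof -
  let ?A = "Abs_fps (\<lambda>m. z m / of_nat m)"
  let ?E = "fps_exp 1 oo ?A"
  \<comment> \<open>Division by zero makes this coefficient 0 whatever \<open>z 0\<close> is, so the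
    index 0 does not disturb the composition.\<close>
  have A0: "fps_nth ?A 0 = 0" by simp
  have dE: "fps_deriv ?E = ?E * fps_deriv ?A"
    by (simp add: fps_compose_deriv[OF A0])
  have "fps_nth ?E n = h n" for n
  proof (induction n rule: less_induct)
    case (less n)
    show ?case
    proof (cases n)
      case 0
      then show ?thesis by (simp add: h0 fps_compose_nth)
    next
      case (Suc k)
      have "of_nat (Suc k) * fps_nth ?E (Suc k) = fps_nth (fps_deriv ?E) k" by simp
      also have "\<dots> = (\<Sum>i=0..k. fps_nth ?E i * fps_nth (fps_deriv ?A) (k - i))"
        unfolding dE by (simp add: fps_mult_nth)
      also have "\<dots> = (\<Sum>i=0..k. h i * z (Suc (k - i)))"
        using less Suc by (intro sum.cong) (auto simp del: of_nat_Suc)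
      also have "\<dots> = (\<Sum>m=1..Suc k. z m * h (Suc k - m))"
        by (rule sum.reindex_bij_witness[of _ "\<lambda>m. Suc k - m" "\<lambda>i. Suc k - i"]) (auto simp: Suc_diff_le)
      also have "\<dots> = of_nat (Suc k) * h (Suc k)" by (rule rec[symmetric])
      finally have "of_nat (Suc k) * fps_nth ?E (Suc k) = of_nat (Suc k) * h (Suc k)" .
      then have "fps_nth ?E (Suc k) = h (Suc k)" by (metis mult_left_cancel of_nat_neq_0)
      then show ?thesis using Suc by simp
    qed
  qed
  then show ?thesis by (simp add: fps_eq_iff)
qed

lemma cycle_gf_eq_eval_fps:
  assumes "norm t < 1" "summable (\<lambda>m. of_real (x (Suc m) / real (Suc m)) * t ^ Suc m)"
  shows "cycle_gf x t = eval_fps (Abs_fps (\<lambda>m. of_real (x m) / of_nat m)) t"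
proof -
  let ?f = "\<lambda>m. of_real (x m) / of_nat m * t ^ m :: complex"
  have "summable (\<lambda>m. ?f (Suc m))" using assms(2) by simp
  then have "(\<Sum>m. ?f (Suc m)) = suminf ?f - ?f 0"
    by (intro suminf_split_head) (simp only: summable_Suc_iff[of ?f])
  then show ?thesis by (simp add: cycle_gf_def eval_fps_def)
qed

text \<open>Stated for arbitrary weights, since it is applied to sign-twisted versions of possibly
  truncated weights.\<close>

lemma cycle_gf_holomorphic_expansion:
  fixes x :: "nat \<Rightarrow> real"
  assumes summ: "\<And>t::complex. norm t < 1 \<Longrightarrow> summable (\<lambda>m. of_real (x (Suc m) / real (Suc m)) * t ^ Suc m)"
  shows "cycle_gf x has_fps_expansion Abs_fps (\<lambda>m. of_real (x m) / of_nat m)"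
    and "cycle_gf x holomorphic_on ball 0 1"
proof -
  let ?A = "Abs_fps (\<lambda>m. of_real (x m) / of_nat m :: complex)"
  have rad: "fps_conv_radius ?A \<ge> 1"
    unfolding fps_conv_radius_def
  proof (rule conv_radius_geI_ex')
    fix r :: real assume r: "0 < r" "ereal r < 1"
    then have "summable (\<lambda>m. of_real (x (Suc m) / real (Suc m)) * complex_of_real r ^ Suc m)"
      by (intro summ) auto
    then have "summable (\<lambda>m. fps_nth ?A (Suc m) * complex_of_real r ^ Suc m)" by simp
    then show "summable (\<lambda>m. fps_nth ?A m * complex_of_real r ^ m)"
      by (rule summable_Suc_iff[of "\<lambda>m. fps_nth ?A m * complex_of_real r ^ m", THEN iffD1])
  qed
  have eq: "cycle_gf x t = eval_fps ?A t" if "t \<in> ball 0 1" for t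
    using that by (intro cycle_gf_eq_eval_fps summ) auto
  have "eval_fps ?A holomorphic_on ball 0 1"
    by (rule holomorphic_on_eval_fps) (use rad in \<open>auto simp: eball_def intro: less_le_trans[of _ 1]\<close>)
  then show "cycle_gf x holomorphic_on ball 0 1" by (subst holomorphic_cong[OF refl eq])
  have "eventually (\<lambda>t::complex. t \<in> ball 0 1) (nhds 0)" by (rule eventually_nhds_in_open) auto
  then have "eventually (\<lambda>t. eval_fps ?A t = cycle_gf x t) (nhds 0)"
    by eventually_elim (simp add: eq)
  then show "cycle_gf x has_fps_expansion ?A"
    using rad by (auto simp: has_fps_expansion_def intro: less_le_trans[of 0 1])
qed

text \<open>Applying Cauchy's formula to the reflected series puts the singularity \<open>t = 1\<close> at the middle
  of the interval of integration.\<close>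

lemma norm_const_integral:
  fixes x :: "nat \<Rightarrow> real" and v \<beta> :: real
  assumes summ: "\<And>t::complex. norm t < 1 \<Longrightarrow> summable (\<lambda>m. of_real (x (Suc m) / real (Suc m)) * t ^ Suc m)"
    and rec: "\<And>n. real n * norm_const x n = (\<Sum>m=1..n. x m * norm_const x (n - m))"
    and v: "v > 0" and \<beta>: "\<beta> > 0"
  defines "w \<equiv> \<lambda>s. complex_of_real v + \<i> * complex_of_real (\<beta> * s)"
  shows "complex_of_real (2 * pi / \<beta> * norm_const x n) =
    (LINT s|lborel. indicator {-(pi / \<beta>)..pi / \<beta>} s *\<^sub>R (exp (cycle_gf x (exp (- w s))) * exp (of_nat n * w s)))"
proof -
  define y where "y = (\<lambda>m. x m * (-1) ^ m)"
  define F where "F = (\<lambda>t. exp (cycle_gf y t))"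
  define \<rho> where "\<rho> = exp (- v)"
  have \<rho>: "0 < \<rho>" "\<rho> < 1" using v by (auto simp: \<rho>_def)
  have term_eq: "of_real (y (Suc m) / real (Suc m)) * t ^ Suc m = of_real (x (Suc m) / real (Suc m)) * (- t) ^ Suc m"
    for m and t :: complex
  proof -
    have "(- t) ^ Suc m = (-1) ^ Suc m * t ^ Suc m" by (rule power_minus)
    then show ?thesis unfolding y_def by (simp only: of_real_divide of_real_mult of_real_power of_real_minus of_real_1) (simp add: field_simps)
  qed
  have gf_y: "cycle_gf y t = cycle_gf x (- t)" for t
    unfolding cycle_gf_def term_eq ..
  have summ_y: "summable (\<lambda>m. of_real (y (Suc m) / real (Suc m)) * t ^ Suc m)" if "norm t < 1" for t :: complex
    unfolding term_eq using that by (intro summ) auto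
  note exp_y = cycle_gf_holomorphic_expansion[of y, OF summ_y]
  let ?h = "\<lambda>n. complex_of_real ((-1) ^ n * norm_const x n)"
  have "fps_exp 1 oo Abs_fps (\<lambda>m. of_real (y m) / of_nat m) = Abs_fps ?h"
  proof (rule fps_exp_compose_rec)
    show "?h 0 = 1" by (simp add: norm_const_0)
    fix N
    have "(-1) ^ N * (real N * norm_const x N) = (\<Sum>m=1..N. y m * ((-1) ^ (N - m) * norm_const x (N - m)))"
      unfolding rec sum_distrib_left
    proof (intro sum.cong refl)
      fix m assume "m \<in> {1..N}"
      then have "(-1 :: real) ^ N = (-1) ^ m * (-1) ^ (N - m)" by (simp add: power_add[symmetric])
      then show "(-1) ^ N * (x m * norm_const x (N - m)) = y m * ((-1) ^ (N - m) * norm_const x (N - m))"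
        by (simp add: y_def)
    qed
    note eq = this
    have "of_nat N * ?h N = complex_of_real ((-1) ^ N * (real N * norm_const x N))" by simp
    also have "\<dots> = (\<Sum>m=1..N. of_real (y m) * ?h (N - m))" unfolding eq by simp
    finally show "of_nat N * ?h N = (\<Sum>m=1..N. of_real (y m) * ?h (N - m))" .
  qed
  then have "F has_fps_expansion Abs_fps ?h"
    using has_fps_expansion_compose[OF has_fps_expansion_exp1 exp_y(1)] by (simp add: F_def o_def)
  then have coeff: "(deriv ^^ n) F 0 / fact n = ?h n"
    using fps_nth_fps_expansion by fastforce
  have holF: "F holomorphic_on ball 0 1" unfolding F_def by (intro holomorphic_intros exp_y(2))
  have "((\<lambda>u. F u / (u - 0) ^ Suc n) has_contour_integral (2 * pi * \<i>) / fact n * (deriv ^^ n) F 0) (circlepath 0 \<rho>)"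
  proof (rule Cauchy_has_contour_integral_higher_derivative_circlepath)
    have sub: "cball 0 \<rho> \<subseteq> ball (0::complex) 1" using \<rho> by auto
    show "continuous_on (cball 0 \<rho>) F"
      by (rule holomorphic_on_imp_continuous_on[OF holomorphic_on_subset[OF holF sub]])
    show "F holomorphic_on ball 0 \<rho>" by (rule holomorphic_on_subset[OF holF]) (use \<rho> in auto)
  qed (use \<rho> in auto)
  moreover have "(2 * pi * \<i>) / fact n * (deriv ^^ n) F 0 = 2 * pi * \<i> * ?h n"
    unfolding coeff[symmetric] by simp
  ultimately have "((\<lambda>u. F u / u ^ Suc n) has_contour_integral 2 * pi * \<i> * ?h n) (part_circlepath 0 \<rho> 0 (2 * pi))"
    unfolding circlepath_def by simp
  then have HI: "((\<lambda>s. F (\<rho> * cis s) / (\<rho> * cis s) ^ Suc n * \<rho> * \<i> * cis s) has_integral 2 * pi * \<i> * ?h n) {0..2 * pi}"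
    (is "(?g has_integral _) _")
    by (subst (asm) has_contour_integral_part_circlepath_iff) auto
  have "continuous_on {0..2 * pi} (\<lambda>s. F (\<rho> * cis s))"
  proof (rule continuous_on_compose2[OF holomorphic_on_imp_continuous_on[OF holF]])
    show "continuous_on {0..2 * pi} (\<lambda>s. \<rho> * cis s)" by (intro continuous_intros)
    show "(\<lambda>s. \<rho> * cis s) ` {0..2 * pi} \<subseteq> ball 0 1" using \<rho> by (auto simp: norm_mult)
  qed
  then have "continuous_on {0..2 * pi} ?g"
    using \<rho> by (intro continuous_intros) auto
  then have "set_integrable lborel {0..2 * pi} ?g" by (rule borel_integrable_atLeastAtMost')
  then have "(LINT s:{0..2 * pi}|lborel. ?g s) = integral {0..2 * pi} ?g"
    by (rule set_borel_integral_eq_integral(2))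
  also have "\<dots> = 2 * pi * \<i> * ?h n" by (rule integral_unique[OF HI])
  finally have "(LINT s|lborel. indicator {0..2 * pi} s *\<^sub>R ?g s) = 2 * pi * \<i> * ?h n"
    unfolding set_lebesgue_integral_def .
  note LI = this
  \<comment> \<open>The substitution \<open>pi - \<beta> * s\<close> makes the interval symmetric
    about 0, and the point on the circle becomes \<open>- exp (- w s)\<close>. The sign
    \<open>(-1) ^ n\<close> of the denominator then matches that of the coefficient.\<close>
  have "2 * pi * \<i> * ?h n = \<bar>- \<beta>\<bar> *\<^sub>R (LINT s|lborel. indicator {0..2 * pi} (pi + - \<beta> * s) *\<^sub>R ?g (pi + - \<beta> * s))"
    unfolding LI[symmetric] by (rule lborel_integral_real_affine) (use \<beta> in simp)
  also have "(\<lambda>s. indicator {0..2 * pi} (pi + - \<beta> * s) *\<^sub>R ?g (pi + - \<beta> * s)) =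
      (\<lambda>s. \<i> * (-1) ^ n * (indicator {-(pi / \<beta>)..pi / \<beta>} s *\<^sub>R (exp (cycle_gf x (exp (- w s))) * exp (of_nat n * w s))))"
  proof
    fix s
    have ind: "indicator {0..2 * pi} (pi + - \<beta> * s) = (indicator {-(pi / \<beta>)..pi / \<beta>} s :: real)"
      using \<beta> by (auto simp: indicator_def field_simps)
    have "complex_of_real \<rho> * cis (pi + - \<beta> * s) = - exp (- w s)"
    proof -
      have "exp (- w s) = exp (complex_of_real (- v)) * exp (\<i> * complex_of_real (- \<beta> * s))"
        unfolding w_def by (subst exp_add[symmetric]) (simp add: algebra_simps)
      also have "\<dots> = complex_of_real \<rho> * cis (- \<beta> * s)"
        unfolding \<rho>_def cis_conv_exp by (simp only: exp_of_real)
      finally have e: "exp (- w s) = \<dots>" .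
      have "cis (pi + - \<beta> * s) = cis pi * cis (- \<beta> * s)" by (rule cis_mult[symmetric])
      then show ?thesis unfolding e by simp
    qed
    note cs = this
    have "?g (pi + - \<beta> * s) = F (- exp (- w s)) / (- exp (- w s)) ^ n * \<i>"
    proof -
      have "?g (pi + - \<beta> * s) = F (\<rho> * cis (pi + - \<beta> * s)) / (\<rho> * cis (pi + - \<beta> * s)) ^ n * \<i>"
        using \<rho> by (simp add: field_simps)
      then show ?thesis unfolding cs .
    qed
    also have "F (- exp (- w s)) = exp (cycle_gf x (exp (- w s)))" by (simp add: F_def gf_y)
    also have "(- exp (- w s)) ^ n = (-1) ^ n * exp (- (of_nat n * w s))"
      by (subst power_minus) (simp add: exp_of_nat_mult[symmetric])
    also have "exp (cycle_gf x (exp (- w s))) / ((-1) ^ n * exp (- (of_nat n * w s))) * \<i> =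
        \<i> * (-1) ^ n * (exp (cycle_gf x (exp (- w s))) * exp (of_nat n * w s))"
      by (cases "even n") (auto simp: exp_minus field_simps)
    finally have "?g (pi + - \<beta> * s) = \<dots>" .
    then show "indicator {0..2 * pi} (pi + - \<beta> * s) *\<^sub>R ?g (pi + - \<beta> * s) =
       \<i> * (-1) ^ n * (indicator {-(pi / \<beta>)..pi / \<beta>} s *\<^sub>R (exp (cycle_gf x (exp (- w s))) * exp (of_nat n * w s)))"
      unfolding ind by (simp add: scaleR_conv_of_real)
  qed
  finally have "2 * pi * \<i> * ?h n = \<bar>- \<beta>\<bar> *\<^sub>R (\<i> * (-1) ^ n *
      (LINT s|lborel. indicator {-(pi / \<beta>)..pi / \<beta>} s *\<^sub>R (exp (cycle_gf x (exp (- w s))) * exp (of_nat n * w s))))"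
    (is "_ = _ *\<^sub>R (_ * ?I)") by (simp only: integral_mult_right_zero)
  then have "(\<i> * (-1) ^ n) * (2 * pi * complex_of_real (norm_const x n)) = (\<i> * (-1) ^ n) * (of_real \<beta> * ?I)"
    using \<beta> by (simp add: scaleR_conv_of_real mult_ac)
  then have "2 * pi * complex_of_real (norm_const x n) = of_real \<beta> * ?I"
    by (subst (asm) mult_left_cancel) auto
  then show ?thesis using \<beta> by (simp add: field_simps)
qed

section \<open>The logarithmic singularity\<close>

text \<open>The principal logarithm of \<open>1 + \<i> y\<close>, split into the two parts that the
  estimates treat separately.\<close>

definition ln_one_plus_i :: "real \<Rightarrow> complex" where
  "ln_one_plus_i y = Complex (ln (1 + y\<^sup>2) / 2) (arctan y)"

lemma Re_ln_one_plus_i [simp]: "Re (ln_one_plus_i y) = ln (1 + y\<^sup>2) / 2"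
  and Im_ln_one_plus_i [simp]: "Im (ln_one_plus_i y) = arctan y"
  by (simp_all add: ln_one_plus_i_def)

lemma exp_ln_one_plus_i: "exp (ln_one_plus_i y) = 1 + \<i> * of_real y"
proof -
  have pos: "1 + y\<^sup>2 > 0" by (simp add: add_pos_nonneg)
  have "exp (ln (1 + y\<^sup>2) / 2) = sqrt (1 + y\<^sup>2)"
    using pos by (simp add: ln_sqrt[symmetric])
  moreover have "sqrt (1 + y\<^sup>2) \<noteq> 0" using pos by simp
  ultimately show ?thesis
    by (simp add: complex_eq_iff Re_exp Im_exp cos_arctan sin_arctan)
qed

lemma Ln_rescaled:
  assumes "v > 0"
  shows "Ln (of_real v * (1 + \<i> * of_real y)) = of_real (ln v) + ln_one_plus_i y"
proof (rule Ln_unique)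
  show "exp (complex_of_real (ln v) + ln_one_plus_i y) = of_real v * (1 + \<i> * of_real y)"
    using assms by (simp add: exp_add exp_ln_one_plus_i exp_of_real)
  show "- pi < Im (complex_of_real (ln v) + ln_one_plus_i y)"
    "Im (complex_of_real (ln v) + ln_one_plus_i y) \<le> pi"
    using arctan_bounded[of y] pi_gt_zero by auto
qed

lemma ln_one_plus_sq_nonneg: "ln (1 + y\<^sup>2) \<ge> (0::real)"
  by (rule ln_ge_zero) simp

text \<open>Bounds the imaginary part of the logarithm by its real part. The 8 comes from
  \<open>\<bar>y\<bar> > 1\<close>, where the left side is at most 4 and \<open>ln 2\<close> at
  least 1/2; for \<open>\<bar>y\<bar> \<le> 1\<close> the factor 2 would do.\<close>

lemma arctan_sq_le: "(arctan y)\<^sup>2 \<le> 8 * ln (1 + y\<^sup>2)"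
proof (cases "\<bar>y\<bar> \<le> 1")
  case True
  then have y2: "y\<^sup>2 \<le> 1" by (simp add: abs_square_le_1)
  have "\<bar>arctan y\<bar> \<le> \<bar>y\<bar>" using abs_arctan[of y] arctan_le_self[of "\<bar>y\<bar>"] by simp
  then have "(arctan y)\<^sup>2 \<le> y\<^sup>2" by (rule abs_le_square_iff[THEN iffD1])
  moreover have "y\<^sup>2 / (1 + y\<^sup>2) \<le> ln (1 + y\<^sup>2)"
  proof -
    have pos: "1 + y\<^sup>2 > 0" by (simp add: add_pos_nonneg)
    have "ln (inverse (1 + y\<^sup>2)) \<le> inverse (1 + y\<^sup>2) - 1" using pos by (intro ln_le_minus_one) simp
    moreover have "inverse (1 + y\<^sup>2) - 1 = - (y\<^sup>2 / (1 + y\<^sup>2))" using pos by (simp add: field_simps)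
    ultimately show ?thesis using pos by (simp add: ln_inverse)
  qed
  moreover have "y\<^sup>2 / (1 + y\<^sup>2) \<ge> y\<^sup>2 / 2"
    using y2 by (intro divide_left_mono) (auto simp: add_pos_nonneg)
  ultimately show ?thesis using zero_le_power2[of y] by linarith
next
  case False
  then have "1 \<le> y\<^sup>2" using abs_square_le_1[of y] by linarith
  then have "ln 2 \<le> ln (1 + y\<^sup>2)" by simp
  moreover have "1 / 2 \<le> ln (2::real)" using ln2_ge_two_thirds by simp
  moreover have "(arctan y)\<^sup>2 \<le> 2\<^sup>2"
    using arctan_bounded[of y] pi_less_4 by (intro abs_le_square_iff[THEN iffD1]) auto
  ultimately show ?thesis by simp
qed

text \<open>The imaginary part adds at most \<open>16 * v\<close> to the square. Half of the real
  part pays for it if \<open>l - 3 * v / 4 \<ge> 16\<close>, which follows from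
  \<open>v \<le> l\<close> and \<open>l \<ge> 64\<close>.\<close>

lemma norm_diff_ln_one_plus_i_le:
  assumes l: "l \<ge> 64" and v: "v = ln (1 + y\<^sup>2) / 2" "v \<le> l"
  shows "norm (of_real l - ln_one_plus_i y) \<le> l - v / 2"
proof -
  have v0: "v \<ge> 0" unfolding v using ln_one_plus_sq_nonneg[of y] by simp
  have "(norm (of_real l - ln_one_plus_i y))\<^sup>2 = (l - v)\<^sup>2 + (arctan y)\<^sup>2"
    by (simp add: cmod_power2 v)
  also have "\<dots> \<le> (l - v)\<^sup>2 + 16 * v" using arctan_sq_le[of y] v by simp
  also have "\<dots> \<le> (l - v / 2)\<^sup>2"
  proof -
    have "(l - v / 2)\<^sup>2 - ((l - v)\<^sup>2 + 16 * v) = v * (l - 3 * v / 4 - 16)"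
      by (simp add: power2_eq_square algebra_simps)
    moreover have "v * (l - 3 * v / 4 - 16) \<ge> 0" using v0 v(2) l by (intro mult_nonneg_nonneg) auto
    ultimately show ?thesis by linarith
  qed
  finally show ?thesis by (rule power2_le_imp_le) (use v(2) v0 l in auto)
qed

lemma norm_ln_one_plus_i_sq_le:
  "(norm (ln_one_plus_i y))\<^sup>2 \<le> (ln (1 + y\<^sup>2) / 2)\<^sup>2 + 16 * (ln (1 + y\<^sup>2) / 2)"
  using arctan_sq_le[of y] by (simp add: cmod_power2)

text \<open>The remainder is of order \<open>j^2 * l ^ (j - 2) * \<bar>z\<bar>^2\<close>; the factor
  \<open>l^2\<close> on the left avoids the exponent \<open>j - 2\<close>. The induction multiplies
  the remainder by \<open>l - z\<close> and adds \<open>j * l ^ (j - 1) * z^2\<close>.\<close>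

lemma power_taylor_remainder:
  fixes z :: complex and l :: real
  assumes l: "l > 0" and z: "norm (of_real l - z) \<le> l"
  shows "l\<^sup>2 * norm ((of_real l - z) ^ j - of_real l ^ j + of_nat j * of_real l ^ (j - 1) * z) \<le> (real j)\<^sup>2 * l ^ j * (norm z)\<^sup>2"
proof (induction j)
  case 0 then show ?case by simp
next
  case (Suc j)
  let ?D = "\<lambda>j. (of_real l - z) ^ j - of_real l ^ j + of_nat j * of_real l ^ (j - 1) * z"
  have pow: "of_nat j * complex_of_real l ^ (j - 1) * of_real l = of_nat j * of_real l ^ j"
    by (cases j) auto
  have "?D (Suc j) = (of_real l - z) * ?D j + of_nat j * of_real l ^ (j - 1) * z\<^sup>2 
      + (of_nat j * of_real l ^ j - of_nat j * of_real l ^ (j - 1) * of_real l) * z"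
    by (simp add: algebra_simps power2_eq_square)
  then have D: "?D (Suc j) = (of_real l - z) * ?D j + of_nat j * of_real l ^ (j - 1) * z\<^sup>2"
    unfolding pow by simp
  have "l\<^sup>2 * norm (?D (Suc j)) \<le> norm (of_real l - z) * (l\<^sup>2 * norm (?D j)) + l\<^sup>2 * (real j * l ^ (j - 1) * (norm z)\<^sup>2)"
  proof -
    have "norm (?D (Suc j)) \<le> norm (of_real l - z) * norm (?D j) + real j * l ^ (j - 1) * (norm z)\<^sup>2"
      unfolding D using l by (intro order.trans[OF norm_triangle_ineq]) (simp add: norm_mult norm_power)
    then have "l\<^sup>2 * norm (?D (Suc j)) \<le> l\<^sup>2 * (norm (of_real l - z) * norm (?D j) + real j * l ^ (j - 1) * (norm z)\<^sup>2)"
      by (intro mult_left_mono) auto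
    then show ?thesis by (simp add: algebra_simps)
  qed
  also have "\<dots> \<le> l * ((real j)\<^sup>2 * l ^ j * (norm z)\<^sup>2) + real j * l ^ Suc j * (norm z)\<^sup>2"
  proof (rule add_mono)
    show "norm (of_real l - z) * (l\<^sup>2 * norm (?D j)) \<le> l * ((real j)\<^sup>2 * l ^ j * (norm z)\<^sup>2)"
      using l by (intro mult_mono Suc.IH z) auto
    show "l\<^sup>2 * (real j * l ^ (j - 1) * (norm z)\<^sup>2) \<le> real j * l ^ Suc j * (norm z)\<^sup>2"
      by (cases j) (auto simp: power2_eq_square mult_ac)
  qed
  also have "\<dots> = ((real j)\<^sup>2 + real j) * (l ^ Suc j * (norm z)\<^sup>2)"
    by (simp add: algebra_simps)
  also have "\<dots> \<le> (real (Suc j))\<^sup>2 * (l ^ Suc j * (norm z)\<^sup>2)"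
    using l by (intro mult_right_mono) (auto simp: power2_eq_square algebra_simps)
  finally show ?case by (simp add: mult_ac)
qed

section \<open>Growth of \<open>G\<close> near the singularity and away from it\<close>

locale log_singularity =
  fixes \<theta> :: "nat \<Rightarrow> real" and k :: nat and G :: "complex \<Rightarrow> complex" and c :: "nat \<Rightarrow> real"
  assumes \<theta>_nonneg: "\<And>m. 1 \<le> m \<Longrightarrow> 0 \<le> \<theta> m"
    and summ: "\<And>t::complex. norm t < 1 \<Longrightarrow> summable (\<lambda>m. of_real (\<theta> (Suc m) / real (Suc m)) * t ^ Suc m)"
    and k: "1 \<le> k"
    and G_eq: "\<And>t. norm t < 1 \<Longrightarrow> G t = cycle_gf \<theta> t"
    and G_cont: "continuous_on (cball 0 1 - {1}) G"
    and G_asym: "(\<lambda>w. G (exp (- w)) -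
             ((- Ln w) ^ (k + 1) / of_nat (k + 1) + (\<Sum>j\<le>k. of_real (c j) * (- Ln w) ^ j)))
          \<in> O[at 0 within {w. 0 \<le> Re w}](\<lambda>w. w)"
begin

definition PC :: "complex \<Rightarrow> complex" where
  "PC z = z ^ (k + 1) / of_nat (k + 1) + (\<Sum>j\<le>k. of_real (c j) * z ^ j)"

definition P :: "real \<Rightarrow> real" where
  "P l = l ^ (k + 1) / real (k + 1) + (\<Sum>j\<le>k. c j * l ^ j)"

text \<open>The derivative of \<open>P\<close>; at \<open>j = 0\<close> the factor
  \<open>real j\<close> cancels the truncated exponent.\<close>

definition dP :: "real \<Rightarrow> real" where
  "dP l = l ^ k + (\<Sum>j\<le>k. c j * (real j * l ^ (j - 1)))"

text \<open>A majorant of \<open>PC\<close> on discs, with the leading term of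
  \<open>P\<close>.\<close>

definition Q :: "real \<Rightarrow> real" where
  "Q l = l ^ (k + 1) / real (k + 1) + (\<Sum>j\<le>k. \<bar>c j\<bar> * l ^ j)"

lemma PC_of_real: "PC (of_real l) = of_real (P l)"
  by (simp add: PC_def P_def)

lemma norm_PC_le: "norm z \<le> r \<Longrightarrow> norm (PC z) \<le> Q r"
  unfolding PC_def Q_def
proof (intro order.trans[OF norm_triangle_ineq] add_mono order.trans[OF norm_sum] sum_mono)
  assume z: "norm z \<le> r"
  show "norm (z ^ (k + 1) / of_nat (k + 1)) \<le> r ^ (k + 1) / real (k + 1)"
    unfolding norm_divide norm_power norm_of_nat using z by (intro divide_right_mono power_mono) auto
  show "norm (of_real (c j) * z ^ j) \<le> \<bar>c j\<bar> * r ^ j" for j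
    unfolding norm_mult norm_power norm_of_real using z by (intro mult_left_mono power_mono) auto
qed

text \<open>The bound \<open>\<delta> \<le> 1\<close> is asked for because it makes
  \<open>ln (norm w) \<le> 0\<close>, so \<open>- Ln w\<close> has nonnegative real part on this
  neighbourhood.\<close>

lemma G_near:
  obtains C \<delta> where "C > 0" "0 < \<delta>" "\<delta> \<le> 1"
    "\<And>w. 0 \<le> Re w \<Longrightarrow> w \<noteq> 0 \<Longrightarrow> norm w \<le> \<delta> \<Longrightarrow> norm (G (exp (- w)) - PC (- Ln w)) \<le> C * norm w"
proof -
  have "(\<lambda>w. G (exp (- w)) - PC (- Ln w)) \<in> O[at 0 within {w. 0 \<le> Re w}](\<lambda>w. w)"
    using G_asym unfolding PC_def .
  from landau_o.bigE[OF this] obtain C where C: "C > 0" "eventually (\<lambda>w. norm (G (exp (- w)) - PC (- Ln w)) \<le> C * norm w) (at 0 within {w. 0 \<le> Re w})"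
    by blast
  then obtain d where "d > 0" "\<And>w. 0 \<le> Re w \<Longrightarrow> w \<noteq> 0 \<Longrightarrow> norm w < d \<Longrightarrow> norm (G (exp (- w)) - PC (- Ln w)) \<le> C * norm w"
    unfolding eventually_at by (auto simp: dist_norm)
  then show ?thesis using C(1) by (intro that[of C "min (d / 2) 1"]) auto
qed

text \<open>Compactness of a rectangle minus a disc around 0. The height restriction ensures that
  \<open>exp (- w) = 1\<close> only at the centre of that disc.\<close>

lemma G_far:
  assumes "\<delta> > 0"
  obtains B where "\<And>w. 0 \<le> Re w \<Longrightarrow> Re w \<le> 1 \<Longrightarrow> \<bar>Im w\<bar> \<le> pi \<Longrightarrow> \<delta> \<le> norm w \<Longrightarrow> norm (G (exp (- w))) \<le> B"
proof -
  define K where "K = cbox (Complex 0 (- pi)) (Complex 1 pi) - ball 0 \<delta>"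
  have K: "w \<in> K \<longleftrightarrow> 0 \<le> Re w \<and> Re w \<le> 1 \<and> \<bar>Im w\<bar> \<le> pi \<and> \<delta> \<le> norm w" for w
    by (auto simp: K_def in_cbox_complex_iff)
  have "compact K" unfolding K_def by (intro compact_diff compact_cbox open_ball)
  moreover have "continuous_on K (\<lambda>w. G (exp (- w)))"
  proof (rule continuous_on_compose2[OF G_cont])
    show "continuous_on K (\<lambda>w. exp (- w))" by (intro continuous_intros)
    show "(\<lambda>w. exp (- w)) ` K \<subseteq> cball 0 1 - {1}"
    proof safe
      fix w assume w: "w \<in> K"
      show "exp (- w) \<in> cball 0 1" using w K by simp
      assume "exp (- w) = 1"
      \<comment> \<open>\<open>2 * m * pi\<close> lies in \<open>[- pi, pi]\<close>, which leaves
        \<open>m = 0\<close>.\<close>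
      then obtain m :: int where m: "Re w = 0" "- Im w = of_int (2 * m) * pi"
        unfolding exp_eq_1 by auto
      have "\<bar>of_int (2 * m) * pi\<bar> \<le> pi" using w K[of w] m by (metis abs_minus_cancel)
      then have "\<bar>2 * real_of_int m\<bar> \<le> 1" by (simp add: abs_mult)
      then have "m = 0" by linarith
      then have "w = 0" using m by (auto simp: complex_eq_iff)
      then show False using w K assms by auto
    qed
  qed
  ultimately have "bounded ((\<lambda>w. G (exp (- w))) ` K)"
    by (intro compact_imp_bounded compact_continuous_image)
  then obtain B where "\<forall>w\<in>K. norm (G (exp (- w))) \<le> B" unfolding bounded_iff by auto
  then show ?thesis using K by (intro that[of B]) auto
qed

text \<open>Moving off the real axis at fixed real part of \<open>w\<close> lowers the real part of
  the polynomial. The leading term gains \<open>l ^ k * v / (2 * (k + 1))\<close>, with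
  \<open>v = ln (1 + y^2) / 2\<close>; for large \<open>l\<close> the lower terms give back at most
  half of it.\<close>

lemma Re_PC_le:
  obtains L where "L \<ge> 64" "\<And>l y. l \<ge> L \<Longrightarrow> ln (1 + y\<^sup>2) / 2 \<le> l \<Longrightarrow>
    Re (PC (of_real l - ln_one_plus_i y)) - P l \<le> - (l ^ k * (ln (1 + y\<^sup>2) / 2) / (4 * real (k + 1)))"
proof -
  \<comment> \<open>\<open>S\<close> bounds the loss from lower terms in units of
    \<open>l ^ (k - 1) * v\<close>. Each power contributes \<open>2 * j^2\<close> from its Taylor
    remainder and \<open>j\<close> from its linear term, together at most
    \<open>3 * k^2\<close>.\<close>
  define S where "S = (\<Sum>j\<le>k. \<bar>c j\<bar> * (3 * (real k)\<^sup>2))"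
  have S0: "S \<ge> 0" unfolding S_def by (intro sum_nonneg) auto
  have "Re (PC (of_real l - ln_one_plus_i y)) - P l \<le> - (l ^ k * (ln (1 + y\<^sup>2) / 2) / (4 * real (k + 1)))"
    if l: "l \<ge> max 64 (4 * real (k + 1) * S)" and vl: "ln (1 + y\<^sup>2) / 2 \<le> l" for l y
  proof -
    define v where "v = ln (1 + y\<^sup>2) / 2"
    define z where "z = ln_one_plus_i y"
    have v0: "v \<ge> 0" unfolding v_def using ln_one_plus_sq_nonneg[of y] by simp
    have l0: "l > 0" "l \<ge> 64" using l by auto
    have vl: "v \<le> l" using vl by (simp add: v_def)
    have Rez: "Re z = v" by (simp add: z_def v_def)
    have nz: "norm (of_real l - z) \<le> l - v / 2"
      unfolding z_def by (rule norm_diff_ln_one_plus_i_le[OF l0(2) v_def vl])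
    then have nzl: "norm (of_real l - z) \<le> l" using v0 by linarith
    \<comment> \<open>Uses \<open>v \<le> l\<close> and \<open>16 \<le> l\<close>. Making the square
      linear in \<open>v\<close> lets the remainders compete with the gain, even for tiny
      \<open>v\<close>.\<close>
    have z2: "(norm z)\<^sup>2 \<le> 2 * l * v"
    proof -
      have "(norm z)\<^sup>2 \<le> v\<^sup>2 + 16 * v" unfolding z_def v_def by (rule norm_ln_one_plus_i_sq_le)
      also have "\<dots> = v * (v + 16)" by (simp add: power2_eq_square algebra_simps)
      also have "\<dots> \<le> v * (2 * l)" using v0 vl l0 by (intro mult_left_mono) auto
      finally show ?thesis by (simp add: mult_ac)
    qed
    have lead: "Re ((of_real l - z) ^ (k + 1)) \<le> l ^ (k + 1) - l ^ k * v / 2"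
    proof -
      have "Re ((of_real l - z) ^ (k + 1)) \<le> norm (of_real l - z) ^ (k + 1)"
        using complex_Re_le_cmod[of "(of_real l - z) ^ (k + 1)"] by (simp only: norm_power)
      also have "\<dots> = norm (of_real l - z) ^ k * norm (of_real l - z)" by simp
      also have "\<dots> \<le> l ^ k * (l - v / 2)"
        using nz nzl l0 by (intro mult_mono power_mono) auto
      finally show ?thesis by (simp add: algebra_simps)
    qed
    have low: "l * \<bar>Re ((of_real l - z) ^ j) - l ^ j\<bar> \<le> 3 * (real k)\<^sup>2 * (l ^ k * v)" if j: "j \<le> k" for j
    proof (cases "j = 0")
      case False
      let ?D = "(of_real l - z) ^ j - of_real l ^ j + of_nat j * of_real l ^ (j - 1) * z"
      have "Re ((of_real l - z) ^ j) - l ^ j = Re ?D - real j * l ^ (j - 1) * v"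
      proof -
        have "of_nat j * complex_of_real l ^ (j - 1) * z = complex_of_real (real j * l ^ (j - 1)) * z" by simp
        then have "Re (of_nat j * complex_of_real l ^ (j - 1) * z) = real j * l ^ (j - 1) * v"
          by (simp only: Re_complex_of_real Im_complex_of_real times_complex.sel Rez mult_zero_left diff_zero)
        moreover have "Re (complex_of_real l ^ j) = l ^ j" by (metis Re_complex_of_real of_real_power)
        ultimately show ?thesis by simp
      qed
      then have "\<bar>Re ((of_real l - z) ^ j) - l ^ j\<bar> \<le> norm ?D + real j * l ^ (j - 1) * v"
      proof -
        have "\<bar>Re ?D - real j * l ^ (j - 1) * v\<bar> \<le> \<bar>Re ?D\<bar> + \<bar>real j * l ^ (j - 1) * v\<bar>"
          by (rule abs_triangle_ineq4)
        moreover have "\<bar>real j * l ^ (j - 1) * v\<bar> = real j * l ^ (j - 1) * v" using v0 l0 by simp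
        moreover have "\<bar>Re ?D\<bar> \<le> norm ?D" by (rule abs_Re_le_cmod)
        ultimately have "\<bar>Re ?D - real j * l ^ (j - 1) * v\<bar> \<le> norm ?D + real j * l ^ (j - 1) * v" by linarith
        then show ?thesis unfolding \<open>Re ((of_real l - z) ^ j) - l ^ j = Re ?D - real j * l ^ (j - 1) * v\<close> .
      qed
      then have "l\<^sup>2 * \<bar>Re ((of_real l - z) ^ j) - l ^ j\<bar> \<le> l\<^sup>2 * (norm ?D + real j * l ^ (j - 1) * v)"
        by (intro mult_left_mono) auto
      also have "\<dots> = l\<^sup>2 * norm ?D + real j * l ^ (j + 1) * v"
        using False by (cases j) (auto simp: power2_eq_square algebra_simps)
      also have "\<dots> \<le> (real j)\<^sup>2 * l ^ j * (2 * l * v) + real j * l ^ (j + 1) * v"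
        using power_taylor_remainder[OF l0(1) nzl, of j] z2 l0
        by (intro add_mono order.refl order.trans[OF _ mult_left_mono[OF z2]]) auto
      also have "\<dots> = (2 * (real j)\<^sup>2 + real j) * (l ^ (j + 1) * v)" by (simp add: algebra_simps)
      also have "\<dots> \<le> (3 * (real k)\<^sup>2) * (l ^ (k + 1) * v)"
      proof (intro mult_mono)
        have "(real j)\<^sup>2 \<le> (real k)\<^sup>2" using j by (intro power_mono) auto
        moreover have "real j \<le> (real j)\<^sup>2" using False by (simp add: power2_eq_square)
        ultimately show "2 * (real j)\<^sup>2 + real j \<le> 3 * (real k)\<^sup>2" by linarith
        show "l ^ (j + 1) \<le> l ^ (k + 1)" using j l0 by (intro power_increasing) auto
      qed (use v0 l0 in auto)
      finally have "l * (l * \<bar>Re ((of_real l - z) ^ j) - l ^ j\<bar>) \<le> l * (3 * (real k)\<^sup>2 * (l ^ k * v))"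
        by (simp add: power2_eq_square mult_ac)
      then show ?thesis using l0 by (subst (asm) mult_le_cancel_left_pos) auto
    qed (use v0 l0 in auto)
    let ?X = "\<Sum>j\<le>k. \<bar>c j\<bar> * \<bar>Re ((of_real l - z) ^ j) - l ^ j\<bar>"
    have "l * ?X = (\<Sum>j\<le>k. \<bar>c j\<bar> * (l * \<bar>Re ((of_real l - z) ^ j) - l ^ j\<bar>))"
      by (simp add: sum_distrib_left mult_ac)
    also have "\<dots> \<le> (\<Sum>j\<le>k. \<bar>c j\<bar> * (3 * (real k)\<^sup>2 * (l ^ k * v)))"
      using low by (intro sum_mono mult_left_mono) auto
    also have "\<dots> = S * (l ^ k * v)" unfolding S_def by (simp add: sum_distrib_left sum_distrib_right mult_ac)
    also have "\<dots> \<le> (l / (4 * real (k + 1))) * (l ^ k * v)"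
      using l v0 l0 by (intro mult_right_mono) (auto simp: field_simps)
    finally have "l * ?X \<le> l * (l ^ k * v / (4 * real (k + 1)))" by simp
    then have X: "?X \<le> l ^ k * v / (4 * real (k + 1))" using l0 by (subst (asm) mult_le_cancel_left_pos) auto
    have "Re (PC (of_real l - z)) - P l = (Re ((of_real l - z) ^ (k + 1)) - l ^ (k + 1)) / real (k + 1) +
        (\<Sum>j\<le>k. c j * (Re ((of_real l - z) ^ j) - l ^ j))"
    proof -
      have "Re ((of_real l - z) ^ (k + 1) / of_nat (k + 1)) = Re ((of_real l - z) ^ (k + 1)) / real (k + 1)"
        by (metis Re_divide_of_real of_real_of_nat_eq)
      then show ?thesis unfolding PC_def P_def
        by (simp add: sum_subtractf right_diff_distrib diff_divide_distrib)
    qed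
    also have "\<dots> \<le> (- (l ^ k * v / 2)) / real (k + 1) + ?X"
    proof (intro add_mono divide_right_mono sum_mono)
      show "Re ((of_real l - z) ^ (k + 1)) - l ^ (k + 1) \<le> - (l ^ k * v / 2)" using lead by simp
      show "c j * (Re ((of_real l - z) ^ j) - l ^ j) \<le> \<bar>c j\<bar> * \<bar>Re ((of_real l - z) ^ j) - l ^ j\<bar>" for j
        by (metis abs_ge_self abs_mult)
    qed auto
    also have "\<dots> \<le> - (l ^ k * v / (4 * real (k + 1)))"
    proof -
      define Y where "Y = l ^ k * v / real (k + 1)"
      have Y: "(- (l ^ k * v / 2)) / real (k + 1) = - (Y / 2)" "l ^ k * v / (4 * real (k + 1)) = Y / 4"
        by (simp_all add: Y_def)
      show ?thesis using X unfolding Y by simp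
    qed
    finally show ?thesis by (simp add: z_def v_def)
  qed
  then show ?thesis by (intro that[of "max 64 (4 * real (k + 1) * S)"]) auto
qed

text \<open>First-order expansion with an error of order
  \<open>l ^ (k - 1) * \<bar>z\<bar>^2\<close>, smaller by a factor \<open>l\<close> than the
  quadratic term to be extracted from \<open>dP l * z\<close>.\<close>

lemma PC_taylor:
  obtains C where "C > 0" "\<And>l z. l \<ge> 1 \<Longrightarrow> norm (of_real l - z) \<le> l \<Longrightarrow>
    l\<^sup>2 * norm (PC (of_real l - z) - of_real (P l) + of_real (dP l) * z) \<le> C * (l ^ (k + 1) * (norm z)\<^sup>2)"
proof -
  define C where "C = real (k + 1) + (\<Sum>j\<le>k. \<bar>c j\<bar> * (real j)\<^sup>2)"
  have "l\<^sup>2 * norm (PC (of_real l - z) - of_real (P l) + of_real (dP l) * z) \<le> C * (l ^ (k + 1) * (norm z)\<^sup>2)"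
    if l: "l \<ge> 1" "norm (of_real l - z) \<le> l" for l z
  proof -
    let ?D = "\<lambda>j. (of_real l - z) ^ j - of_real l ^ j + of_nat j * of_real l ^ (j - 1) * z"
    have l0: "l > 0" using l by simp
    have "PC (of_real l - z) - of_real (P l) + of_real (dP l) * z = ?D (k + 1) / of_nat (k + 1) + (\<Sum>j\<le>k. of_real (c j) * ?D j)"
    proof -
      have "?D (k + 1) / of_nat (k + 1) = (of_real l - z) ^ (k + 1) / of_nat (k + 1) - of_real l ^ (k + 1) / of_nat (k + 1) + of_real l ^ k * z"
        by (simp add: field_simps del: of_nat_Suc power_Suc)
      moreover have "(\<Sum>j\<le>k. of_real (c j) * ?D j) = (\<Sum>j\<le>k. of_real (c j) * (of_real l - z) ^ j) -
          (\<Sum>j\<le>k. of_real (c j) * of_real l ^ j) + (\<Sum>j\<le>k. of_real (c j) * (of_nat j * of_real l ^ (j - 1))) * z"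
        unfolding sum_distrib_right sum_subtractf[symmetric] sum.distrib[symmetric]
        by (intro sum.cong refl) (simp only: ring_distribs mult.assoc)
      moreover have "complex_of_real (P l) = of_real l ^ (k + 1) / of_nat (k + 1) + (\<Sum>j\<le>k. of_real (c j) * of_real l ^ j)"
        by (simp add: P_def)
      moreover have "complex_of_real (dP l) = of_real l ^ k + (\<Sum>j\<le>k. of_real (c j) * (of_nat j * of_real l ^ (j - 1)))"
        by (simp add: dP_def)
      ultimately show ?thesis unfolding PC_def by (simp only: distrib_right) (simp only: add.assoc add.commute add.left_commute diff_conv_add_uminus minus_add_distrib)
    qed
    then have "l\<^sup>2 * norm (PC (of_real l - z) - of_real (P l) + of_real (dP l) * z) \<le>
        l\<^sup>2 * (norm (?D (k + 1)) / real (k + 1) + (\<Sum>j\<le>k. \<bar>c j\<bar> * norm (?D j)))"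
      by (intro mult_left_mono) (auto intro!: norm_triangle_mono sum_norm_le simp: norm_divide norm_mult simp del: power_Suc of_nat_Suc)
    also have "\<dots> = l\<^sup>2 * norm (?D (k + 1)) / real (k + 1) + (\<Sum>j\<le>k. \<bar>c j\<bar> * (l\<^sup>2 * norm (?D j)))"
      by (simp add: distrib_left sum_distrib_left mult_ac)
    also have "\<dots> \<le> real (k + 1) * (l ^ (k + 1) * (norm z)\<^sup>2) + (\<Sum>j\<le>k. \<bar>c j\<bar> * ((real j)\<^sup>2 * (l ^ (k + 1) * (norm z)\<^sup>2)))"
    proof (intro add_mono sum_mono mult_left_mono)
      have "l\<^sup>2 * norm (?D (k + 1)) \<le> (real (k + 1))\<^sup>2 * l ^ (k + 1) * (norm z)\<^sup>2"
        by (rule power_taylor_remainder[OF l0 l(2)])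
      also have "\<dots> = real (k + 1) * (l ^ (k + 1) * (norm z)\<^sup>2) * real (k + 1)"
        by (simp only: power2_eq_square mult_ac)
      finally show "l\<^sup>2 * norm (?D (k + 1)) / real (k + 1) \<le> real (k + 1) * (l ^ (k + 1) * (norm z)\<^sup>2)"
        by (subst pos_divide_le_eq) auto
    next
      fix j assume j: "j \<in> {..k}"
      have "l\<^sup>2 * norm (?D j) \<le> (real j)\<^sup>2 * l ^ j * (norm z)\<^sup>2"
        by (rule power_taylor_remainder[OF l0 l(2)])
      also have "\<dots> \<le> (real j)\<^sup>2 * (l ^ (k + 1) * (norm z)\<^sup>2)"
        unfolding mult.assoc using l j by (intro mult_left_mono mult_right_mono power_increasing) auto
      finally show "l\<^sup>2 * norm (?D j) \<le> (real j)\<^sup>2 * (l ^ (k + 1) * (norm z)\<^sup>2)" .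
    qed auto
    also have "\<dots> = C * (l ^ (k + 1) * (norm z)\<^sup>2)"
      unfolding C_def by (simp only: distrib_right sum_distrib_right mult.assoc)
    finally show ?thesis .
  qed
  moreover have "C > 0" unfolding C_def by (intro add_pos_nonneg sum_nonneg) auto
  ultimately show ?thesis using that by blast
qed

end

section \<open>The saddle point\<close>

text \<open>Solutions exist by the intermediate value theorem once \<open>n \<ge> f 0\<close>. They
  leave every interval \<open>{0..B}\<close> because \<open>f\<close> is bounded there while its
  value is \<open>n\<close>.\<close>

lemma saddle_sequence:
  fixes f :: "real \<Rightarrow> real"
  assumes cont: "continuous_on UNIV f" and lim: "filterlim f at_top at_top"
  obtains L :: "nat \<Rightarrow> real" where "filterlim L at_top sequentially" "eventually (\<lambda>n. f (L n) = real n) sequentially"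
proof -
  define L where "L n = (SOME x. 0 \<le> x \<and> f x = real n)" for n
  have ev: "eventually (\<lambda>n. f 0 \<le> real n) sequentially"
    using filterlim_real_sequentially unfolding filterlim_at_top by blast
  have L: "0 \<le> L n \<and> f (L n) = real n" if n: "f 0 \<le> real n" for n
  proof -
    obtain y where y: "y \<ge> 0" "f y \<ge> real n"
    proof -
      have "eventually (\<lambda>y. real n \<le> f y \<and> 0 \<le> y) at_top"
        using lim unfolding filterlim_at_top by (intro eventually_conj eventually_ge_at_top) auto
      then show ?thesis using that by (auto simp: eventually_at_top_linorder)
    qed
    have "\<exists>x. 0 \<le> x \<and> x \<le> y \<and> f x = real n"
      using n y by (intro IVT' continuous_on_subset[OF cont]) auto
    then show ?thesis unfolding L_def by (intro someI_ex[of "\<lambda>x. 0 \<le> x \<and> f x = real n"]) auto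
  qed
  have "filterlim L at_top sequentially"
    unfolding filterlim_at_top
  proof
    fix B
    have "bounded (f ` {0..B})"
      by (intro compact_imp_bounded compact_continuous_image continuous_on_subset[OF cont]) auto
    then obtain M where "\<forall>y\<in>f ` {0..B}. norm y \<le> M" unfolding bounded_iff by blast
    then have M: "\<bar>f x\<bar> \<le> M" if "x \<in> {0..B}" for x using that by auto
    have "eventually (\<lambda>n. M < real n) sequentially"
      using filterlim_real_sequentially unfolding filterlim_at_top_dense by blast
    with ev show "eventually (\<lambda>n. B \<le> L n) sequentially"
    proof eventually_elim
      case (elim n)
      then show ?case using L[of n] M[of "L n"] by (cases "B \<le> L n") auto
    qed
  qed
  moreover have "eventually (\<lambda>n. f (L n) = real n) sequentially"
    using ev by eventually_elim (use L in auto)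
  ultimately show ?thesis by (rule that)
qed

text \<open>Bernoulli's inequality for the integer part of \<open>a\<close>, which is at least
  \<open>a / 2\<close>. With \<open>a\<close> proportional to \<open>lam\<close> and
  \<open>x = s^2 / lam\<close> it yields an integrable majorant independent of
  \<open>lam\<close>.\<close>

lemma exp_neg_mult_ln_le:
  fixes a x :: real
  assumes a: "a \<ge> 1" and x: "x \<ge> 0"
  shows "exp (- (a * ln (1 + x))) \<le> 1 / (1 + a * x / 2)"
proof -
  define M where "M = nat \<lfloor>a\<rfloor>"
  have M: "real M \<le> a" "a / 2 \<le> real M"
  proof -
    have "1 \<le> \<lfloor>a\<rfloor>" using a by simp
    then have "real M = of_int \<lfloor>a\<rfloor>" "1 \<le> real_of_int \<lfloor>a\<rfloor>" unfolding M_def by auto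
    then show "real M \<le> a" "a / 2 \<le> real M" using of_int_floor_le[of a] real_of_int_floor_add_one_gt[of a] by linarith+
  qed
  have ln0: "ln (1 + x) \<ge> 0" using x by simp
  have "exp (- (a * ln (1 + x))) \<le> exp (- (real M * ln (1 + x)))"
    using M ln0 by (auto intro: mult_right_mono)
  also have "\<dots> = 1 / (1 + x) ^ M"
    using x by (simp add: exp_minus exp_of_nat_mult inverse_eq_divide)
  also have "\<dots> \<le> 1 / (1 + real M * x)"
    using Bernoulli_inequality[of x M] x by (intro divide_left_mono) (auto simp: add_pos_nonneg)
  also have "\<dots> \<le> 1 / (1 + a * x / 2)"
  proof (intro divide_left_mono)
    have "(a / 2) * x \<le> real M * x" using M x by (intro mult_right_mono) auto
    then show "1 + a * x / 2 \<le> 1 + real M * x" by simp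
    show "0 < (1 + real M * x) * (1 + a * x / 2)" using a x by (intro mult_pos_pos add_pos_nonneg) auto
  qed auto
  finally show ?thesis .
qed

lemma power_ratio_tendsto_0:
  assumes "j < m"
  shows "((\<lambda>l::real. l ^ j / l ^ m) \<longlongrightarrow> 0) at_top"
proof (rule Lim_transform_eventually)
  show "((\<lambda>l::real. inverse (l ^ (m - j))) \<longlongrightarrow> 0) at_top"
    by (rule tendsto_inverse_0_at_top) (use assms in \<open>auto intro!: filterlim_pow_at_top filterlim_ident\<close>)
  show "eventually (\<lambda>l::real. inverse (l ^ (m - j)) = l ^ j / l ^ m) at_top"
    using eventually_gt_at_top[of 0]
  proof eventually_elim
    case (elim l)
    have "l ^ m = l ^ (m - j) * l ^ j" using assms by (simp add: power_add[symmetric])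
    then show ?case using elim by (simp add: divide_simps)
  qed
qed

text \<open>The difference is cubic in \<open>s / sqrt x\<close>, so the product decays like
  \<open>1 / sqrt x\<close>. It is odd in \<open>s\<close>, which reduces negative \<open>s\<close>
  to positive \<open>s\<close>.\<close>

lemma arctan_rescaled_tendsto: "((\<lambda>x. x * (s / sqrt x - arctan (s / sqrt x))) \<longlongrightarrow> 0) at_top" for s :: real
proof -
  have pos: "((\<lambda>x. x * (s / sqrt x - arctan (s / sqrt x))) \<longlongrightarrow> 0) at_top" if "s > 0" for s :: real
    using that by real_asymp
  consider "s > 0" | "s = 0" | "s < 0" by linarith
  then show ?thesis
  proof cases
    case 3
    then have "((\<lambda>x. - (x * (- s / sqrt x - arctan (- s / sqrt x)))) \<longlongrightarrow> - 0) at_top"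
      by (intro tendsto_minus pos) auto
    then show ?thesis by (simp add: arctan_minus algebra_simps)
  qed (use pos in auto)
qed

lemma ln_rescaled_tendsto: "((\<lambda>x. x * (ln (1 + s\<^sup>2 / x) / 2)) \<longlongrightarrow> s\<^sup>2 / 2) at_top" for s :: real
  by real_asymp

context log_singularity
begin

lemma poly_over_power_tendsto:
  "((\<lambda>l::real. (l ^ (k + 1) / real (k + 1) + (\<Sum>j\<le>k. a j * l ^ j)) / l ^ (k + 1)) \<longlongrightarrow> 1 / real (k + 1)) at_top"
proof (rule Lim_transform_eventually)
  have "((\<lambda>l. 1 / real (k + 1) + (\<Sum>j\<le>k. a j * (l ^ j / l ^ (k + 1)))) \<longlongrightarrow> 1 / real (k + 1) + (\<Sum>j\<le>k. a j * 0)) at_top"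
    by (intro tendsto_intros power_ratio_tendsto_0) auto
  then show "((\<lambda>l. 1 / real (k + 1) + (\<Sum>j\<le>k. a j * (l ^ j / l ^ (k + 1)))) \<longlongrightarrow> 1 / real (k + 1)) at_top"
    by simp
  show "eventually (\<lambda>l. 1 / real (k + 1) + (\<Sum>j\<le>k. a j * (l ^ j / l ^ (k + 1))) =
      (l ^ (k + 1) / real (k + 1) + (\<Sum>j\<le>k. a j * l ^ j)) / l ^ (k + 1)) at_top"
    using eventually_gt_at_top[of 0]
  proof eventually_elim
    case (elim l)
    then show ?case by (simp add: add_divide_distrib sum_divide_distrib del: power_Suc)
  qed
qed

lemma P_tendsto: "((\<lambda>l. P l / l ^ (k + 1)) \<longlongrightarrow> 1 / real (k + 1)) at_top"
  unfolding P_def by (rule poly_over_power_tendsto)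

lemma Q_tendsto: "((\<lambda>l. Q l / l ^ (k + 1)) \<longlongrightarrow> 1 / real (k + 1)) at_top"
  unfolding Q_def by (rule poly_over_power_tendsto)

lemma dP_tendsto: "((\<lambda>l. dP l / l ^ k) \<longlongrightarrow> 1) at_top"
proof (rule Lim_transform_eventually)
  have "((\<lambda>l. c j * (real j * (l ^ (j - 1) / l ^ k))) \<longlongrightarrow> 0) at_top" if "j \<le> k" for j
  proof (cases "j = 0")
    case False
    have "((\<lambda>l. c j * (real j * (l ^ (j - 1) / l ^ k))) \<longlongrightarrow> c j * (real j * 0)) at_top"
      by (intro tendsto_intros power_ratio_tendsto_0) (use that False in auto)
    then show ?thesis by simp
  qed auto
  then have "((\<lambda>l. 1 + (\<Sum>j\<le>k. c j * (real j * (l ^ (j - 1) / l ^ k)))) \<longlongrightarrow> 1 + (\<Sum>j\<le>k. 0)) at_top"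
    by (intro tendsto_intros) auto
  then show "((\<lambda>l. 1 + (\<Sum>j\<le>k. c j * (real j * (l ^ (j - 1) / l ^ k)))) \<longlongrightarrow> 1) at_top" by simp
  show "eventually (\<lambda>l. 1 + (\<Sum>j\<le>k. c j * (real j * (l ^ (j - 1) / l ^ k))) = dP l / l ^ k) at_top"
    using eventually_gt_at_top[of 0]
  proof eventually_elim
    case (elim l)
    then show ?case by (simp add: dP_def add_divide_distrib sum_divide_distrib del: power_Suc)
  qed
qed

lemma eventually_dP_bounds: "eventually (\<lambda>l. l ^ k / 2 \<le> dP l \<and> dP l \<le> 2 * l ^ k \<and> l / 2 \<le> dP l) at_top"
proof -
  have "eventually (\<lambda>l. dP l / l ^ k \<in> {1/2<..<2}) at_top"
    using dP_tendsto by (rule topological_tendstoD) auto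
  with eventually_ge_at_top[of 1] show ?thesis
  proof eventually_elim
    case (elim l)
    have "l ^ 1 \<le> l ^ k" using elim k by (intro power_increasing) auto
    then have "l \<le> l ^ k" by simp
    moreover have "l ^ k / 2 < dP l" "dP l < 2 * l ^ k" using elim by (auto simp: field_simps)
    ultimately show ?case by auto
  qed
qed

lemma filterlim_dP_exp: "filterlim (\<lambda>l. dP l * exp l) at_top at_top"
proof (rule filterlim_at_top_mono)
  show "filterlim (\<lambda>l::real. exp l) at_top at_top" by (rule exp_at_top)
  show "eventually (\<lambda>l. exp l \<le> dP l * exp l) at_top"
    using eventually_dP_bounds eventually_ge_at_top[of 2]
  proof eventually_elim
    case (elim l)
    have "1 * exp l \<le> dP l * exp l" using elim by (intro mult_right_mono) auto
    then show ?case by simp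
  qed
qed

text \<open>The critical point equation of \<open>P (- ln v) + n * v\<close> in the variable
  \<open>L = - ln v\<close>.\<close>

lemma obtain_saddle:
  obtains L :: "nat \<Rightarrow> real" where "filterlim L at_top sequentially"
    "eventually (\<lambda>n. dP (L n) * exp (L n) = real n) sequentially"
proof (rule saddle_sequence)
  show "continuous_on UNIV (\<lambda>l. dP l * exp l)" unfolding dP_def by (intro continuous_intros)
qed (use filterlim_dP_exp in auto)

lemma Q_nonneg: "r \<ge> 0 \<Longrightarrow> Q r \<ge> 0"
  unfolding Q_def by (intro add_nonneg_nonneg sum_nonneg) auto

lemma Q_mono: "0 \<le> r \<Longrightarrow> r \<le> s \<Longrightarrow> Q r \<le> Q s"
  unfolding Q_def by (intro add_mono sum_mono mult_left_mono divide_right_mono power_mono) auto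

end

section \<open>Size of the saddle point parameters\<close>

locale saddle = log_singularity +
  fixes L :: "nat \<Rightarrow> real"
  assumes L_top: "filterlim L at_top sequentially"
    and L_eq: "eventually (\<lambda>n. dP (L n) * exp (L n) = real n) sequentially"
begin

definition lam :: "nat \<Rightarrow> real" where "lam n = dP (L n)"
definition v :: "nat \<Rightarrow> real" where "v n = exp (- L n)"
text \<open>The scale of the Gaussian peak: \<open>Im w = \<beta> * s\<close> makes
  \<open>y = Im w / v\<close> equal to \<open>s / sqrt lam\<close>, and the quadratic term
  \<open>- lam * y^2 / 2\<close> becomes \<open>- s^2 / 2\<close>.\<close>

definition \<beta> :: "nat \<Rightarrow> real" where "\<beta> n = v n / sqrt (lam n)"

lemma v_pos [simp]: "v n > 0" by (simp add: v_def)

lemma ln_v [simp]: "ln (v n) = - L n" by (simp add: v_def)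

lemma L_large: "eventually (\<lambda>n. B \<le> L n) sequentially"
  using L_top unfolding filterlim_at_top by blast

lemma v_tendsto: "v \<longlonglongrightarrow> 0"
  unfolding v_def by (rule filterlim_compose[OF exp_at_bot]) (use L_top in \<open>simp add: filterlim_uminus_at_top\<close>)

lemma lam_bounds: "eventually (\<lambda>n. L n ^ k / 2 \<le> lam n \<and> lam n \<le> 2 * L n ^ k \<and> L n / 2 \<le> lam n) sequentially"
  unfolding lam_def using eventually_compose_filterlim[OF eventually_dP_bounds L_top] .

lemma lam_top: "filterlim lam at_top sequentially"
proof (rule filterlim_at_top_mono)
  show "filterlim (\<lambda>n. L n / 2) at_top sequentially"
    using filterlim_tendsto_pos_mult_at_top[OF tendsto_const _ L_top, of "1/2"] by simp
  show "eventually (\<lambda>n. L n / 2 \<le> lam n) sequentially" using lam_bounds by eventually_elim auto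
qed

lemma lam_large: "eventually (\<lambda>n. B \<le> lam n) sequentially"
  using lam_top unfolding filterlim_at_top by blast

lemma n_v: "eventually (\<lambda>n. real n * v n = lam n) sequentially"
  using L_eq by eventually_elim (simp add: v_def lam_def exp_minus field_simps)

lemma n_beta: "eventually (\<lambda>n. \<beta> n > 0 \<and> real n * \<beta> n = sqrt (lam n)) sequentially"
  using n_v lam_large[of 1]
proof eventually_elim
  case (elim n)
  have "real n * \<beta> n = lam n / sqrt (lam n)" using elim by (simp add: \<beta>_def)
  then show ?case using elim by (simp add: \<beta>_def real_div_sqrt)
qed

text \<open>The saddle equation reads \<open>ln n = L + ln (dP L)\<close>, and the last term is only
  of order \<open>ln L\<close>.\<close>

lemma L_over_ln: "(\<lambda>n. L n / ln (real n)) \<longlonglongrightarrow> 1"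
proof -
  have "((\<lambda>l. 1 + ln (dP l) / l) \<longlongrightarrow> 1 + 0) at_top"
  proof (intro tendsto_intros)
    show "((\<lambda>l. ln (dP l) / l) \<longlongrightarrow> 0) at_top"
    proof (rule tendsto_sandwich)
      show "eventually (\<lambda>l. 0 \<le> ln (dP l) / l) at_top"
        using eventually_dP_bounds eventually_ge_at_top[of 2] by eventually_elim (auto intro!: divide_nonneg_nonneg ln_ge_zero)
      show "eventually (\<lambda>l. ln (dP l) / l \<le> (ln 2 + real k * ln l) / l) at_top"
        using eventually_dP_bounds eventually_ge_at_top[of 2]
      proof eventually_elim
        case (elim l)
        have "ln (dP l) \<le> ln (2 * l ^ k)" using elim by (intro ln_mono) auto
        also have "\<dots> = ln 2 + real k * ln l" using elim by (simp add: ln_mult ln_realpow)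
        finally show ?case using elim by (intro divide_right_mono) auto
      qed
      show "((\<lambda>l. (ln 2 + real k * ln l) / l) \<longlongrightarrow> 0) at_top" by real_asymp
    qed auto
  qed
  then have "(\<lambda>n. 1 + ln (dP (L n)) / L n) \<longlonglongrightarrow> 1" using filterlim_compose[OF _ L_top] by simp
  moreover have "eventually (\<lambda>n. 1 + ln (dP (L n)) / L n = ln (real n) / L n) sequentially"
    using L_eq L_large[of 2] lam_large[of 1]
  proof eventually_elim
    case (elim n)
    have "ln (dP (L n) * exp (L n)) = ln (dP (L n)) + L n"
      using elim(3) by (simp add: ln_mult lam_def)
    then have "ln (real n) = ln (dP (L n)) + L n" unfolding elim(1) .
    then show ?case using elim by (simp add: field_simps)
  qed
  ultimately have "(\<lambda>n. ln (real n) / L n) \<longlonglongrightarrow> 1" by (rule Lim_transform_eventually)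
  then have "(\<lambda>n. inverse (ln (real n) / L n)) \<longlonglongrightarrow> inverse 1" by (rule tendsto_inverse) auto
  then show ?thesis by (simp add: field_simps)
qed

end

lemma integrable_inverse_one_plus_sq: "integrable lborel (\<lambda>s::real. inverse (1 + s\<^sup>2))"
  using integrable_inverse_1_plus_square unfolding set_integrable_def by simp

lemma integral_gaussian: "(LINT s|lborel. exp (- (s\<^sup>2 / 2))) = sqrt (2 * pi)"
proof -
  have "(LINT s|lborel. std_normal_density s) = 1"
    using prob_space.prob_space[OF prob_space_normal_density[of 1 0]]
      integral_std_normal_moment_even[of 0] by simp
  moreover have "std_normal_density s = exp (- (s\<^sup>2 / 2)) / sqrt (2 * pi)" for s
    by (simp add: std_normal_density_def)
  ultimately show ?thesis by (simp add: field_simps)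
qed

section \<open>Pointwise limit of the integrand at the saddle\<close>

context saddle
begin

definition w :: "nat \<Rightarrow> real \<Rightarrow> complex" where
  "w n s = complex_of_real (v n) + \<i> * complex_of_real (\<beta> n * s)"

text \<open>The exponent of the integrand for \<open>h\<^sub>n\<close> minus its value at
  \<open>s = 0\<close>; the real part \<open>n * v\<close> of \<open>n * w\<close> is constant on
  the circle and has cancelled.\<close>

definition E :: "nat \<Rightarrow> real \<Rightarrow> complex" where
  "E n s = G (exp (- w n s)) - G (exp (- complex_of_real (v n))) + \<i> * complex_of_real (real n * \<beta> n * s)"

lemma Re_w [simp]: "Re (w n s) = v n" and Im_w [simp]: "Im (w n s) = \<beta> n * s"
  by (simp_all add: w_def)

lemma v_nonneg [simp]: "0 \<le> v n"
  using v_pos[of n] by (rule less_imp_le)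

lemma norm_w_le: "norm (w n s) \<le> v n + \<bar>\<beta> n * s\<bar>"
  using cmod_le[of "w n s"] by (simp add: abs_mult)

lemma w_nonzero [simp]: "w n s \<noteq> 0"
  using v_pos[of n] by (metis Re_w less_irrefl zero_complex.sel(1))

lemma norm_exp_w_less_1: "norm (exp (- w n s)) < 1"
  by simp

lemma continuous_G_w: "continuous_on A (\<lambda>s. G (exp (- w n s)))"
proof (rule continuous_on_compose2[OF G_cont])
  show "continuous_on A (\<lambda>s. exp (- w n s))" unfolding w_def by (intro continuous_intros)
  show "(\<lambda>s. exp (- w n s)) ` A \<subseteq> cball 0 1 - {1}"
  proof safe
    fix s show "exp (- w n s) \<in> cball 0 1" using norm_exp_w_less_1[of n s] by simp
    assume "exp (- w n s) = 1" then show False using norm_exp_w_less_1[of n s] by simp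
  qed
qed

lemma measurable_E [measurable]: "(\<lambda>s. E n s) \<in> borel_measurable borel"
  unfolding E_def by (intro borel_measurable_continuous_onI continuous_intros continuous_G_w)

text \<open>Writing \<open>w = v (1 + \<i> y)\<close> with \<open>y = s / sqrt lam\<close>, the linear term of the expansion of \<open>P\<close> at
  the saddle \<open>L\<close> cancels against \<open>n w\<close> because \<open>n v = lam = P' L\<close>.\<close>

lemma w_rescaled:
  assumes "lam n > 0"
  shows "w n s = of_real (v n) * (1 + \<i> * of_real (s / sqrt (lam n)))"
  using assms by (simp add: w_def \<beta>_def algebra_simps)

lemma neg_Ln_w:
  assumes "lam n > 0"
  shows "- Ln (w n s) = of_real (L n) - ln_one_plus_i (s / sqrt (lam n))"
  unfolding w_rescaled[OF assms] by (subst Ln_rescaled) auto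

lemma sq_rescaled: "lam n > 0 \<Longrightarrow> (s / sqrt (lam n))\<^sup>2 = s\<^sup>2 / lam n"
  by (simp add: power_divide)

text \<open>Converts the condition \<open>ln (1 + y^2) / 2 \<le> l\<close> of the polynomial
  estimates into \<open>norm w \<le> 1\<close>.\<close>

lemma ln_norm_w:
  assumes "lam n > 0"
  shows "ln (1 + (s / sqrt (lam n))\<^sup>2) / 2 = L n + ln (norm (w n s))"
proof -
  have "Re (- Ln (w n s)) = L n - ln (1 + (s / sqrt (lam n))\<^sup>2) / 2"
    unfolding neg_Ln_w[OF assms] by simp
  moreover have "Re (- Ln (w n s)) = - ln (norm (w n s))" by simp
  ultimately show ?thesis by linarith
qed

lemma Ln_v: "Ln (complex_of_real (v n)) = - of_real (L n)"
  using Ln_of_real[of "v n"] by simp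

text \<open>Four pieces: replacing \<open>G\<close> by the polynomial at \<open>w\<close>
  (\<open>A\<close>) and at \<open>v\<close> (\<open>B\<close>) costs O(|w|) and O(v); the Taylor
  remainder (\<open>D\<close>) is O(1 / L); and \<open>lam * (\<i> y - ln (1 + \<i> y))\<close>
  (\<open>F\<close>) carries the Gaussian.\<close>

lemma E_tendsto: "(\<lambda>n. E n s) \<longlonglongrightarrow> - of_real (s\<^sup>2 / 2)"
proof -
  obtain C \<delta> where C: "C > 0" "0 < \<delta>" "\<delta> \<le> 1"
    "\<And>w. 0 \<le> Re w \<Longrightarrow> w \<noteq> 0 \<Longrightarrow> norm w \<le> \<delta> \<Longrightarrow> norm (G (exp (- w)) - PC (- Ln w)) \<le> C * norm w"
    using G_near by blast
  obtain C2 where C2: "C2 > 0" "\<And>l z. l \<ge> 1 \<Longrightarrow> norm (of_real l - z) \<le> l \<Longrightarrow>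
    l\<^sup>2 * norm (PC (of_real l - z) - of_real (P l) + of_real (dP l) * z) \<le> C2 * (l ^ (k + 1) * (norm z)\<^sup>2)"
    using PC_taylor by blast
  define y where "y n = s / sqrt (lam n)" for n
  define z where "z n = ln_one_plus_i (y n)" for n
  have \<beta>0: "\<beta> \<longlonglongrightarrow> 0"
  proof (rule tendsto_sandwich[OF _ _ tendsto_const v_tendsto])
    show "eventually (\<lambda>n. 0 \<le> \<beta> n) sequentially" using n_beta by eventually_elim auto
    show "eventually (\<lambda>n. \<beta> n \<le> v n) sequentially" using lam_large[of 1]
    proof eventually_elim
      case (elim n)
      have "v n / sqrt (lam n) \<le> v n / 1" using elim by (intro divide_left_mono) auto
      then show ?case by (simp add: \<beta>_def)
    qed
  qed
  have w0: "(\<lambda>n. norm (w n s)) \<longlonglongrightarrow> 0"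
  proof -
    have "(\<lambda>n. norm (w n s)) \<longlonglongrightarrow> norm (complex_of_real 0 + \<i> * complex_of_real (0 * s))"
      unfolding w_def by (intro tendsto_intros v_tendsto \<beta>0)
    then show ?thesis by simp
  qed
  have w_small: "eventually (\<lambda>n. norm (w n s) < \<delta>) sequentially"
    using order_tendstoD(2)[OF w0 C(2)] .
  have v_small: "eventually (\<lambda>n. v n < \<delta>) sequentially"
    using order_tendstoD(2)[OF v_tendsto C(2)] .
  have A: "(\<lambda>n. G (exp (- w n s)) - PC (of_real (L n) - z n)) \<longlonglongrightarrow> 0"
  proof (rule Lim_null_comparison)
    show "eventually (\<lambda>n. norm (G (exp (- w n s)) - PC (of_real (L n) - z n)) \<le> C * norm (w n s)) sequentially"
      using w_small lam_large[of 1]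
    proof eventually_elim
      case (elim n)
      then show ?case using C(4)[of "w n s"] neg_Ln_w[of n s] v_pos[of n] by (simp add: z_def y_def less_imp_le)
    qed
    show "(\<lambda>n. C * norm (w n s)) \<longlonglongrightarrow> 0" using tendsto_mult_right_zero[OF w0] .
  qed
  have B: "(\<lambda>n. G (exp (- complex_of_real (v n))) - of_real (P (L n))) \<longlonglongrightarrow> 0"
  proof (rule Lim_null_comparison)
    show "eventually (\<lambda>n. norm (G (exp (- complex_of_real (v n))) - of_real (P (L n))) \<le> C * v n) sequentially"
      using v_small
    proof eventually_elim
      case (elim n)
      then show ?case using C(4)[of "complex_of_real (v n)"] v_pos[of n] by (simp add: Ln_v PC_of_real less_imp_le)
    qed
    show "(\<lambda>n. C * v n) \<longlonglongrightarrow> 0" using tendsto_mult_right_zero[OF v_tendsto] .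
  qed
  have D: "(\<lambda>n. PC (of_real (L n) - z n) - of_real (P (L n)) + of_real (lam n) * z n) \<longlonglongrightarrow> 0"
  proof (rule Lim_null_comparison)
    \<comment> \<open>From \<open>\<bar>z\<bar>^2 \<le> s^2 * (s^2 + 16) / lam\<close> and
      \<open>L ^ k \<le> 2 * lam\<close> in \<open>PC_taylor\<close>: one factor
      \<open>1 / L\<close> is left over.\<close>
    let ?R = "\<lambda>n. C2 * (2 * inverse (L n) * (s\<^sup>2 * (s\<^sup>2 + 16)))"
    show "eventually (\<lambda>n. norm (PC (of_real (L n) - z n) - of_real (P (L n)) + of_real (lam n) * z n) \<le> ?R n) sequentially"
      using w_small lam_large[of 1] lam_bounds L_large[of 64]
    proof eventually_elim
      case (elim n)
      define u where "u = ln (1 + (y n)\<^sup>2) / 2"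
      have lam: "lam n \<ge> 1" using elim by simp
      have y2: "(y n)\<^sup>2 = s\<^sup>2 / lam n" unfolding y_def using lam by (intro sq_rescaled) simp
      have "u = L n + ln (norm (w n s))"
        unfolding u_def y_def using lam by (intro ln_norm_w) simp
      moreover have "ln (norm (w n s)) \<le> 0" using elim C(3) by (intro ln_le_zero_iff[THEN iffD2]) auto
      ultimately have uL: "u \<le> L n" by simp
      have u0: "u \<ge> 0" unfolding u_def using ln_one_plus_sq_nonneg[of "y n"] by simp
      have "ln (1 + (y n)\<^sup>2) \<le> (y n)\<^sup>2" by (rule ln_add_one_self_le_self) simp
      then have uy: "u \<le> (y n)\<^sup>2" using u0 unfolding u_def by linarith
      have "norm (of_real (L n) - z n) \<le> L n - u / 2"
        unfolding z_def by (rule norm_diff_ln_one_plus_i_le) (use elim uL in \<open>auto simp: u_def\<close>)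
      then have nz: "norm (of_real (L n) - z n) \<le> L n" using u0 by linarith
      have "(norm (z n))\<^sup>2 \<le> u\<^sup>2 + 16 * u" unfolding z_def u_def by (rule norm_ln_one_plus_i_sq_le)
      also have "\<dots> \<le> ((y n)\<^sup>2)\<^sup>2 + 16 * (y n)\<^sup>2" using uy u0 by (intro add_mono power_mono mult_left_mono) auto
      also have "\<dots> = (s\<^sup>2 / lam n) * (s\<^sup>2 / lam n + 16)" unfolding y2 by (simp add: power2_eq_square algebra_simps)
      also have "\<dots> \<le> (s\<^sup>2 / lam n) * (s\<^sup>2 + 16)"
      proof (intro mult_left_mono)
        have "s\<^sup>2 / lam n \<le> s\<^sup>2 / 1" using lam by (intro divide_left_mono) auto
        then show "s\<^sup>2 / lam n + 16 \<le> s\<^sup>2 + 16" by simp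
      qed (use lam in auto)
      finally have z2: "(norm (z n))\<^sup>2 \<le> (s\<^sup>2 / lam n) * (s\<^sup>2 + 16)" .
      have L0: "L n > 0" using elim by simp
      let ?D = "norm (PC (of_real (L n) - z n) - of_real (P (L n)) + of_real (lam n) * z n)"
      have "(L n)\<^sup>2 * ?D \<le> C2 * (L n ^ (k + 1) * (norm (z n))\<^sup>2)"
        unfolding lam_def using nz elim by (intro C2(2)) auto
      also have "\<dots> \<le> C2 * (L n ^ (k + 1) * ((s\<^sup>2 / lam n) * (s\<^sup>2 + 16)))"
        using z2 C2(1) L0 by (intro mult_left_mono) auto
      also have "\<dots> = C2 * (L n * (L n ^ k / lam n) * (s\<^sup>2 * (s\<^sup>2 + 16)))" by simp
      also have "\<dots> \<le> C2 * (L n * 2 * (s\<^sup>2 * (s\<^sup>2 + 16)))"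
        using C2(1) L0 lam elim by (intro mult_left_mono mult_right_mono) (auto simp: field_simps)
      also have "\<dots> = (L n)\<^sup>2 * ?R n" using L0 by (simp add: power2_eq_square)
      finally show ?case using L0 by (subst (asm) mult_le_cancel_left_pos) auto
    qed
    have "(\<lambda>n. inverse (L n)) \<longlonglongrightarrow> 0" using tendsto_inverse_0_at_top[OF L_top] .
    then have "?R \<longlonglongrightarrow> C2 * (2 * 0 * (s\<^sup>2 * (s\<^sup>2 + 16)))" by (intro tendsto_intros)
    then show "?R \<longlonglongrightarrow> 0" by simp
  qed
  have F: "(\<lambda>n. of_real (lam n) * (\<i> * of_real (y n) - z n)) \<longlonglongrightarrow> - of_real (s\<^sup>2 / 2)"
  proof -
    have "(\<lambda>n. Complex (- (lam n * (ln (1 + s\<^sup>2 / lam n) / 2))) (lam n * (s / sqrt (lam n) - arctan (s / sqrt (lam n))))) \<longlonglongrightarrow>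
        Complex (- (s\<^sup>2 / 2)) 0"
      by (intro tendsto_intros filterlim_compose[OF ln_rescaled_tendsto lam_top] filterlim_compose[OF arctan_rescaled_tendsto lam_top])
    moreover have "eventually (\<lambda>n. Complex (- (lam n * (ln (1 + s\<^sup>2 / lam n) / 2))) (lam n * (s / sqrt (lam n) - arctan (s / sqrt (lam n)))) =
        of_real (lam n) * (\<i> * of_real (y n) - z n)) sequentially"
      using lam_large[of 1]
    proof eventually_elim
      case (elim n)
      have "(y n)\<^sup>2 = s\<^sup>2 / lam n" unfolding y_def using elim by (intro sq_rescaled) simp
      then show ?case by (simp add: complex_eq_iff z_def) (simp add: y_def)
    qed
    ultimately have "(\<lambda>n. of_real (lam n) * (\<i> * of_real (y n) - z n)) \<longlonglongrightarrow> Complex (- (s\<^sup>2 / 2)) 0"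
      by (rule Lim_transform_eventually)
    also have "Complex (- (s\<^sup>2 / 2)) 0 = - of_real (s\<^sup>2 / 2)" by (simp add: complex_eq_iff)
    finally show ?thesis .
  qed
  \<comment> \<open>The polynomial terms telescope, and the two terms in \<open>lam * z\<close>
    cancel; what remains is \<open>E\<close>, because
    \<open>n * \<beta> * s = lam * y\<close>.\<close>
  let ?T = "\<lambda>n. (G (exp (- w n s)) - PC (of_real (L n) - z n)) - (G (exp (- complex_of_real (v n))) - of_real (P (L n))) +
      (PC (of_real (L n) - z n) - of_real (P (L n)) + of_real (lam n) * z n) +
      of_real (lam n) * (\<i> * of_real (y n) - z n)"
  have "(\<lambda>n. ?T n) \<longlonglongrightarrow> 0 - 0 + 0 + - of_real (s\<^sup>2 / 2)"
    by (intro tendsto_add tendsto_diff A B D F)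
  then have lim: "(\<lambda>n. ?T n) \<longlonglongrightarrow> - of_real (s\<^sup>2 / 2)" by simp
  show ?thesis
  proof (rule Lim_transform_eventually[OF lim])
    show "eventually (\<lambda>n. ?T n = E n s) sequentially"
      using n_beta lam_large[of 1]
    proof eventually_elim
      case (elim n)
      have "real n * \<beta> n * s = lam n * y n"
      proof -
        have "lam n * y n = (lam n / sqrt (lam n)) * s" by (simp add: y_def)
        also have "lam n / sqrt (lam n) = real n * \<beta> n" using elim by (simp add: real_div_sqrt)
        finally show ?thesis by simp
      qed
      then have "\<i> * complex_of_real (real n * \<beta> n * s) = of_real (lam n) * (\<i> * of_real (y n))" by simp
      then show ?case unfolding E_def by (simp add: algebra_simps)
    qed
  qed
qed

end

section \<open>Domination inside the window and smallness outside\<close>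

context saddle
begin

lemma powr_neg_tendsto:
  assumes "d > 0" shows "(\<lambda>n. real n powr (- d)) \<longlonglongrightarrow> 0"
  using assms by real_asymp

lemma norm_exp_E: "norm (exp (E n s)) = exp (Re (G (exp (- w n s))) - Re (G (exp (- complex_of_real (v n)))))"
  unfolding E_def norm_exp_eq_Re by simp

lemma G_at_v:
  obtains C where "C > 0" "eventually (\<lambda>n. norm (G (exp (- complex_of_real (v n))) - of_real (P (L n))) \<le> C) sequentially"
proof -
  obtain C \<delta> where C: "C > 0" "0 < \<delta>" "\<delta> \<le> 1"
    "\<And>w. 0 \<le> Re w \<Longrightarrow> w \<noteq> 0 \<Longrightarrow> norm w \<le> \<delta> \<Longrightarrow> norm (G (exp (- w)) - PC (- Ln w)) \<le> C * norm w"
    using G_near by blast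
  have "eventually (\<lambda>n. v n < \<delta>) sequentially"
    using order_tendstoD(2)[OF v_tendsto C(2)] .
  then have "eventually (\<lambda>n. norm (G (exp (- complex_of_real (v n))) - of_real (P (L n))) \<le> C) sequentially"
  proof eventually_elim
    case (elim n)
    have "norm (G (exp (- complex_of_real (v n))) - of_real (P (L n))) \<le> C * v n"
      using elim C(4)[of "complex_of_real (v n)"] v_pos[of n] by (simp add: Ln_v PC_of_real)
    also have "\<dots> \<le> C * 1" using elim C by (intro mult_left_mono) auto
    finally show ?case by simp
  qed
  then show ?thesis using that C(1) by blast
qed

text \<open>The dominating function for the window: there \<open>w\<close> is uniformly small, so
  \<open>Re_PC_le\<close> applies and leaves a power of \<open>1 + s^2 / lam\<close> with exponent
  proportional to \<open>- lam\<close>, to which Bernoulli's bound applies.\<close>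

lemma exp_E_bound_inner:
  assumes d: "d > 0"
  obtains C where "C > 0"
    "eventually (\<lambda>n. \<forall>s. \<bar>\<beta> n * s\<bar> \<le> real n powr (- d) \<longrightarrow> norm (exp (E n s)) \<le> C * inverse (1 + s\<^sup>2)) sequentially"
proof -
  obtain C \<delta> where C: "C > 0" "0 < \<delta>" "\<delta> \<le> 1"
    "\<And>w. 0 \<le> Re w \<Longrightarrow> w \<noteq> 0 \<Longrightarrow> norm w \<le> \<delta> \<Longrightarrow> norm (G (exp (- w)) - PC (- Ln w)) \<le> C * norm w"
    using G_near by blast
  obtain Cv where Cv: "Cv > 0" "eventually (\<lambda>n. norm (G (exp (- complex_of_real (v n))) - of_real (P (L n))) \<le> Cv) sequentially"
    using G_at_v by blast
  obtain L0 where L0: "L0 \<ge> 64" "\<And>l y. l \<ge> L0 \<Longrightarrow> ln (1 + y\<^sup>2) / 2 \<le> l \<Longrightarrow>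
    Re (PC (of_real l - ln_one_plus_i y)) - P l \<le> - (l ^ k * (ln (1 + y\<^sup>2) / 2) / (4 * real (k + 1)))"
    using Re_PC_le by blast
  \<comment> \<open>16 is 4 from \<open>Re_PC_le\<close>, times 2 from
    \<open>lam \<le> 2 * L ^ k\<close>, times 2 from the halved logarithm in
    \<open>u\<close>.\<close>
  define \<kappa> where "\<kappa> = 1 / (16 * real (k + 1))"
  have \<kappa>: "0 < \<kappa>" "\<kappa> \<le> 1" by (auto simp: \<kappa>_def)
  have "(\<lambda>n. v n + real n powr (- d)) \<longlonglongrightarrow> 0 + 0" by (intro tendsto_intros v_tendsto powr_neg_tendsto d)
  then have "eventually (\<lambda>n. v n + real n powr (- d) < \<delta>) sequentially"
    using order_tendstoD(2)[of _ 0 _ \<delta>] C(2) by simp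
  then have "eventually (\<lambda>n. \<forall>s. \<bar>\<beta> n * s\<bar> \<le> real n powr (- d) \<longrightarrow>
      norm (exp (E n s)) \<le> exp (C + Cv) * (2 / \<kappa>) * inverse (1 + s\<^sup>2)) sequentially"
    using Cv(2) lam_bounds lam_large[of "1 / \<kappa>"] L_large[of L0]
  proof eventually_elim
    case (elim n)
    show ?case
    proof (intro allI impI)
      fix s assume s: "\<bar>\<beta> n * s\<bar> \<le> real n powr (- d)"
      let ?y = "s / sqrt (lam n)"
      define u where "u = ln (1 + ?y\<^sup>2) / 2"
      have "1 \<le> 1 / \<kappa>" using \<kappa> by simp
      then have lam: "lam n > 0" using elim by linarith
      have small: "norm (w n s) \<le> \<delta>" using norm_w_le[of n s] s elim by linarith
      then have "ln (norm (w n s)) \<le> 0" using C(3) by (intro ln_le_zero_iff[THEN iffD2]) auto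
      then have uL: "u \<le> L n" unfolding u_def ln_norm_w[OF lam] by simp
      have u0: "u \<ge> 0" unfolding u_def using ln_one_plus_sq_nonneg[of ?y] by simp
      have "norm (G (exp (- w n s)) - PC (of_real (L n) - ln_one_plus_i ?y)) \<le> C * norm (w n s)"
        using C(4)[of "w n s"] small neg_Ln_w[OF lam] by simp
      also have "\<dots> \<le> C * 1" using small C by (intro mult_left_mono) auto
      finally have "Re (G (exp (- w n s))) \<le> C + Re (PC (of_real (L n) - ln_one_plus_i ?y))"
        using complex_Re_le_cmod[of "G (exp (- w n s)) - PC (of_real (L n) - ln_one_plus_i ?y)"] by simp
      also have "\<dots> \<le> C + (P (L n) - L n ^ k * u / (4 * real (k + 1)))"
        using L0(2)[of "L n" ?y] elim uL unfolding u_def by simp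
      finally have 1: "Re (G (exp (- w n s))) \<le> C + (P (L n) - L n ^ k * u / (4 * real (k + 1)))" .
      have 2: "Re (G (exp (- complex_of_real (v n)))) \<ge> P (L n) - Cv"
        using elim(2) abs_Re_le_cmod[of "G (exp (- complex_of_real (v n))) - of_real (P (L n))"] by simp
      have "\<kappa> * lam n * (2 * u) = (lam n / 2) * u / (4 * real (k + 1))" by (simp add: \<kappa>_def field_simps)
      also have "\<dots> \<le> L n ^ k * u / (4 * real (k + 1))"
        using elim u0 by (intro divide_right_mono mult_right_mono) auto
      finally have 3: "\<kappa> * lam n * (2 * u) \<le> L n ^ k * u / (4 * real (k + 1))" .
      have "norm (exp (E n s)) \<le> exp ((C + Cv) + - (\<kappa> * lam n * (2 * u)))"
        unfolding norm_exp_E using 1 2 3 by simp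
      also have "\<dots> = exp (C + Cv) * exp (- (\<kappa> * lam n * ln (1 + s\<^sup>2 / lam n)))"
        unfolding exp_add u_def sq_rescaled[OF lam] by simp
      also have "\<dots> \<le> exp (C + Cv) * (1 / (1 + (\<kappa> * lam n) * (s\<^sup>2 / lam n) / 2))"
      proof (intro mult_left_mono exp_neg_mult_ln_le)
        show "1 \<le> \<kappa> * lam n" using elim \<kappa> by (simp add: field_simps)
      qed (use lam in auto)
      also have "\<dots> = exp (C + Cv) * (1 / (1 + \<kappa> * s\<^sup>2 / 2))" using lam by simp
      also have "\<dots> \<le> exp (C + Cv) * ((2 / \<kappa>) * inverse (1 + s\<^sup>2))"
      proof (intro mult_left_mono)
        have "(\<kappa> / 2) * (1 + s\<^sup>2) \<le> 1 + \<kappa> * s\<^sup>2 / 2" using \<kappa> by (simp add: algebra_simps)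
        moreover have "0 < (\<kappa> / 2) * (1 + s\<^sup>2)" using \<kappa> by (intro mult_pos_pos) (auto simp: add_pos_nonneg)
        moreover have "0 < 1 + \<kappa> * s\<^sup>2 / 2" using \<kappa> by (intro add_pos_nonneg) auto
        ultimately have "1 / (1 + \<kappa> * s\<^sup>2 / 2) \<le> 1 / ((\<kappa> / 2) * (1 + s\<^sup>2))"
          by (intro divide_left_mono mult_pos_pos[where a = "1 + \<kappa> * s\<^sup>2 / 2"]) auto
        also have "\<dots> = (2 / \<kappa>) * inverse (1 + s\<^sup>2)" using \<kappa> by (simp add: field_simps)
        finally show "1 / (1 + \<kappa> * s\<^sup>2 / 2) \<le> (2 / \<kappa>) * inverse (1 + s\<^sup>2)" .
      qed auto
      finally show "norm (exp (E n s)) \<le> exp (C + Cv) * (2 / \<kappa>) * inverse (1 + s\<^sup>2)" by (simp add: mult_ac)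
    qed
  qed
  then show ?thesis by (rule that[rotated]) (use \<kappa> in simp)
qed

text \<open>Near 0 the bound \<open>\<bar>w\<bar> \<ge> n powr (- d)\<close> gives
  \<open>\<bar>Ln w\<bar> \<le> d * ln n + pi\<close>, so \<open>Q\<close> majorizes
  \<open>G\<close> up to a constant; farther away \<open>G\<close> is bounded by compactness.
  \<open>B\<close> absorbs \<open>pi\<close> and all error constants.\<close>

lemma exp_E_bound_outer:
  assumes d: "d > 0"
  obtains B where "B \<ge> 0"
    "eventually (\<lambda>n. \<forall>s. real n powr (- d) \<le> \<bar>\<beta> n * s\<bar> \<longrightarrow> \<bar>\<beta> n * s\<bar> \<le> pi \<longrightarrow>
       norm (exp (E n s)) \<le> exp (Q (d * ln (real n) + B) + B - P (L n))) sequentially"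
proof -
  obtain C \<delta> where C: "C > 0" "0 < \<delta>" "\<delta> \<le> 1"
    "\<And>w. 0 \<le> Re w \<Longrightarrow> w \<noteq> 0 \<Longrightarrow> norm w \<le> \<delta> \<Longrightarrow> norm (G (exp (- w)) - PC (- Ln w)) \<le> C * norm w"
    using G_near by blast
  obtain Cv where Cv: "Cv > 0" "eventually (\<lambda>n. norm (G (exp (- complex_of_real (v n))) - of_real (P (L n))) \<le> Cv) sequentially"
    using G_at_v by blast
  obtain B0 where B0: "\<And>w. 0 \<le> Re w \<Longrightarrow> Re w \<le> 1 \<Longrightarrow> \<bar>Im w\<bar> \<le> pi \<Longrightarrow> \<delta> \<le> norm w \<Longrightarrow> norm (G (exp (- w))) \<le> B0"
    using G_far[OF C(2)] by blast
  define B where "B = pi + C + Cv + \<bar>B0\<bar>"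
  have Bge: "B \<ge> pi" "B \<ge> 0" "B \<ge> C + Cv" "B \<ge> B0 + Cv" unfolding B_def using C(1) Cv(1) pi_ge_zero by linarith+
  have "eventually (\<lambda>n. v n < 1) sequentially" using order_tendstoD(2)[OF v_tendsto] by simp
  then have "eventually (\<lambda>n. \<forall>s. real n powr (- d) \<le> \<bar>\<beta> n * s\<bar> \<longrightarrow> \<bar>\<beta> n * s\<bar> \<le> pi \<longrightarrow>
       norm (exp (E n s)) \<le> exp (Q (d * ln (real n) + B) + B - P (L n))) sequentially"
    using Cv(2) eventually_ge_at_top[of 1]
  proof eventually_elim
    case (elim n)
    show ?case
    proof (intro allI impI)
      fix s assume s: "real n powr (- d) \<le> \<bar>\<beta> n * s\<bar>" "\<bar>\<beta> n * s\<bar> \<le> pi"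
      have dl: "d * ln (real n) \<ge> 0" using d elim by simp
      have Q0: "Q (d * ln (real n) + B) \<ge> 0" using dl Bge by (intro Q_nonneg) auto
      have "norm (G (exp (- w n s))) + Cv \<le> Q (d * ln (real n) + B) + B"
      proof (cases "norm (w n s) \<le> \<delta>")
        case True
        have n0: "norm (w n s) > 0" by simp
        have "real n powr (- d) \<le> norm (w n s)" using s(1) abs_Im_le_cmod[of "w n s"] by simp
        then have "ln (real n powr (- d)) \<le> ln (norm (w n s))" using elim by (intro ln_mono) auto
        then have l1: "- (d * ln (real n)) \<le> ln (norm (w n s))" using elim by (simp add: ln_powr)
        have l2: "ln (norm (w n s)) \<le> 0" using True C(3) by (intro ln_le_zero_iff[THEN iffD2]) auto
        have "norm (- Ln (w n s)) \<le> \<bar>Re (Ln (w n s))\<bar> + \<bar>Im (Ln (w n s))\<bar>"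
          unfolding norm_minus_cancel by (rule cmod_le)
        also have "\<dots> \<le> d * ln (real n) + pi"
        proof (rule add_mono)
          show "\<bar>Re (Ln (w n s))\<bar> \<le> d * ln (real n)" using l1 l2 by simp
          show "\<bar>Im (Ln (w n s))\<bar> \<le> pi" using mpi_less_Im_Ln[of "w n s"] Im_Ln_le_pi[of "w n s"] by simp
        qed
        also have "\<dots> \<le> d * ln (real n) + B" using Bge by simp
        finally have "norm (PC (- Ln (w n s))) \<le> Q (d * ln (real n) + B)" by (rule norm_PC_le)
        moreover have "norm (G (exp (- w n s)) - PC (- Ln (w n s))) \<le> C"
        proof -
          have "norm (G (exp (- w n s)) - PC (- Ln (w n s))) \<le> C * norm (w n s)" using True by (intro C(4)) auto
          also have "\<dots> \<le> C * 1" using True C by (intro mult_left_mono) auto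
          finally show ?thesis by simp
        qed
        ultimately show ?thesis
          using norm_triangle_sub[of "G (exp (- w n s))" "PC (- Ln (w n s))"] Bge by linarith
      next
        case False
        then have "norm (G (exp (- w n s))) \<le> B0" using s elim by (intro B0) auto
        then show ?thesis using Bge Q0 by linarith
      qed
      moreover have "Re (G (exp (- w n s))) \<le> norm (G (exp (- w n s)))" by (rule complex_Re_le_cmod)
      moreover have "Re (G (exp (- complex_of_real (v n)))) \<ge> P (L n) - Cv"
        using elim(2) abs_Re_le_cmod[of "G (exp (- complex_of_real (v n))) - of_real (P (L n))"] by simp
      ultimately show "norm (exp (E n s)) \<le> exp (Q (d * ln (real n) + B) + B - P (L n))"
        unfolding norm_exp_E by simp
    qed
  qed
  then show ?thesis by (rule that[rotated]) (use Bge in auto)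
qed

lemma L_le_ln: "eventually (\<lambda>n. L n \<le> 2 * ln (real n)) sequentially"
proof -
  have "eventually (\<lambda>n. L n / ln (real n) < 2) sequentially"
    using order_tendstoD(2)[OF L_over_ln, of 2] by simp
  with eventually_ge_at_top[of 2] show ?thesis
  proof eventually_elim
    case (elim n)
    then have "ln (real n) > 0" by simp
    then show ?case using elim by (simp add: field_simps)
  qed
qed

text \<open>\<open>lam\<close> is at most a power of \<open>ln n\<close>. So
  \<open>v = lam / n\<close>, and \<open>\<beta>\<close> with it, is negligible against the window
  width for every \<open>d < 1\<close>.\<close>

lemma lam_over_n_le_powr:
  assumes d: "d < 1"
  shows "eventually (\<lambda>n. C * (lam n / real n) \<le> real n powr (- d)) sequentially"
proof -
  have "((\<lambda>n. ln (real n) ^ k * real n powr (- (1 - d))) \<longlongrightarrow> 0) sequentially"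
    using d by real_asymp
  then have "(\<lambda>n. \<bar>C\<bar> * 2 * 2 ^ k * (ln (real n) ^ k * real n powr (- (1 - d)))) \<longlonglongrightarrow> 0"
    by (rule tendsto_mult_right_zero)
  from order_tendstoD(2)[OF this, of 1]
  have "eventually (\<lambda>n. \<bar>C\<bar> * 2 * 2 ^ k * (ln (real n) ^ k * real n powr (- (1 - d))) < 1) sequentially"
    by simp
  then show ?thesis using L_le_ln lam_bounds lam_large[of 0] L_large[of 0] eventually_ge_at_top[of 1]
  proof eventually_elim
    case (elim n)
    have "real n powr (- (1 - d)) * real n powr (- d) = real n powr (-1)"
      by (subst powr_add[symmetric]) simp
    then have pw: "real n powr (- (1 - d)) * real n powr (- d) = 1 / real n"
      using elim by (simp add: powr_minus_divide)
    have "2 * L n ^ k \<le> 2 * (2 * ln (real n)) ^ k" using elim by (intro mult_left_mono power_mono) auto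
    then have lam: "lam n \<le> 2 * (2 * ln (real n)) ^ k" using elim by linarith
    have "C * (lam n / real n) \<le> \<bar>C\<bar> * (2 * (2 * ln (real n)) ^ k / real n)"
      using lam elim by (intro mult_mono divide_right_mono) auto
    also have "\<dots> = \<bar>C\<bar> * 2 * 2 ^ k * ln (real n) ^ k * (1 / real n)" by (simp add: power_mult_distrib)
    also have "\<dots> = (\<bar>C\<bar> * 2 * 2 ^ k * (ln (real n) ^ k * real n powr (- (1 - d)))) * real n powr (- d)"
      unfolding pw[symmetric] by (simp only: mult.assoc)
    also have "\<dots> \<le> 1 * real n powr (- d)" using elim by (intro mult_right_mono) auto
    finally show ?case by simp
  qed
qed

text \<open>The window, measured in \<open>s\<close>, exhausts the line, so the inner integral
  converges to the full Gaussian.\<close>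

lemma eventually_inner:
  assumes d: "d < 1"
  shows "eventually (\<lambda>n. \<bar>\<beta> n * s\<bar> \<le> real n powr (- d)) sequentially"
  using lam_over_n_le_powr[OF d, of "\<bar>s\<bar>"] n_beta lam_large[of 1] eventually_ge_at_top[of 1]
proof eventually_elim
  case (elim n)
  have "real n * \<beta> n = sqrt (lam n)" using elim by simp
  also have "\<dots> \<le> lam n" using elim by (intro real_le_lsqrt) (auto simp: power2_eq_square)
  finally have "\<beta> n \<le> lam n / real n" using elim by (simp add: field_simps)
  then have "\<bar>s\<bar> * \<beta> n \<le> \<bar>s\<bar> * (lam n / real n)" by (intro mult_left_mono) auto
  moreover have "\<bar>\<beta> n * s\<bar> = \<bar>s\<bar> * \<beta> n" using elim by (simp add: abs_mult)
  ultimately show ?case using elim by linarith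
qed

lemma v_le_powr:
  assumes "d < 1" shows "eventually (\<lambda>n. v n \<le> real n powr (- d)) sequentially"
  using lam_over_n_le_powr[OF assms, of 1] n_v eventually_ge_at_top[of 1]
proof eventually_elim
  case (elim n)
  then have "v n = 1 * (lam n / real n)" by (simp add: field_simps)
  then show ?case using elim by linarith
qed

lemma integral_inner_tendsto:
  assumes d: "0 < d" "d < 1"
    and meas [measurable]: "\<And>n. \<Phi> n \<in> borel_measurable borel"
    and bound: "eventually (\<lambda>n. \<forall>s. \<bar>\<beta> n * s\<bar> \<le> real n powr (- d) \<longrightarrow> norm (\<Phi> n s) \<le> 2) sequentially"
    and lim: "\<And>s. (\<lambda>n. \<Phi> n s) \<longlonglongrightarrow> 1"
  shows "(\<lambda>n. LINT s|lborel. indicator {s. \<bar>\<beta> n * s\<bar> \<le> real n powr (- d)} s *\<^sub>R (exp (E n s) * \<Phi> n s)) \<longlonglongrightarrow> of_real (sqrt (2 * pi))"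
proof -
  let ?I = "\<lambda>n s. indicator {s. \<bar>\<beta> n * s\<bar> \<le> real n powr (- d)} s :: real"
  obtain C where C: "C > 0"
    "eventually (\<lambda>n. \<forall>s. \<bar>\<beta> n * s\<bar> \<le> real n powr (- d) \<longrightarrow> norm (exp (E n s)) \<le> C * inverse (1 + s\<^sup>2)) sequentially"
    using exp_E_bound_inner[OF d(1)] by blast
  from bound C(2) have "eventually (\<lambda>n. \<forall>s. norm (?I n s *\<^sub>R (exp (E n s) * \<Phi> n s)) \<le> C * inverse (1 + s\<^sup>2) * 2) sequentially"
  proof eventually_elim
    case (elim n)
    show ?case
    proof
      fix s
      show "norm (?I n s *\<^sub>R (exp (E n s) * \<Phi> n s)) \<le> C * inverse (1 + s\<^sup>2) * 2"
      proof (cases "\<bar>\<beta> n * s\<bar> \<le> real n powr (- d)")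
        case True
        then have "norm (exp (E n s)) * norm (\<Phi> n s) \<le> C * inverse (1 + s\<^sup>2) * 2"
          using elim C(1) by (intro mult_mono) (auto intro!: mult_nonneg_nonneg simp: add_nonneg_nonneg)
        then show ?thesis using True by (simp add: norm_mult)
      next
        case False
        have "0 \<le> C * inverse (1 + s\<^sup>2) * 2" using C(1) by (auto intro!: mult_nonneg_nonneg simp: add_nonneg_nonneg)
        then show ?thesis using False by simp
      qed
    qed
  qed
  \<comment> \<open>Dominated convergence asks for the bound at every index, but it holds only
    eventually; hence the shift by \<open>N\<close>.\<close>
  then obtain N where N: "\<And>n s. n \<ge> N \<Longrightarrow> norm (?I n s *\<^sub>R (exp (E n s) * \<Phi> n s)) \<le> C * inverse (1 + s\<^sup>2) * 2"
    unfolding eventually_sequentially by blast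
  have "(\<lambda>n. LINT s|lborel. ?I (n + N) s *\<^sub>R (exp (E (n + N) s) * \<Phi> (n + N) s)) \<longlonglongrightarrow>
      (LINT s|lborel. exp (- complex_of_real (s\<^sup>2 / 2)))"
  proof (rule integral_dominated_convergence[where w = "\<lambda>s. C * inverse (1 + s\<^sup>2) * 2"])
    show "(\<lambda>s. ?I (n + N) s *\<^sub>R (exp (E (n + N) s) * \<Phi> (n + N) s)) \<in> borel_measurable lborel" for n
      by measurable
    show "integrable lborel (\<lambda>s. C * inverse (1 + s\<^sup>2) * 2)"
      using integrable_inverse_one_plus_sq by simp
    show "AE s in lborel. (\<lambda>n. ?I (n + N) s *\<^sub>R (exp (E (n + N) s) * \<Phi> (n + N) s)) \<longlonglongrightarrow> exp (- complex_of_real (s\<^sup>2 / 2))"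
    proof (rule AE_I2)
      fix s
      have ev: "eventually (\<lambda>n. \<bar>\<beta> n * s\<bar> \<le> real n powr (- d)) sequentially"
        using d by (intro eventually_inner) auto
      have "(\<lambda>n. exp (E n s) * \<Phi> n s) \<longlonglongrightarrow> exp (- complex_of_real (s\<^sup>2 / 2)) * 1"
        by (intro tendsto_intros E_tendsto lim)
      then have "(\<lambda>n. exp (E n s) * \<Phi> n s) \<longlonglongrightarrow> exp (- complex_of_real (s\<^sup>2 / 2))" by simp
      then have "(\<lambda>n. ?I n s *\<^sub>R (exp (E n s) * \<Phi> n s)) \<longlonglongrightarrow> exp (- complex_of_real (s\<^sup>2 / 2))"
        by (rule Lim_transform_eventually) (use ev in eventually_elim, simp)
      then show "(\<lambda>n. ?I (n + N) s *\<^sub>R (exp (E (n + N) s) * \<Phi> (n + N) s)) \<longlonglongrightarrow> exp (- complex_of_real (s\<^sup>2 / 2))"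
        by (rule LIMSEQ_ignore_initial_segment)
    qed
    show "AE s in lborel. norm (?I (n + N) s *\<^sub>R (exp (E (n + N) s) * \<Phi> (n + N) s)) \<le> C * inverse (1 + s\<^sup>2) * 2" for n
      by (intro AE_I2 N) simp
    show "(\<lambda>s. exp (- complex_of_real (s\<^sup>2 / 2))) \<in> borel_measurable lborel" by measurable
  qed
  note lim_shifted = this
  have gauss: "(LINT s|lborel. exp (- complex_of_real (s\<^sup>2 / 2))) = of_real (sqrt (2 * pi))"
  proof -
    have "exp (- complex_of_real (s\<^sup>2 / 2)) = of_real (exp (- (s\<^sup>2 / 2)))" for s
      by (subst exp_of_real[symmetric]) simp
    then have "(LINT s|lborel. exp (- complex_of_real (s\<^sup>2 / 2))) = (LINT s|lborel. of_real (exp (- (s\<^sup>2 / 2))))" by simp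
    also have "\<dots> = of_real (LINT s|lborel. exp (- (s\<^sup>2 / 2)))" by (rule integral_complex_of_real)
    finally show ?thesis unfolding integral_gaussian .
  qed
  show ?thesis
    by (rule LIMSEQ_offset[of "\<lambda>n. LINT s|lborel. ?I n s *\<^sub>R (exp (E n s) * \<Phi> n s)" N]) (rule lim_shifted[unfolded gauss])
qed

text \<open>Dividing by \<open>(ln n) ^ (k + 1)\<close> leaves
  \<open>(5 * d ^ (k + 1) - 1) / (k + 1) < 0\<close>. The first summand comes from the length of the
  interval of integration and is of lower order because \<open>k \<ge> 1\<close>.\<close>

lemma outer_exponent_at_bot:
  assumes d: "d > 0" "5 * d ^ (k + 1) < 1"
  shows "filterlim (\<lambda>n. ln (real n) + 5 * Q (d * ln (real n) + B) + B - P (L n)) at_bot sequentially"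
proof -
  have ln_top: "filterlim (\<lambda>n. ln (real n)) at_top sequentially"
    by (rule filterlim_compose[OF ln_at_top filterlim_real_sequentially])
  have Qlim: "((\<lambda>x. Q (d * x + B) / x ^ (k + 1)) \<longlongrightarrow> 1 / real (k + 1) * d ^ (k + 1)) at_top"
  proof (rule Lim_transform_eventually)
    have top: "filterlim (\<lambda>x. d * x + B) at_top at_top" using d by real_asymp
    have "((\<lambda>x. (d * x + B) / x) \<longlongrightarrow> d) at_top" by real_asymp
    then show "((\<lambda>x. Q (d * x + B) / (d * x + B) ^ (k + 1) * ((d * x + B) / x) ^ (k + 1)) \<longlongrightarrow> 1 / real (k + 1) * d ^ (k + 1)) at_top"
      by (intro tendsto_mult tendsto_power filterlim_compose[OF Q_tendsto top])
    have "eventually (\<lambda>x. d * x + B > 0) at_top" using top unfolding filterlim_at_top_dense by blast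
    with eventually_gt_at_top[of 0] show "eventually (\<lambda>x. Q (d * x + B) / (d * x + B) ^ (k + 1) * ((d * x + B) / x) ^ (k + 1) = Q (d * x + B) / x ^ (k + 1)) at_top"
      by eventually_elim (simp add: power_divide del: power_Suc)
  qed
  have Plim: "(\<lambda>n. P (L n) / ln (real n) ^ (k + 1)) \<longlonglongrightarrow> 1 / real (k + 1) * 1 ^ (k + 1)"
  proof (rule Lim_transform_eventually)
    show "(\<lambda>n. P (L n) / L n ^ (k + 1) * (L n / ln (real n)) ^ (k + 1)) \<longlonglongrightarrow> 1 / real (k + 1) * 1 ^ (k + 1)"
      by (intro tendsto_mult tendsto_power filterlim_compose[OF P_tendsto L_top] L_over_ln)
    show "eventually (\<lambda>n. P (L n) / L n ^ (k + 1) * (L n / ln (real n)) ^ (k + 1) = P (L n) / ln (real n) ^ (k + 1)) sequentially"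
      using L_large[of 1] eventually_gt_at_top[of 1]
      by eventually_elim (auto simp: power_divide simp del: power_Suc)
  qed
  let ?x = "\<lambda>n. ln (real n)"
  let ?T = "\<lambda>n. ?x n ^ 1 / ?x n ^ (k + 1) + 5 * (Q (d * ?x n + B) / ?x n ^ (k + 1)) + B * (?x n ^ 0 / ?x n ^ (k + 1)) - P (L n) / ?x n ^ (k + 1)"
  have "(\<lambda>n. ?T n)
      \<longlonglongrightarrow> 0 + 5 * (1 / real (k + 1) * d ^ (k + 1)) + B * 0 - 1 / real (k + 1) * 1 ^ (k + 1)"
    by (intro tendsto_add tendsto_diff tendsto_mult tendsto_const Plim filterlim_compose[OF Qlim ln_top]
        filterlim_compose[OF power_ratio_tendsto_0 ln_top]) (use k in auto)
  moreover have "0 + 5 * (1 / real (k + 1) * d ^ (k + 1)) + B * 0 - 1 / real (k + 1) * 1 ^ (k + 1) = (5 * d ^ (k + 1) - 1) / real (k + 1)"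
    by (simp add: diff_divide_distrib)
  ultimately have lim: "(\<lambda>n. ?T n)
      \<longlonglongrightarrow> (5 * d ^ (k + 1) - 1) / real (k + 1)" by simp
  have neg: "(5 * d ^ (k + 1) - 1) / real (k + 1) < 0" using d by (intro divide_neg_pos) auto
  have "filterlim (\<lambda>n. ?x n ^ (k + 1)) at_top sequentially"
    by (rule filterlim_pow_at_top) (use ln_top in auto)
  from filterlim_tendsto_neg_mult_at_bot[OF lim neg this]
  show ?thesis
  proof (rule filterlim_mono_eventually[OF _ order.refl order.refl])
    show "eventually (\<lambda>n. ?T n * ?x n ^ (k + 1) =
        ln (real n) + 5 * Q (d * ln (real n) + B) + B - P (L n)) sequentially"
      using eventually_gt_at_top[of 1]
    proof eventually_elim
      case (elim n)
      then have "?x n ^ (k + 1) \<noteq> 0" by simp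
      then show ?case by (simp add: algebra_simps del: power_Suc)
    qed
  qed
qed

lemma integrable_bounded_on:
  fixes h :: "real \<Rightarrow> complex"
  assumes [measurable]: "h \<in> borel_measurable borel" "S \<in> sets borel"
    and S: "S \<subseteq> {-a..a}" and M: "\<And>s. s \<in> S \<Longrightarrow> norm (h s) \<le> M"
  shows "integrable lborel (\<lambda>s. indicator S s *\<^sub>R h s)"
    and "a \<ge> 0 \<Longrightarrow> M \<ge> 0 \<Longrightarrow> norm (LINT s|lborel. indicator S s *\<^sub>R h s) \<le> M * (2 * a)"
proof -
  let ?g = "\<lambda>s. indicator {-a..a} s *\<^sub>R \<bar>M\<bar>"
  have g: "integrable lborel ?g" by (intro integrable_real_indicator integrable_scaleR_left) (auto simp: emeasure_lborel_Icc_eq)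
  have le: "norm (indicator S s *\<^sub>R h s) \<le> ?g s" for s
    using S M[of s] by (auto simp: indicator_def split: if_splits)
  show int: "integrable lborel (\<lambda>s. indicator S s *\<^sub>R h s)"
    by (rule Bochner_Integration.integrable_bound[OF g]) (use le in auto)
  assume a: "a \<ge> 0" "M \<ge> 0"
  have "norm (LINT s|lborel. indicator S s *\<^sub>R h s) \<le> (LINT s|lborel. norm (indicator S s *\<^sub>R h s))"
    by (rule integral_norm_bound)
  also have "\<dots> \<le> (LINT s|lborel. ?g s)"
    by (rule integral_mono[OF integrable_norm[OF int] g]) (rule le)
  also have "\<dots> = M * (2 * a)" using a by simp
  finally show "norm (LINT s|lborel. indicator S s *\<^sub>R h s) \<le> M * (2 * a)" .
qed

text \<open>\<Phi> stays abstract so that one statement serves both numerator and denominator of the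
  ratio. Its global bound uses four of the five multiples of \<open>Q\<close>, and
  \<open>exp (E n s)\<close> outside the window the fifth.\<close>

lemma saddle_integral_tendsto:
  assumes d: "0 < d" "d < 1" "5 * d ^ (k + 1) < 1"
    and meas [measurable]: "\<And>n. \<Phi> n \<in> borel_measurable borel"
    and bound: "eventually (\<lambda>n. \<forall>s. \<bar>\<beta> n * s\<bar> \<le> real n powr (- d) \<longrightarrow> norm (\<Phi> n s) \<le> 2) sequentially"
    and lim: "\<And>s. (\<lambda>n. \<Phi> n s) \<longlonglongrightarrow> 1"
    and B': "B' \<ge> 0" and bound': "eventually (\<lambda>n. \<forall>s. norm (\<Phi> n s) \<le> exp (4 * Q (d * ln (real n) + B') + B')) sequentially"
  shows "(\<lambda>n. LINT s|lborel. indicator {- (pi / \<beta> n)..pi / \<beta> n} s *\<^sub>R (exp (E n s) * \<Phi> n s)) \<longlonglongrightarrow> of_real (sqrt (2 * pi))"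
proof -
  obtain C where C: "C > 0"
    "eventually (\<lambda>n. \<forall>s. \<bar>\<beta> n * s\<bar> \<le> real n powr (- d) \<longrightarrow> norm (exp (E n s)) \<le> C * inverse (1 + s\<^sup>2)) sequentially"
    using exp_E_bound_inner[OF d(1)] by blast
  obtain B where B: "B \<ge> 0"
    "eventually (\<lambda>n. \<forall>s. real n powr (- d) \<le> \<bar>\<beta> n * s\<bar> \<longrightarrow> \<bar>\<beta> n * s\<bar> \<le> pi \<longrightarrow>
       norm (exp (E n s)) \<le> exp (Q (d * ln (real n) + B) + B - P (L n))) sequentially"
    using exp_E_bound_outer[OF d(1)] by blast
  define D where "D = B + B'"
  define h where "h n s = exp (E n s) * \<Phi> n s" for n s
  have hm [measurable]: "h n \<in> borel_measurable borel" for n unfolding h_def by measurable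
  define S1 where "S1 n = {s. \<bar>\<beta> n * s\<bar> \<le> real n powr (- d)}" for n
  define S2 where "S2 n = {s. real n powr (- d) < \<bar>\<beta> n * s\<bar> \<and> \<bar>\<beta> n * s\<bar> \<le> pi}" for n
  have S_meas [measurable]: "S1 n \<in> sets borel" "S2 n \<in> sets borel" for n
    unfolding S1_def S2_def by measurable
  define H where "H n = ln (real n) + 5 * Q (d * ln (real n) + D) + D - P (L n)" for n
  have Hlim: "filterlim H at_bot sequentially" unfolding H_def by (rule outer_exponent_at_bot[OF d(1,3)])
  have main: "eventually (\<lambda>n. (LINT s|lborel. indicator {- (pi / \<beta> n)..pi / \<beta> n} s *\<^sub>R h n s) =
      (LINT s|lborel. indicator (S1 n) s *\<^sub>R h n s) + (LINT s|lborel. indicator (S2 n) s *\<^sub>R h n s) \<and>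
      norm (LINT s|lborel. indicator (S2 n) s *\<^sub>R h n s) \<le> 2 * pi * exp (H n)) sequentially"
    using C(2) B(2) bound bound' n_beta lam_large[of 1] eventually_ge_at_top[of 1]
  proof eventually_elim
    case (elim n)
    have \<beta>: "\<beta> n > 0" and n\<beta>: "real n * \<beta> n = sqrt (lam n)" using elim by auto
    have pw: "real n powr (- d) \<le> pi"
    proof -
      have "real n powr (- d) \<le> real n powr 0" using elim d by (intro powr_mono) auto
      then show ?thesis using elim pi_gt3 by simp
    qed
    have mem: "s \<in> {- (pi / \<beta> n)..pi / \<beta> n} \<longleftrightarrow> \<bar>\<beta> n * s\<bar> \<le> pi" for s
    proof -
      have "s \<in> {- (pi / \<beta> n)..pi / \<beta> n} \<longleftrightarrow> \<bar>s\<bar> \<le> pi / \<beta> n" unfolding abs_le_iff by auto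
      also have "\<dots> \<longleftrightarrow> \<bar>\<beta> n * s\<bar> \<le> pi" using \<beta> by (simp add: abs_mult pos_le_divide_eq mult.commute)
      finally show ?thesis .
    qed
    have sub1: "S1 n \<subseteq> {- (pi / \<beta> n)..pi / \<beta> n}"
      unfolding subset_iff mem S1_def using pw by auto
    have sub2: "S2 n \<subseteq> {- (pi / \<beta> n)..pi / \<beta> n}"
      unfolding subset_iff mem S2_def by auto
    have un: "indicator {- (pi / \<beta> n)..pi / \<beta> n} s = (indicator (S1 n) s + indicator (S2 n) s :: real)" for s
    proof (cases "\<bar>\<beta> n * s\<bar> \<le> real n powr (- d)")
      case True
      then have "s \<in> S1 n" "s \<notin> S2 n" by (auto simp: S1_def S2_def)
      moreover from this have "s \<in> {- (pi / \<beta> n)..pi / \<beta> n}" using sub1 by blast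
      ultimately show ?thesis by simp
    next
      case False
      then have "s \<notin> S1 n" "s \<in> S2 n \<longleftrightarrow> s \<in> {- (pi / \<beta> n)..pi / \<beta> n}"
        unfolding mem by (auto simp: S1_def S2_def)
      then show ?thesis by (simp add: indicator_def)
    qed
    have dl: "d * ln (real n) \<ge> 0" using d elim by simp
    let ?M = "exp (Q (d * ln (real n) + B) + B - P (L n)) * exp (4 * Q (d * ln (real n) + B') + B')"
    have "norm (h n s) \<le> C * 2" if "s \<in> S1 n" for s
    proof -
      have "norm (exp (E n s)) \<le> C * inverse (1 + s\<^sup>2)" using elim that by (auto simp: S1_def)
      also have "\<dots> \<le> C * 1" using C(1) by (intro mult_left_mono) (auto simp: field_simps add_pos_nonneg)
      finally show ?thesis unfolding h_def norm_mult using elim that C(1)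
        by (intro mult_mono) (auto simp: S1_def)
    qed
    then have i1: "integrable lborel (\<lambda>s. indicator (S1 n) s *\<^sub>R h n s)"
      by (intro integrable_bounded_on(1)[OF _ _ sub1]) auto
    have b2: "norm (h n s) \<le> ?M" if "s \<in> S2 n" for s
      unfolding h_def norm_mult using elim that by (intro mult_mono) (auto simp: S2_def)
    then have i2: "integrable lborel (\<lambda>s. indicator (S2 n) s *\<^sub>R h n s)"
      by (intro integrable_bounded_on(1)[OF _ _ sub2]) auto
    have eq: "(LINT s|lborel. indicator {- (pi / \<beta> n)..pi / \<beta> n} s *\<^sub>R h n s) =
      (LINT s|lborel. indicator (S1 n) s *\<^sub>R h n s) + (LINT s|lborel. indicator (S2 n) s *\<^sub>R h n s)"
      unfolding un scaleR_add_left by (rule Bochner_Integration.integral_add[OF i1 i2])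
    have "norm (LINT s|lborel. indicator (S2 n) s *\<^sub>R h n s) \<le> ?M * (2 * (pi / \<beta> n))"
      using \<beta> by (intro integrable_bounded_on(2)[OF _ _ sub2 b2]) auto
    \<comment> \<open>\<open>n * \<beta> = sqrt lam \<ge> 1\<close>, so the length of the interval
      is at most \<open>2 * pi * n\<close>: the origin of \<open>ln n\<close> in
      \<open>H\<close>.\<close>
    also have "\<dots> \<le> ?M * (2 * (pi * real n))"
    proof (intro mult_left_mono)
      have "1 \<le> real n * \<beta> n" unfolding n\<beta> using elim by simp
      then have "1 / \<beta> n \<le> real n" using \<beta> by (simp add: field_simps)
      then have "pi * (1 / \<beta> n) \<le> pi * real n" by (intro mult_left_mono) auto
      then show "pi / \<beta> n \<le> pi * real n" by simp
    qed auto
    also have "\<dots> = 2 * pi * exp (ln (real n) + Q (d * ln (real n) + B) + B - P (L n) + 4 * Q (d * ln (real n) + B') + B')"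
      using elim by (simp add: exp_add exp_diff)
    also have "\<dots> \<le> 2 * pi * exp (H n)"
    proof -
      have "Q (d * ln (real n) + B) \<le> Q (d * ln (real n) + D)" "Q (d * ln (real n) + B') \<le> Q (d * ln (real n) + D)"
        using dl B(1) B' by (auto intro!: Q_mono simp: D_def)
      then show ?thesis unfolding H_def D_def by (intro mult_left_mono) auto
    qed
    finally show ?case using eq by simp
  qed
  have "(\<lambda>n. LINT s|lborel. indicator (S2 n) s *\<^sub>R h n s) \<longlonglongrightarrow> 0"
  proof (rule Lim_null_comparison)
    show "eventually (\<lambda>n. norm (LINT s|lborel. indicator (S2 n) s *\<^sub>R h n s) \<le> 2 * pi * exp (H n)) sequentially"
      using main by eventually_elim auto
    show "(\<lambda>n. 2 * pi * exp (H n)) \<longlonglongrightarrow> 0"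
      by (intro tendsto_mult_right_zero filterlim_compose[OF exp_at_bot Hlim])
  qed
  then have "(\<lambda>n. (LINT s|lborel. indicator (S1 n) s *\<^sub>R h n s) + (LINT s|lborel. indicator (S2 n) s *\<^sub>R h n s)) \<longlonglongrightarrow> of_real (sqrt (2 * pi)) + 0"
    unfolding h_def S1_def by (intro tendsto_add integral_inner_tendsto[OF d(1,2) meas bound lim])
  then have "(\<lambda>n. LINT s|lborel. indicator {- (pi / \<beta> n)..pi / \<beta> n} s *\<^sub>R h n s) \<longlonglongrightarrow> of_real (sqrt (2 * pi)) + 0"
    by (rule Lim_transform_eventually) (use main in eventually_elim, simp)
  then show ?thesis unfolding h_def by (simp only: add_0_right)
qed

end

section \<open>Ratios of normalization constants\<close>

definition truncate_low :: "nat \<Rightarrow> (nat \<Rightarrow> real) \<Rightarrow> nat \<Rightarrow> real" where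
  "truncate_low b x = (\<lambda>m. if m \<le> b then 0 else x m)"

lemma truncate_low_gf:
  fixes t :: complex
  assumes "summable (\<lambda>m. of_real (x (Suc m) / real (Suc m)) * t ^ Suc m)"
  shows "summable (\<lambda>m. of_real (truncate_low b x (Suc m) / real (Suc m)) * t ^ Suc m)"
    and "cycle_gf (truncate_low b x) t = cycle_gf x t - (\<Sum>m=1..b. of_real (x m / real m) * t ^ m)"
proof -
  let ?f = "\<lambda>m. of_real (x (Suc m) / real (Suc m)) * t ^ Suc m"
  let ?h = "\<lambda>m. if m \<in> {..<b} then ?f m else 0"
  have h: "?h sums (\<Sum>m<b. ?f m)" using sums_If_finite_set[of "{..<b}" ?f] by simp
  have eq: "of_real (truncate_low b x (Suc m) / real (Suc m)) * t ^ Suc m = ?f m - ?h m" for m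
    by (auto simp: truncate_low_def)
  have "(\<lambda>m. ?f m - ?h m) sums (suminf ?f - (\<Sum>m<b. ?f m))"
    by (intro sums_diff h summable_sums assms)
  moreover have "(\<Sum>m<b. ?f m) = (\<Sum>m=1..b. of_real (x m / real m) * t ^ m)"
    by (rule sum.reindex_bij_witness[of _ "\<lambda>m. m - 1" Suc]) auto
  ultimately have S: "(\<lambda>m. of_real (truncate_low b x (Suc m) / real (Suc m)) * t ^ Suc m) sums
      (cycle_gf x t - (\<Sum>m=1..b. of_real (x m / real m) * t ^ m))"
    unfolding eq cycle_gf_def by simp
  show "summable (\<lambda>m. of_real (truncate_low b x (Suc m) / real (Suc m)) * t ^ Suc m)"
    using S by (rule sums_summable)
  show "cycle_gf (truncate_low b x) t = cycle_gf x t - (\<Sum>m=1..b. of_real (x m / real m) * t ^ m)"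
    unfolding cycle_gf_def[of "truncate_low b x"] using S by (rule sums_unique[symmetric])
qed

text \<open>Mean value inequality on the convex left half-plane, where the derivative has modulus at
  most 1.\<close>

lemma norm_exp_minus_1_le:
  fixes z :: complex
  assumes "Re z \<le> 0"
  shows "norm (exp z - 1) \<le> norm z"
proof -
  have "norm (exp z - exp 0) \<le> 1 * norm (z - 0)"
  proof (rule field_differentiable_bound[of "{z. Re z \<le> 0}" exp exp])
    show "convex {z. Re z \<le> 0}" by (rule convex_halfspace_Re_le)
    show "(exp has_field_derivative exp u) (at u within {z. Re z \<le> 0})" for u :: complex
      by (auto intro!: derivative_eq_intros)
  qed (use assms in auto)
  then show ?thesis by simp
qed

context log_singularity
begin

text \<open>The \<open>g\<^sub>b 1\<close> of the overview, also the total rate of the Poisson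
  vector.\<close>

definition g1 :: "nat \<Rightarrow> real" where
  "g1 b = (\<Sum>m=1..b. \<theta> m / real m)"

lemma g1_nonneg: "g1 b \<ge> 0"
  unfolding g1_def by (intro sum_nonneg divide_nonneg_nonneg \<theta>_nonneg) auto

text \<open>The weight \<open>2 * 2 powr (- m / N)\<close> is at least 1 for \<open>m \<le> N\<close>; its constant 2 is small enough for the
  margin left by the hypothesis on \<open>c\<close>.\<close>

lemma g1_le_G:
  assumes N: "N > 0" and b: "real b \<le> N"
  shows "g1 b \<le> 2 * norm (G (exp (- complex_of_real (ln 2 / N))))"
proof -
  define q where "q = exp (- (ln 2 / N))"
  have q: "0 < q" "q < 1" using N by (auto simp: q_def)
  let ?f = "\<lambda>m. \<theta> (Suc m) / real (Suc m) * q ^ Suc m"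
  have "summable (\<lambda>m. complex_of_real (?f m))"
    using summ[of "complex_of_real q"] q by simp
  then have S: "summable ?f" by (simp only: summable_complex_of_real)
  have nn: "?f m \<ge> 0" for m using \<theta>_nonneg[of "Suc m"] q by (intro mult_nonneg_nonneg) auto
  have "g1 b = (\<Sum>m<b. \<theta> (Suc m) / real (Suc m))"
    unfolding g1_def by (rule sum.reindex_bij_witness[of _ Suc "\<lambda>m. m - 1"]) auto
  also have "\<dots> \<le> (\<Sum>m<b. 2 * ?f m)"
  proof (rule sum_mono)
    fix m assume m: "m \<in> {..<b}"
    then have "real (Suc m) \<le> N" using b by simp
    then have "real (Suc m) / N \<le> 1" using N by simp
    then have "real (Suc m) / N * ln 2 \<le> 1 * ln 2" by (intro mult_right_mono) auto
    then have "exp (- ln 2) \<le> exp (- (real (Suc m) / N * ln 2))" by simp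
    also have "\<dots> = q ^ Suc m" unfolding q_def exp_of_nat_mult[symmetric] by (simp add: field_simps)
    finally have "1 / 2 \<le> q ^ Suc m" by (simp add: exp_minus)
    then have "\<theta> (Suc m) / real (Suc m) * 1 \<le> \<theta> (Suc m) / real (Suc m) * (2 * q ^ Suc m)"
      using \<theta>_nonneg[of "Suc m"] by (intro mult_left_mono) auto
    then show "\<theta> (Suc m) / real (Suc m) \<le> 2 * ?f m" by (simp add: mult_ac)
  qed
  also have "\<dots> = 2 * (\<Sum>m<b. ?f m)" by (simp only: sum_distrib_left)
  also have "(\<Sum>m<b. ?f m) \<le> suminf ?f" using S nn by (intro sum_le_suminf) auto
  also have "suminf ?f \<le> norm (complex_of_real (suminf ?f))" by simp
  also have "complex_of_real (suminf ?f) = G (complex_of_real q)"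
  proof -
    have "complex_of_real (suminf ?f) = (\<Sum>m. complex_of_real (?f m))" by (rule suminf_of_real[OF S])
    also have "\<dots> = cycle_gf \<theta> (complex_of_real q)" unfolding cycle_gf_def by simp
    also have "\<dots> = G (complex_of_real q)" using q by (intro G_eq[symmetric]) simp
    finally show ?thesis .
  qed
  also have "complex_of_real q = exp (- complex_of_real (ln 2 / N))"
    unfolding q_def exp_of_real[symmetric] by simp
  finally show ?thesis by simp
qed

text \<open>\<open>g1_le_G\<close> with \<open>N = n powr d\<close> evaluates \<open>G\<close> at
  \<open>w = ln 2 / n powr d\<close>, where \<open>- Ln w = d * ln n - ln (ln 2)\<close>. The same
  \<open>w\<close> serves all \<open>b \<le> N\<close>, so the threshold in \<open>n\<close> does
  not depend on \<open>b\<close>.\<close>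

lemma g1_bound:
  assumes d: "d > 0"
  obtains C where "C > 0"
    "eventually (\<lambda>n. \<forall>b. real b \<le> real n powr d \<longrightarrow> g1 b \<le> 2 * Q (d * ln (real n) + 1) + C) sequentially"
proof -
  obtain C \<delta> where C: "C > 0" "0 < \<delta>" "\<delta> \<le> 1"
    "\<And>w. 0 \<le> Re w \<Longrightarrow> w \<noteq> 0 \<Longrightarrow> norm w \<le> \<delta> \<Longrightarrow> norm (G (exp (- w)) - PC (- Ln w)) \<le> C * norm w"
    using G_near by blast
  have "(\<lambda>n. ln 2 / real n powr d) \<longlonglongrightarrow> 0" using d by real_asymp
  from order_tendstoD(2)[OF this C(2)]
  have "eventually (\<lambda>n. \<forall>b. real b \<le> real n powr d \<longrightarrow> g1 b \<le> 2 * Q (d * ln (real n) + 1) + 2 * C) sequentially"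
    using eventually_ge_at_top[of 1]
  proof eventually_elim
    case (elim n)
    show ?case
    proof (intro allI impI)
      fix b assume b: "real b \<le> real n powr d"
      define u where "u = ln 2 / real n powr d"
      have u: "u > 0" "u < \<delta>" using elim by (auto simp: u_def)
      have "g1 b \<le> 2 * norm (G (exp (- complex_of_real u)))"
        unfolding u_def using elim b by (intro g1_le_G) auto
      also have "norm (G (exp (- complex_of_real u))) \<le> Q (d * ln (real n) + 1) + C"
      proof -
        have "norm (G (exp (- complex_of_real u)) - PC (- Ln (complex_of_real u))) \<le> C * norm (complex_of_real u)"
          using u elim by (intro C(4)) auto
        also have "\<dots> \<le> C * 1" using u elim C by (intro mult_left_mono) auto
        finally have 1: "norm (G (exp (- complex_of_real u)) - PC (- Ln (complex_of_real u))) \<le> C" by simp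
        have lnu: "ln u = ln (ln 2) - d * ln (real n)"
          unfolding u_def using elim by (subst ln_div) (auto simp: ln_powr)
        \<comment> \<open>The 1 absorbs \<open>- ln (ln 2)\<close>, which lies between 0 and
          1.\<close>
        have "\<bar>ln u\<bar> \<le> d * ln (real n) + 1"
        proof -
          have l2: "2 / 3 \<le> ln (2::real)" by (rule ln2_ge_two_thirds)
          have "ln (inverse (ln (2::real))) \<le> inverse (ln 2) - 1" using l2 by (intro ln_le_minus_one) simp
          moreover have "inverse (ln (2::real)) \<le> inverse (2 / 3)" using l2 by (intro le_imp_inverse_le) auto
          ultimately have "- ln (ln (2::real)) \<le> 1" using l2 by (simp add: ln_inverse)
          moreover have "ln (ln (2::real)) \<le> 0" using ln_2_less_1 l2 by (intro ln_le_zero_iff[THEN iffD2]) auto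
          moreover have "d * ln (real n) \<ge> 0" using d elim by simp
          ultimately show ?thesis unfolding lnu by linarith
        qed
        then have "norm (- Ln (complex_of_real u)) \<le> d * ln (real n) + 1"
          using u by (simp only: Ln_of_real norm_minus_cancel norm_of_real)
        then have "norm (PC (- Ln (complex_of_real u))) \<le> Q (d * ln (real n) + 1)" by (rule norm_PC_le)
        with 1 show ?thesis
          using norm_triangle_sub[of "G (exp (- complex_of_real u))" "PC (- Ln (complex_of_real u))"] by linarith
      qed
      finally show "g1 b \<le> 2 * Q (d * ln (real n) + 1) + 2 * C" by simp
    qed
  qed
  then show ?thesis by (rule that[rotated]) (use C in simp)
qed

lemma Q_powr_tendsto_0:
  assumes "a > 0"
  shows "(\<lambda>n. Q (d * ln (real n) + B) * real n powr (- a)) \<longlonglongrightarrow> 0"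
proof -
  have *: "(\<lambda>n. (d * ln (real n) + B) ^ j * real n powr (- a)) \<longlonglongrightarrow> 0" for j
  proof (rule Lim_null_comparison)
    show "eventually (\<lambda>n. norm ((d * ln (real n) + B) ^ j * real n powr (- a)) \<le> (\<bar>d\<bar> + \<bar>B\<bar>) ^ j * (ln (real n) ^ j * real n powr (- a))) sequentially"
      using eventually_ge_at_top[of 3]
    proof eventually_elim
      case (elim n)
      have "ln 3 \<le> ln (real n)" using elim by (intro ln_mono) auto
      moreover have "1 \<le> ln (3::real)" using exp_le ln_ge_iff[of 3 1] by simp
      ultimately have l: "1 \<le> ln (real n)" by simp
      have "\<bar>d * ln (real n) + B\<bar> \<le> \<bar>d\<bar> * ln (real n) + \<bar>B\<bar> * 1"
        using l by (intro order.trans[OF abs_triangle_ineq]) (simp add: abs_mult)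
      also have "\<dots> \<le> (\<bar>d\<bar> + \<bar>B\<bar>) * ln (real n)" using mult_left_mono[OF l, of "\<bar>B\<bar>"] by (simp add: distrib_right)
      finally have "\<bar>d * ln (real n) + B\<bar> ^ j \<le> ((\<bar>d\<bar> + \<bar>B\<bar>) * ln (real n)) ^ j" by (intro power_mono) auto
      then have "\<bar>d * ln (real n) + B\<bar> ^ j * real n powr (- a) \<le> ((\<bar>d\<bar> + \<bar>B\<bar>) * ln (real n)) ^ j * real n powr (- a)"
        by (intro mult_right_mono) auto
      moreover have "norm ((d * ln (real n) + B) ^ j * real n powr (- a)) = \<bar>d * ln (real n) + B\<bar> ^ j * real n powr (- a)"
        by (simp add: abs_mult power_abs)
      ultimately show ?case by (simp only: power_mult_distrib mult.assoc)
    qed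
    have "((\<lambda>n. ln (real n) ^ j * real n powr (- a)) \<longlongrightarrow> 0) sequentially" using assms by real_asymp
    then show "(\<lambda>n. (\<bar>d\<bar> + \<bar>B\<bar>) ^ j * (ln (real n) ^ j * real n powr (- a))) \<longlonglongrightarrow> 0"
      by (rule tendsto_mult_right_zero)
  qed
  have "(\<lambda>n. ((d * ln (real n) + B) ^ (k + 1) * real n powr (- a)) / real (k + 1) + (\<Sum>j\<le>k. \<bar>c j\<bar> * ((d * ln (real n) + B) ^ j * real n powr (- a))))
      \<longlonglongrightarrow> 0 / real (k + 1) + (\<Sum>j\<le>k. \<bar>c j\<bar> * 0)"
    by (intro tendsto_intros *) auto
  moreover have "((d * ln (real n) + B) ^ (k + 1) * real n powr (- a)) / real (k + 1) + (\<Sum>j\<le>k. \<bar>c j\<bar> * ((d * ln (real n) + B) ^ j * real n powr (- a)))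
      = Q (d * ln (real n) + B) * real n powr (- a)" for n
    unfolding Q_def by (simp add: distrib_right sum_distrib_right mult.assoc del: power_Suc)
  ultimately show ?thesis by (simp only:) simp
qed

lemma g1_powr_tendsto_0:
  assumes a: "a > 0" and d: "d > 0" and b: "eventually (\<lambda>n. real (b n) \<le> real n powr d) sequentially"
  shows "(\<lambda>n. g1 (b n) * real n powr (- a)) \<longlonglongrightarrow> 0"
proof -
  obtain C where C: "C > 0"
    "eventually (\<lambda>n. \<forall>b. real b \<le> real n powr d \<longrightarrow> g1 b \<le> 2 * Q (d * ln (real n) + 1) + C) sequentially"
    using g1_bound[OF d] by blast
  show ?thesis
  proof (rule Lim_null_comparison)
    show "eventually (\<lambda>n. norm (g1 (b n) * real n powr (- a)) \<le> 2 * (Q (d * ln (real n) + 1) * real n powr (- a)) + C * real n powr (- a)) sequentially"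
      using C(2) b
    proof eventually_elim
      case (elim n)
      then have "g1 (b n) * real n powr (- a) \<le> (2 * Q (d * ln (real n) + 1) + C) * real n powr (- a)"
        by (intro mult_right_mono) auto
      then show ?case using g1_nonneg[of "b n"] by (simp add: distrib_right abs_mult)
    qed
    have "(\<lambda>n. real n powr (- a)) \<longlonglongrightarrow> 0" using a by real_asymp
    then have "(\<lambda>n. 2 * (Q (d * ln (real n) + 1) * real n powr (- a)) + C * real n powr (- a)) \<longlonglongrightarrow> 2 * 0 + C * 0"
      by (intro tendsto_intros Q_powr_tendsto_0 a)
    then show "(\<lambda>n. 2 * (Q (d * ln (real n) + 1) * real n powr (- a)) + C * real n powr (- a)) \<longlonglongrightarrow> 0" by simp
  qed
qed

end

section \<open>The extra factor of the truncated weights\<close>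

context saddle
begin

text \<open>The factor \<open>t ^ r * exp (g\<^sub>b 1 - g\<^sub>b t)\<close> at
  \<open>t = exp (- w)\<close>; it is 1 for \<open>b = r = 0\<close>.\<close>

definition Phi :: "nat \<Rightarrow> nat \<Rightarrow> nat \<Rightarrow> real \<Rightarrow> complex" where
  "Phi b r n s = exp (of_real (g1 b) - (\<Sum>m=1..b. of_real (\<theta> m / real m) * exp (- w n s) ^ m) - of_nat r * w n s)"

text \<open>The exponential prefactor is the value of the untruncated, unshifted integrand at the
  saddle. It does not depend on \<open>b\<close> or \<open>r\<close> and will cancel.\<close>

lemma norm_const_eq_saddle_integral:
  assumes "\<beta> n > 0" "r \<le> n"
  shows "of_real (2 * pi / \<beta> n * (exp (g1 b) * norm_const (truncate_low b \<theta>) (n - r))) =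
    exp (G (exp (- complex_of_real (v n))) + of_real (real n * v n)) *
      (LINT s|lborel. indicator {- (pi / \<beta> n)..pi / \<beta> n} s *\<^sub>R (exp (E n s) * Phi b r n s))"
proof -
  let ?x = "truncate_low b \<theta>" and ?I = "indicator {- (pi / \<beta> n)..pi / \<beta> n} :: real \<Rightarrow> real"
  have int: "complex_of_real (2 * pi / \<beta> n * norm_const ?x (n - r)) =
      (LINT s|lborel. ?I s *\<^sub>R (exp (cycle_gf ?x (exp (- w n s))) * exp (of_nat (n - r) * w n s)))"
    unfolding w_def
    by (rule norm_const_integral) (use assms truncate_low_gf(1)[OF summ] norm_const_rec in auto)
  have "complex_of_real (2 * pi / \<beta> n * (exp (g1 b) * norm_const ?x (n - r))) =
      of_real (exp (g1 b)) * of_real (2 * pi / \<beta> n * norm_const ?x (n - r))"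
    by (simp only: of_real_mult mult_ac)
  then have "of_real (2 * pi / \<beta> n * (exp (g1 b) * norm_const ?x (n - r))) =
      exp (of_real (g1 b)) * (LINT s|lborel. ?I s *\<^sub>R (exp (cycle_gf ?x (exp (- w n s))) * exp (of_nat (n - r) * w n s)))"
    unfolding int exp_of_real .
  also have "\<dots> = (LINT s|lborel. exp (of_real (g1 b)) * (?I s *\<^sub>R (exp (cycle_gf ?x (exp (- w n s))) * exp (of_nat (n - r) * w n s))))"
    by (rule integral_mult_right_zero[symmetric])
  also have "\<dots> = (LINT s|lborel. exp (G (exp (- complex_of_real (v n))) + of_real (real n * v n)) * (?I s *\<^sub>R (exp (E n s) * Phi b r n s)))"
  proof (rule arg_cong[where f = "integral\<^sup>L lborel"], rule ext)
    fix s
    have gf: "cycle_gf ?x (exp (- w n s)) = G (exp (- w n s)) - (\<Sum>m=1..b. of_real (\<theta> m / real m) * exp (- w n s) ^ m)"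
      using truncate_low_gf(2)[OF summ[OF norm_exp_w_less_1]] G_eq[OF norm_exp_w_less_1] by simp
    have nw: "of_nat (n - r) * w n s = of_real (real n * v n) + \<i> * of_real (real n * \<beta> n * s) - of_nat r * w n s"
      using assms(2) by (simp add: w_def of_nat_diff algebra_simps)
    have "exp (of_real (g1 b)) * (exp (cycle_gf ?x (exp (- w n s))) * exp (of_nat (n - r) * w n s)) =
        exp (G (exp (- complex_of_real (v n))) + of_real (real n * v n)) * (exp (E n s) * Phi b r n s)"
      unfolding gf nw Phi_def E_def exp_add[symmetric] by (rule arg_cong[where f = exp]) simp
    then show "exp (of_real (g1 b)) * (?I s *\<^sub>R (exp (cycle_gf ?x (exp (- w n s))) * exp (of_nat (n - r) * w n s))) =
        exp (G (exp (- complex_of_real (v n))) + of_real (real n * v n)) * (?I s *\<^sub>R (exp (E n s) * Phi b r n s))"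
      by (simp only: mult_scaleR_right)
  qed
  also have "\<dots> = exp (G (exp (- complex_of_real (v n))) + of_real (real n * v n)) *
      (LINT s|lborel. ?I s *\<^sub>R (exp (E n s) * Phi b r n s))"
    by (rule integral_mult_right_zero)
  finally show ?thesis .
qed

lemma measurable_Phi [measurable]: "Phi b r n \<in> borel_measurable borel"
  unfolding Phi_def[abs_def] w_def by (intro borel_measurable_continuous_onI continuous_intros)

lemma norm_Phi_le: "norm (Phi b r n s) \<le> exp (2 * g1 b)"
proof -
  define S where "S = (\<Sum>m=1..b. of_real (\<theta> m / real m) * exp (- w n s) ^ m)"
  have "norm S \<le> (\<Sum>m=1..b. \<theta> m / real m)"
    unfolding S_def
  proof (rule sum_norm_le)
    fix m assume m: "m \<in> {1..b}"
    have "norm (exp (- w n s) ^ m) \<le> 1" unfolding norm_power using norm_exp_w_less_1[of n s] by (intro power_le_one) auto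
    then have "\<bar>\<theta> m / real m\<bar> * norm (exp (- w n s) ^ m) \<le> \<bar>\<theta> m / real m\<bar> * 1" by (intro mult_left_mono) auto
    then show "norm (of_real (\<theta> m / real m) * exp (- w n s) ^ m) \<le> \<theta> m / real m"
      unfolding norm_mult norm_of_real using \<theta>_nonneg[of m] m by simp
  qed
  then have "- Re S \<le> g1 b" unfolding g1_def using abs_Re_le_cmod[of S] by linarith
  moreover have "0 \<le> real r * v n" by simp
  moreover have "Re (of_real (g1 b) - S - of_nat r * w n s) = g1 b - Re S - real r * v n" by simp
  ultimately have "Re (of_real (g1 b) - S - of_nat r * w n s) \<le> 2 * g1 b" by linarith
  then show ?thesis unfolding Phi_def norm_exp_eq_Re S_def by simp
qed

text \<open>\<open>\<bar>1 - t ^ m\<bar> \<le> m * \<bar>w\<bar> \<le> b * \<bar>w\<bar>\<close> for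
  \<open>t = exp (- w)\<close>. Replacing \<open>m\<close> by \<open>b\<close> reduces everything to
  \<open>g1 b\<close>, which grows slower than any power of \<open>n\<close>.\<close>

lemma norm_Phi_exponent_le:
  "norm (of_real (g1 b) - (\<Sum>m=1..b. of_real (\<theta> m / real m) * exp (- w n s) ^ m) - of_nat r * w n s) \<le>
    (real b * g1 b + real r) * norm (w n s)"
proof -
  have "of_real (g1 b) - (\<Sum>m=1..b. of_real (\<theta> m / real m) * exp (- w n s) ^ m) - of_nat r * w n s =
      - ((\<Sum>m=1..b. of_real (\<theta> m / real m) * (exp (- w n s) ^ m - 1)) + of_nat r * w n s)"
    unfolding g1_def by (simp add: right_diff_distrib sum_subtractf)
  also have "norm \<dots> \<le> norm (\<Sum>m=1..b. of_real (\<theta> m / real m) * (exp (- w n s) ^ m - 1)) + norm (of_nat r * w n s)"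
    unfolding norm_minus_cancel by (rule norm_triangle_ineq)
  also have "norm (\<Sum>m=1..b. of_real (\<theta> m / real m) * (exp (- w n s) ^ m - 1)) \<le> (\<Sum>m=1..b. \<theta> m / real m * (real b * norm (w n s)))"
  proof (rule sum_norm_le)
    fix m assume m: "m \<in> {1..b}"
    have "exp (- w n s) ^ m = exp (of_nat m * (- w n s))" by (rule exp_of_nat_mult[symmetric])
    then have "norm (exp (- w n s) ^ m - 1) \<le> norm (of_nat m * (- w n s))"
      using norm_exp_minus_1_le[of "of_nat m * (- w n s)"] by simp
    also have "\<dots> = real m * norm (w n s)" by (simp add: norm_mult)
    also have "\<dots> \<le> real b * norm (w n s)" using m by (intro mult_right_mono) auto
    finally have "\<bar>\<theta> m / real m\<bar> * norm (exp (- w n s) ^ m - 1) \<le> \<bar>\<theta> m / real m\<bar> * (real b * norm (w n s))"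
      by (intro mult_left_mono) auto
    then show "norm (of_real (\<theta> m / real m) * (exp (- w n s) ^ m - 1)) \<le> \<theta> m / real m * (real b * norm (w n s))"
      unfolding norm_mult norm_of_real using \<theta>_nonneg[of m] m by simp
  qed
  also have "\<dots> = g1 b * (real b * norm (w n s))" unfolding g1_def by (rule sum_distrib_right[symmetric])
  finally show ?thesis by (simp add: norm_mult algebra_simps)
qed

text \<open>On the window the exponent of \<open>Phi\<close> is at most of order
  \<open>n powr (c1 - d) * g1 + n powr (c2 - d)\<close>, which tends to 0 since
  \<open>c1 < c2 < d\<close>.\<close>

lemma Phi_integral_tendsto:
  assumes c': "0 < c1" "c1 < c2" "c2 < d" and d: "d < 1" "5 * d ^ (k + 1) < 1"
    and b: "eventually (\<lambda>n. real (b n) \<le> real n powr c1) sequentially"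
    and r: "eventually (\<lambda>n. real (r n) \<le> real n powr c2) sequentially"
  shows "(\<lambda>n. LINT s|lborel. indicator {- (pi / \<beta> n)..pi / \<beta> n} s *\<^sub>R (exp (E n s) * Phi (b n) (r n) n s)) \<longlonglongrightarrow> of_real (sqrt (2 * pi))"
proof -
  have d0: "d > 0" using c' by linarith
  have bd: "eventually (\<lambda>n. real (b n) \<le> real n powr d) sequentially"
    using b eventually_ge_at_top[of 1]
  proof eventually_elim
    case (elim n)
    have "real n powr c1 \<le> real n powr d" using elim c' by (intro powr_mono) auto
    then show ?case using elim by linarith
  qed
  obtain C where C: "C > 0"
    "eventually (\<lambda>n. \<forall>b. real b \<le> real n powr d \<longrightarrow> g1 b \<le> 2 * Q (d * ln (real n) + 1) + C) sequentially"
    using g1_bound[OF d0] by blast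
  \<comment> \<open>The 2 accounts for
    \<open>\<bar>w\<bar> \<le> v + \<bar>\<beta> * s\<bar>\<close>, both at most
    \<open>n powr (- d)\<close>.\<close>
  define \<epsilon> where "\<epsilon> n = (real (b n) * g1 (b n) + real (r n)) * (2 * real n powr (- d))" for n
  have \<epsilon>0: "\<epsilon> \<longlonglongrightarrow> 0"
  proof (rule Lim_null_comparison)
    show "eventually (\<lambda>n. norm (\<epsilon> n) \<le> 2 * (g1 (b n) * real n powr (- (d - c1))) + 2 * real n powr (- (d - c2))) sequentially"
      using b r eventually_ge_at_top[of 1]
    proof eventually_elim
      case (elim n)
      have p: "real n powr x * real n powr (- d) = real n powr (- (d - x))" for x
        by (subst powr_add[symmetric]) simp
      have "\<epsilon> n \<ge> 0" unfolding \<epsilon>_def using g1_nonneg[of "b n"] by simp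
      moreover have "\<epsilon> n \<le> (real n powr c1 * g1 (b n) + real n powr c2) * (2 * real n powr (- d))"
        unfolding \<epsilon>_def using elim g1_nonneg[of "b n"] by (intro mult_right_mono add_mono) auto
      moreover have "\<dots> = 2 * (g1 (b n) * (real n powr c1 * real n powr (- d))) + 2 * (real n powr c2 * real n powr (- d))"
        by (simp add: algebra_simps)
      ultimately show ?case unfolding p by simp
    qed
    have "(\<lambda>n. real n powr (- (d - c2))) \<longlonglongrightarrow> 0" using c' by (intro powr_neg_tendsto) auto
    then have "(\<lambda>n. 2 * (g1 (b n) * real n powr (- (d - c1))) + 2 * real n powr (- (d - c2))) \<longlonglongrightarrow> 2 * 0 + 2 * 0"
      by (intro tendsto_intros g1_powr_tendsto_0[OF _ d0 bd]) (use c' in auto)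
    then show "(\<lambda>n. 2 * (g1 (b n) * real n powr (- (d - c1))) + 2 * real n powr (- (d - c2))) \<longlonglongrightarrow> 0" by simp
  qed
  define e where "e n s = of_real (g1 (b n)) - (\<Sum>m=1..b n. of_real (\<theta> m / real m) * exp (- w n s) ^ m) - of_nat (r n) * w n s" for n s
  have Phi_e: "Phi (b n) (r n) n s = exp (e n s)" for n s by (simp add: Phi_def e_def)
  have e_le: "eventually (\<lambda>n. \<forall>s. \<bar>\<beta> n * s\<bar> \<le> real n powr (- d) \<longrightarrow> norm (e n s) \<le> \<epsilon> n) sequentially"
    using v_le_powr[OF d(1)]
  proof eventually_elim
    case (elim n)
    show ?case
    proof (intro allI impI)
      fix s assume s: "\<bar>\<beta> n * s\<bar> \<le> real n powr (- d)"
      have "norm (w n s) \<le> 2 * real n powr (- d)" using norm_w_le[of n s] s elim by linarith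
      then have "(real (b n) * g1 (b n) + real (r n)) * norm (w n s) \<le> \<epsilon> n"
        unfolding \<epsilon>_def using g1_nonneg[of "b n"] by (intro mult_left_mono) auto
      then show "norm (e n s) \<le> \<epsilon> n" unfolding e_def using norm_Phi_exponent_le[of "b n" n s "r n"] by linarith
    qed
  qed
  show ?thesis
  proof (rule saddle_integral_tendsto[OF d0 d measurable_Phi])
    have "(\<lambda>n. exp (\<epsilon> n)) \<longlonglongrightarrow> exp 0" by (intro tendsto_intros \<epsilon>0)
    from order_tendstoD(2)[OF this, of 2] have "eventually (\<lambda>n. exp (\<epsilon> n) < 2) sequentially" by simp
    with e_le show "eventually (\<lambda>n. \<forall>s. \<bar>\<beta> n * s\<bar> \<le> real n powr (- d) \<longrightarrow> norm (Phi (b n) (r n) n s) \<le> 2) sequentially"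
    proof eventually_elim
      case (elim n)
      show ?case
      proof (intro allI impI)
        fix s assume "\<bar>\<beta> n * s\<bar> \<le> real n powr (- d)"
        then have "Re (e n s) \<le> \<epsilon> n" using elim complex_Re_le_cmod[of "e n s"] by (meson order.trans)
        then have "norm (Phi (b n) (r n) n s) \<le> exp (\<epsilon> n)" unfolding Phi_e norm_exp_eq_Re by simp
        then show "norm (Phi (b n) (r n) n s) \<le> 2" using elim by linarith
      qed
    qed
    show "(\<lambda>n. Phi (b n) (r n) n s) \<longlonglongrightarrow> 1" for s
    proof -
      have "(\<lambda>n. e n s) \<longlonglongrightarrow> 0"
      proof (rule Lim_null_comparison[OF _ \<epsilon>0])
        show "eventually (\<lambda>n. norm (e n s) \<le> \<epsilon> n) sequentially"
          using e_le eventually_inner[OF d(1), of s] by eventually_elim auto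
      qed
      then have "(\<lambda>n. exp (e n s)) \<longlonglongrightarrow> exp 0" by (intro tendsto_intros)
      then show ?thesis by (simp add: Phi_e)
    qed
    \<comment> \<open>\<open>norm_Phi_le\<close> doubles the bound
      \<open>2 * Q (d * ln n + 1) + C\<close> on \<open>g1\<close>; \<open>1 + 2 * C\<close> covers
      both the shift inside \<open>Q\<close> and the doubled constant.\<close>
    show "(0::real) \<le> 1 + 2 * C" using C by simp
    show "eventually (\<lambda>n. \<forall>s. norm (Phi (b n) (r n) n s) \<le> exp (4 * Q (d * ln (real n) + (1 + 2 * C)) + (1 + 2 * C))) sequentially"
      using C(2) bd eventually_ge_at_top[of 1]
    proof eventually_elim
      case (elim n)
      have "g1 (b n) \<le> 2 * Q (d * ln (real n) + 1) + C" using elim by blast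
      moreover have "Q (d * ln (real n) + 1) \<le> Q (d * ln (real n) + (1 + 2 * C))"
        using elim d0 C by (intro Q_mono) auto
      ultimately have "2 * g1 (b n) \<le> 4 * Q (d * ln (real n) + (1 + 2 * C)) + (1 + 2 * C)" by linarith
      then have "exp (2 * g1 (b n)) \<le> exp (4 * Q (d * ln (real n) + (1 + 2 * C)) + (1 + 2 * C))" by simp
      then show ?case using norm_Phi_le by (meson order.trans)
    qed
  qed
qed

text \<open>The denominator is the case \<open>b = r = 0\<close>. Its integral tends to
  \<open>sqrt (2 * pi)\<close>, which also shows that the constants are eventually nonzero and the
  measures eventually probabilities.\<close>

lemma norm_const_ratio_tendsto:
  assumes c': "0 < c1" "c1 < c2" "c2 < d" and d: "d < 1" "5 * d ^ (k + 1) < 1"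
    and b: "eventually (\<lambda>n. real (b n) \<le> real n powr c1) sequentially"
    and r: "eventually (\<lambda>n. real (r n) \<le> real n powr c2) sequentially" and rn: "eventually (\<lambda>n. r n \<le> n) sequentially"
  shows "(\<lambda>n. exp (g1 (b n)) * norm_const (truncate_low (b n) \<theta>) (n - r n) / norm_const \<theta> n) \<longlonglongrightarrow> 1"
    and "eventually (\<lambda>n. norm_const \<theta> n \<noteq> 0) sequentially"
proof -
  let ?I = "\<lambda>b r n. LINT s|lborel. indicator {- (pi / \<beta> n)..pi / \<beta> n} s *\<^sub>R (exp (E n s) * Phi b r n s)"
  have I1: "(\<lambda>n. ?I (b n) (r n) n) \<longlonglongrightarrow> of_real (sqrt (2 * pi))"
    by (rule Phi_integral_tendsto[OF c' d b r])
  have I0: "(\<lambda>n. ?I 0 0 n) \<longlonglongrightarrow> of_real (sqrt (2 * pi))"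
    by (rule Phi_integral_tendsto[OF c' d]) auto
  have nz: "complex_of_real (sqrt (2 * pi)) \<noteq> 0" by simp
  have ev0: "eventually (\<lambda>n. ?I 0 0 n \<noteq> 0) sequentially" using tendsto_imp_eventually_ne[OF I0 nz] .
  have tl0: "norm_const (truncate_low 0 \<theta>) n = norm_const \<theta> n" for n
    unfolding norm_const_def cycle_weight_def truncate_low_def by (intro arg_cong2[where f = "(/)"] sum.cong prod.cong) auto
  have g0: "g1 0 = 0" by (simp add: g1_def)
  have h: "complex_of_real (2 * pi / \<beta> n * norm_const \<theta> n) = exp (G (exp (- complex_of_real (v n))) + of_real (real n * v n)) * ?I 0 0 n"
    if "\<beta> n > 0" for n
    using norm_const_eq_saddle_integral[OF that, of 0 0] by (simp add: tl0 g0)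
  show "eventually (\<lambda>n. norm_const \<theta> n \<noteq> 0) sequentially"
    using ev0 n_beta
  proof eventually_elim
    case (elim n)
    then have "exp (G (exp (- complex_of_real (v n))) + of_real (real n * v n)) * ?I 0 0 n \<noteq> 0" by simp
    with h[of n] elim have "complex_of_real (2 * pi / \<beta> n * norm_const \<theta> n) \<noteq> 0" by metis
    then show ?case by auto
  qed
  have "(\<lambda>n. ?I (b n) (r n) n / ?I 0 0 n) \<longlonglongrightarrow> of_real (sqrt (2 * pi)) / of_real (sqrt (2 * pi))"
    by (intro tendsto_divide I1 I0 nz)
  then have lim: "(\<lambda>n. ?I (b n) (r n) n / ?I 0 0 n) \<longlonglongrightarrow> of_real 1" using nz by simp
  have "(\<lambda>n. complex_of_real (exp (g1 (b n)) * norm_const (truncate_low (b n) \<theta>) (n - r n) / norm_const \<theta> n)) \<longlonglongrightarrow> of_real 1"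
  proof (rule Lim_transform_eventually[OF lim])
    show "eventually (\<lambda>n. ?I (b n) (r n) n / ?I 0 0 n =
        complex_of_real (exp (g1 (b n)) * norm_const (truncate_low (b n) \<theta>) (n - r n) / norm_const \<theta> n)) sequentially"
      using n_beta rn
    proof eventually_elim
      case (elim n)
      then have \<beta>: "\<beta> n > 0" by simp
      let ?K = "exp (G (exp (- complex_of_real (v n))) + of_real (real n * v n))"
      have "?I (b n) (r n) n / ?I 0 0 n = (?K * ?I (b n) (r n) n) / (?K * ?I 0 0 n)" by simp
      also have "\<dots> = complex_of_real (2 * pi / \<beta> n * (exp (g1 (b n)) * norm_const (truncate_low (b n) \<theta>) (n - r n))) /
          complex_of_real (2 * pi / \<beta> n * norm_const \<theta> n)"
        unfolding h[OF \<beta>] norm_const_eq_saddle_integral[OF \<beta> elim(2)] ..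
      also have "\<dots> = complex_of_real ((2 * pi / \<beta> n * (exp (g1 (b n)) * norm_const (truncate_low (b n) \<theta>) (n - r n))) / (2 * pi / \<beta> n * norm_const \<theta> n))"
        by (rule of_real_divide[symmetric])
      also have "(2 * pi / \<beta> n * (exp (g1 (b n)) * norm_const (truncate_low (b n) \<theta>) (n - r n))) / (2 * pi / \<beta> n * norm_const \<theta> n) =
          exp (g1 (b n)) * norm_const (truncate_low (b n) \<theta>) (n - r n) / norm_const \<theta> n"
        using \<beta> by (subst mult_divide_mult_cancel_left) auto
      finally show ?case .
    qed
  qed
  then show "(\<lambda>n. exp (g1 (b n)) * norm_const (truncate_low (b n) \<theta>) (n - r n) / norm_const \<theta> n) \<longlonglongrightarrow> 1"
    unfolding tendsto_of_real_iff .
qed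

end

section \<open>Total variation distance\<close>

text \<open>\<open>\<bar>p - q\<bar>\<close> is \<open>p - q\<close> plus twice the positive part of
  \<open>q - p\<close>. The differences sum to 0 over all points, so a lower bound for
  \<open>p\<close> outside \<open>B\<close> suffices.\<close>

lemma total_variation_le:
  fixes \<mu> \<nu> :: "'b::countable measure"
  assumes \<mu>: "prob_space \<mu>" "sets \<mu> = UNIV" and \<nu>: "prob_space \<nu>" "sets \<nu> = UNIV"
    and \<epsilon>: "0 \<le> \<epsilon>" and le: "\<And>a. a \<notin> B \<Longrightarrow> (1 - \<epsilon>) * measure \<nu> {a} \<le> measure \<mu> {a}"
  shows "total_variation \<mu> \<nu> \<le> \<epsilon> + measure \<nu> B"
proof -
  interpret \<mu>: prob_space \<mu> by fact
  interpret \<nu>: prob_space \<nu> by fact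
  let ?p = "\<lambda>a. measure \<mu> {a}" and ?q = "\<lambda>a. measure \<nu> {a}"
  have \<mu>F: "measure \<mu> F = sum ?p F" if "finite F" for F
    using that \<mu> by (intro \<mu>.finite_measure_eq_sum_singleton) auto
  have \<nu>F: "measure \<nu> F = sum ?q F" if "finite F" for F
    using that \<nu> by (intro \<nu>.finite_measure_eq_sum_singleton) auto
  \<comment> \<open>Finite sets exhausting the countable type. Since the \<nu>-mass of
    \<open>A i\<close> tends to 1, the cancellation of total masses can be carried out with finite
    sums.\<close>
  define A where "A i = {a::'b. to_nat a < i}" for i
  have A_fin: "finite (A i)" for i
    using finite_imageD[of to_nat "A i"] finite_subset[of "to_nat ` A i" "{..<i}"] inj_to_nat
    by (auto simp: A_def inj_on_subset)
  have "(\<lambda>i. measure \<nu> (A i)) \<longlonglongrightarrow> measure \<nu> (\<Union>i. A i)"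
    by (rule \<nu>.finite_Lim_measure_incseq) (auto simp: \<nu> A_def incseq_def)
  moreover have "(\<Union>i. A i) = space \<nu>" using \<nu>(2) by (auto simp: A_def sets_eq_imp_space_eq[of \<nu> "count_space UNIV"])
  ultimately have lim: "(\<lambda>i. measure \<nu> (A i)) \<longlonglongrightarrow> 1" by (simp add: \<nu>.prob_space)
  have fin_le: "(\<Sum>a\<in>F. \<bar>?p a - ?q a\<bar>) \<le> 2 * (\<epsilon> + measure \<nu> B)" if F: "finite F" for F
  proof -
    have "(\<Sum>a\<in>F. \<bar>?p a - ?q a\<bar>) \<le> 1 - measure \<nu> (A i) + 2 * (\<epsilon> + measure \<nu> B)" for i
    proof -
      define H where "H = F \<union> A i"
      have H: "finite H" using F A_fin by (simp add: H_def)
      have "(\<Sum>a\<in>F. \<bar>?p a - ?q a\<bar>) \<le> (\<Sum>a\<in>H. \<bar>?p a - ?q a\<bar>)"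
        using H by (intro sum_mono2) (auto simp: H_def)
      also have "\<dots> \<le> (\<Sum>a\<in>H. (?p a - ?q a) + 2 * (\<epsilon> * ?q a + (if a \<in> B then ?q a else 0)))"
      proof (rule sum_mono)
        fix a
        have q: "0 \<le> ?q a" "0 \<le> ?p a" by auto
        have eq: "0 \<le> \<epsilon> * ?q a" using \<epsilon> by simp
        show "\<bar>?p a - ?q a\<bar> \<le> (?p a - ?q a) + 2 * (\<epsilon> * ?q a + (if a \<in> B then ?q a else 0))"
        proof (cases "a \<in> B")
          case False
          then have "?q a - \<epsilon> * ?q a \<le> ?p a" using le[of a] by (simp add: algebra_simps)
          then show ?thesis using q eq False by simp
        next
          case True
          then show ?thesis using q eq by (simp add: abs_le_iff)
        qed
      qed
      also have "\<dots> = measure \<mu> H - measure \<nu> H + 2 * (\<epsilon> * measure \<nu> H + measure \<nu> (H \<inter> B))"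
      proof -
        have "(\<Sum>a\<in>H. if a \<in> B then ?q a else 0) = measure \<nu> (H \<inter> B)"
          using H by (subst \<nu>F) (auto simp: sum.If_cases)
        then show ?thesis using H by (simp add: sum.distrib sum_subtractf sum_distrib_left[symmetric] \<mu>F[OF H] \<nu>F[OF H])
      qed
      also have "\<dots> \<le> 1 - measure \<nu> (A i) + 2 * (\<epsilon> * 1 + measure \<nu> B)"
      proof (intro add_mono diff_mono mult_left_mono)
        show "measure \<nu> (A i) \<le> measure \<nu> H" by (rule \<nu>.finite_measure_mono) (auto simp: H_def \<nu>)
        show "measure \<nu> (H \<inter> B) \<le> measure \<nu> B" by (rule \<nu>.finite_measure_mono) (auto simp: \<nu>)
      qed (use \<epsilon> in auto)
      finally show ?thesis by simp
    qed
    note le_i = this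
    have "(\<lambda>i. 1 - measure \<nu> (A i) + 2 * (\<epsilon> + measure \<nu> B)) \<longlonglongrightarrow> 1 - 1 + 2 * (\<epsilon> + measure \<nu> B)"
      by (intro tendsto_intros lim)
    then have "(\<Sum>a\<in>F. \<bar>?p a - ?q a\<bar>) \<le> 1 - 1 + 2 * (\<epsilon> + measure \<nu> B)"
      by (rule LIMSEQ_le_const) (use le_i in auto)
    then show ?thesis by simp
  qed
  have "(\<Sum>\<^sub>\<infinity>a. \<bar>?p a - ?q a\<bar>) \<le> 2 * (\<epsilon> + measure \<nu> B)"
  proof (cases "(\<lambda>a. \<bar>?p a - ?q a\<bar>) summable_on UNIV")
    case True
    then show ?thesis by (rule infsum_le_finite_sums) (use fin_le in auto)
  next
    \<comment> \<open>An infinite sum that does not exist has the default value 0.\<close>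
    case False
    then show ?thesis using \<epsilon> by (simp add: infsum_not_exists)
  qed
  then show ?thesis by (simp add: total_variation_def)
qed

lemma total_variation_nonneg: "0 \<le> total_variation \<mu> \<nu>"
  unfolding total_variation_def by (intro divide_nonneg_pos infsum_nonneg) auto

section \<open>Laws of the cycle counts and of the Poisson vector\<close>

lemma prob_space_law:
  assumes "prob_space M" "X \<in> measurable M (count_space UNIV)"
  shows "prob_space (law M X)" "sets (law M X) = UNIV"
  unfolding law_def using assms by (auto intro: prob_space.prob_space_distr)

lemma measure_law_singleton:
  assumes "X \<in> measurable M (count_space UNIV)"
  shows "measure (law M X) {a} = measure M (X -` {a} \<inter> space M)"
  unfolding law_def using assms by (subst measure_distr) auto

text \<open>The mean as a nonnegative integral, the form consumed by Markov's inequality. The law is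
  rebuilt from its point masses, which treats rate 0 like any other.\<close>

lemma nn_integral_poisson:
  assumes M: "prob_space M" and X: "poisson_distributed M X r" and r: "r \<ge> 0"
  shows "(\<integral>\<^sup>+\<omega>. of_nat (X \<omega>) \<partial>M) = ennreal r"
proof -
  interpret prob_space M by fact
  have Xm: "X \<in> measurable M (count_space UNIV)" and pm: "\<And>j. measure (law M X) {j} = r ^ j / fact j * exp (- r)"
    using X by (auto simp: poisson_distributed_def)
  interpret L: prob_space "law M X" by (rule prob_space_law(1)[OF M Xm])
  have setsL: "sets (law M X) = UNIV" by (rule prob_space_law(2)[OF M Xm])
  have eq: "law M X = density (count_space UNIV) (\<lambda>j. ennreal (r ^ j / fact j * exp (- r)))"
  proof (rule measure_eqI_countable[of _ UNIV])
    show "emeasure (law M X) {a} = emeasure (density (count_space UNIV) (\<lambda>j. ennreal (r ^ j / fact j * exp (- r)))) {a}" for a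
      by (simp add: L.emeasure_eq_measure pm emeasure_density nn_integral_count_space_indicator[symmetric])
  qed (use setsL in auto)
  have "(\<integral>\<^sup>+\<omega>. of_nat (X \<omega>) \<partial>M) = (\<integral>\<^sup>+j. of_nat j \<partial>law M X)"
    unfolding law_def using Xm by (subst nn_integral_distr) auto
  also have "\<dots> = (\<Sum>j. ennreal (r ^ j / fact j * exp (- r)) * of_nat j)"
    unfolding eq by (subst nn_integral_density) (auto simp: nn_integral_count_space_nat)
  also have "\<dots> = (\<Sum>j. ennreal (r ^ j / fact j * exp (- r) * real j))"
    unfolding ennreal_of_nat_eq_real_of_nat using r by (intro suminf_cong ennreal_mult[symmetric]) auto
  also have "\<dots> = ennreal r"
  proof (rule suminf_ennreal_eq)
    show "0 \<le> r ^ j / fact j * exp (- r) * real j" for j using r by simp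
    have "(\<lambda>j. r ^ j / fact j) sums exp r" using exp_converges[of r] by (simp add: field_simps)
    then have "(\<lambda>j. r * exp (- r) * (r ^ j / fact j)) sums (r * exp (- r) * exp r)" by (rule sums_mult)
    moreover have "r * exp (- r) * exp r = r" by (simp add: exp_minus)
    moreover have "r * exp (- r) * (r ^ j / fact j) = r ^ Suc j / fact (Suc j) * exp (- r) * real (Suc j)" for j
      by (simp add: field_simps del: of_nat_Suc)
    ultimately have "(\<lambda>j. r ^ Suc j / fact (Suc j) * exp (- r) * real (Suc j)) sums r" by (simp only:)
    \<comment> \<open>Adding the term \<open>j = 0\<close> changes nothing because of its factor
      \<open>real 0\<close>.\<close>
    then show "(\<lambda>j. r ^ j / fact j * exp (- r) * real j) sums r"
      by (subst (asm) sums_Suc_iff) simp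
  qed
  finally show ?thesis .
qed

text \<open>Lists are indexed from 0 and cycle lengths from 1; hence \<open>m - 1\<close>
  throughout.\<close>

lemma list_eq_map_upt_iff:
  "map f [1..<Suc b] = a \<longleftrightarrow> length a = b \<and> (\<forall>m\<in>{1..b}. f m = a ! (m - 1))"
proof
  assume "map f [1..<Suc b] = a"
  then show "length a = b \<and> (\<forall>m\<in>{1..b}. f m = a ! (m - 1))" by (auto simp del: upt_Suc)
next
  assume a: "length a = b \<and> (\<forall>m\<in>{1..b}. f m = a ! (m - 1))"
  show "map f [1..<Suc b] = a"
  proof (rule nth_equalityI)
    fix i assume "i < length (map f [1..<Suc b])"
    then have "i < b" by (simp del: upt_Suc)
    moreover have "Suc i \<in> {1..b}" using \<open>i < b\<close> by simp
    ultimately show "map f [1..<Suc b] ! i = a ! i" using a by (auto simp del: upt_Suc)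
  qed (use a in simp)
qed

lemma law_cycle_counts:
  assumes nn: "\<And>m. 1 \<le> m \<Longrightarrow> 0 \<le> \<theta> m" and h: "norm_const \<theta> n \<noteq> 0"
    and b: "b \<le> n" and a: "length a = b" and r: "(\<Sum>m=1..b. m * a ! (m - 1)) \<le> n"
  shows "measure (law (perm_measure \<theta> n) (\<lambda>\<sigma>. map (\<lambda>m. cycle_count n \<sigma> m) [1..<Suc b])) {a} =
    (\<Prod>m=1..b. (\<theta> m / real m) ^ (a ! (m - 1)) / fact (a ! (m - 1))) *
      norm_const (truncate_low b \<theta>) (n - (\<Sum>m=1..b. m * a ! (m - 1))) / norm_const \<theta> n"
proof -
  let ?X = "\<lambda>\<sigma>. map (\<lambda>m. cycle_count n \<sigma> m) [1..<Suc b]"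
  let ?S = "{\<sigma>. \<sigma> permutes {1..n} \<and> (\<forall>m\<in>{1..b}. cycle_count n \<sigma> m = a ! (m - 1))}"
  have w: "0 \<le> cycle_weight \<theta> n \<sigma>" for \<sigma>
    unfolding cycle_weight_def using nn by (intro prod_nonneg) auto
  have h0: "0 \<le> norm_const \<theta> n"
    unfolding norm_const_def using w by (intro divide_nonneg_nonneg sum_nonneg) auto
  have Xm: "?X \<in> measurable (perm_measure \<theta> n) (count_space UNIV)"
    unfolding perm_measure_def by (auto simp: measurable_def space_point_measure sets_point_measure)
  have "?X -` {a} \<inter> space (perm_measure \<theta> n) = ?S"
    unfolding perm_measure_def space_point_measure using a by (auto simp: list_eq_map_upt_iff[unfolded One_nat_def] simp del: upt_Suc)
  then have "measure (law (perm_measure \<theta> n) ?X) {a} = measure (perm_measure \<theta> n) ?S"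
    using measure_law_singleton[OF Xm] by simp
  also have "\<dots> = (\<Sum>\<sigma>\<in>?S. cycle_weight \<theta> n \<sigma> / (norm_const \<theta> n * fact n))"
  proof -
    have "emeasure (perm_measure \<theta> n) ?S = (\<Sum>\<sigma>\<in>?S. ennreal (cycle_weight \<theta> n \<sigma> / (norm_const \<theta> n * fact n)))"
      unfolding perm_measure_def by (rule emeasure_point_measure_finite) (auto simp: finite_permutations)
    also have "\<dots> = ennreal (\<Sum>\<sigma>\<in>?S. cycle_weight \<theta> n \<sigma> / (norm_const \<theta> n * fact n))"
      using w h0 by (intro sum_ennreal) auto
    finally show ?thesis unfolding measure_def using w h0 by (simp add: sum_nonneg)
  qed
  also have "\<dots> = (\<Sum>\<sigma>\<in>?S. cycle_weight \<theta> n \<sigma>) / (norm_const \<theta> n * fact n)"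
    by (rule sum_divide_distrib[symmetric])
  also have "\<dots> = (\<Prod>m=1..b. (\<theta> m / real m) ^ (a ! (m - 1)) / fact (a ! (m - 1))) *
      norm_const (truncate_low b \<theta>) (n - (\<Sum>m=1..b. m * a ! (m - 1))) / norm_const \<theta> n"
    unfolding sum_cycle_weight_fixed_small_counts[OF b r] truncate_low_def by simp
  finally show ?thesis .
qed

lemma law_poisson_vector:
  assumes M: "prob_space M" and ind: "prob_space.indep_vars M (\<lambda>_. count_space UNIV) Y {1..}"
    and Y: "\<And>m. 1 \<le> m \<Longrightarrow> poisson_distributed M (Y m) (\<theta> m / real m)"
    and b: "1 \<le> b" and a: "length a = b"
  shows "measure (law M (\<lambda>\<omega>. map (\<lambda>m. Y m \<omega>) [1..<Suc b])) {a} =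
    (\<Prod>m=1..b. (\<theta> m / real m) ^ (a ! (m - 1)) / fact (a ! (m - 1))) * exp (- (\<Sum>m=1..b. \<theta> m / real m))"
    and "(\<lambda>\<omega>. map (\<lambda>m. Y m \<omega>) [1..<Suc b]) \<in> measurable M (count_space UNIV)"
proof -
  interpret prob_space M by fact
  let ?X = "\<lambda>\<omega>. map (\<lambda>m. Y m \<omega>) [1..<Suc b]"
  have Ym: "Y m \<in> measurable M (count_space UNIV)" if "1 \<le> m" for m
    using Y[OF that] by (simp add: poisson_distributed_def)
  \<comment> \<open>Here \<open>1 \<le> b\<close> matters: the empty intersection would be
    \<open>UNIV\<close> and not \<open>space M\<close>.\<close>
  have pre: "?X -` {a'} \<inter> space M = (if length a' = b then (\<Inter>m\<in>{1..b}. Y m -` {a' ! (m - 1)} \<inter> space M) else {})" for a'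
    using b by (auto simp: list_eq_map_upt_iff[unfolded One_nat_def] simp del: upt_Suc)
  show Xm: "?X \<in> measurable M (count_space UNIV)"
  proof (subst measurable_count_space_eq_countable)
    show "?X \<in> space M \<rightarrow> UNIV \<and> (\<forall>a'\<in>UNIV. ?X -` {a'} \<inter> space M \<in> sets M)"
    proof (intro conjI ballI)
      fix a' :: "nat list"
      show "?X -` {a'} \<inter> space M \<in> sets M"
      proof -
        have "(\<Inter>m\<in>{1..b}. Y m -` {a' ! (m - 1)} \<inter> space M) \<in> sets M"
          using b by (intro sets.finite_INT) (auto intro!: measurable_sets[OF Ym])
        then show ?thesis
          unfolding pre by (cases "length a' = b") (simp_all only: if_True if_False sets.empty_sets simp_thms)
      qed
    qed auto
  qed auto
  have "measure (law M ?X) {a} = prob (\<Inter>m\<in>{1..b}. Y m -` {a ! (m - 1)} \<inter> space M)"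
    using measure_law_singleton[OF Xm] pre[of a] a by simp
  also have "\<dots> = (\<Prod>m=1..b. prob (Y m -` {a ! (m - 1)} \<inter> space M))"
    using b by (intro indep_varsD[OF ind]) auto
  also have "\<dots> = (\<Prod>m=1..b. (\<theta> m / real m) ^ (a ! (m - 1)) / fact (a ! (m - 1)) * exp (- (\<theta> m / real m)))"
  proof (rule prod.cong[OF refl])
    fix m assume "m \<in> {1..b}"
    then have m: "1 \<le> m" by simp
    show "prob (Y m -` {a ! (m - 1)} \<inter> space M) = (\<theta> m / real m) ^ (a ! (m - 1)) / fact (a ! (m - 1)) * exp (- (\<theta> m / real m))"
      using Y[OF m] measure_law_singleton[OF Ym[OF m], of "a ! (m - 1)"] by (simp add: poisson_distributed_def)
  qed
  also have "\<dots> = (\<Prod>m=1..b. (\<theta> m / real m) ^ (a ! (m - 1)) / fact (a ! (m - 1))) * exp (- (\<Sum>m=1..b. \<theta> m / real m))"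
    unfolding prod.distrib sum_negf[symmetric] by (simp add: exp_sum)
  finally show "measure (law M ?X) {a} = \<dots>" .
qed

text \<open>Markov's inequality for the sum of the \<open>m * Y m\<close>, whose mean is the sum of
  the \<theta>\<open>m\<close>. Lists of other lengths are excluded since \<open>!\<close> is
  unspecified beyond the end of a list.\<close>

lemma law_poisson_vector_tail:
  assumes M: "prob_space M" and Y: "\<And>m. 1 \<le> m \<Longrightarrow> poisson_distributed M (Y m) (\<theta> m / real m)"
    and nn: "\<And>m. 1 \<le> m \<Longrightarrow> 0 \<le> \<theta> m"
    and Xm: "(\<lambda>\<omega>. map (\<lambda>m. Y m \<omega>) [1..<Suc b]) \<in> measurable M (count_space UNIV)" and R: "R > 0"
  shows "measure (law M (\<lambda>\<omega>. map (\<lambda>m. Y m \<omega>) [1..<Suc b])) {a. length a = b \<and> R < real (\<Sum>m=1..b. m * a ! (m - 1))} \<le>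
    (\<Sum>m=1..b. \<theta> m) / R"
proof -
  interpret prob_space M by fact
  let ?X = "\<lambda>\<omega>. map (\<lambda>m. Y m \<omega>) [1..<Suc b]"
  have Ym [measurable]: "Y m \<in> measurable M (count_space UNIV)" if "1 \<le> m" for m
    using Y[OF that] by (simp add: poisson_distributed_def)
  let ?u = "\<lambda>\<omega>. \<Sum>m=1..b. of_nat m * of_nat (Y m \<omega>) :: ennreal"
  have um: "?u \<in> borel_measurable M"
    by (intro borel_measurable_sum borel_measurable_times_ennreal borel_measurable_const measurable_compose[OF Ym]) auto
  let ?D = "{\<omega>\<in>space M. 1 \<le> ennreal (1 / R) * ?u \<omega>}"
  have u_real: "?u \<omega> = ennreal (real (\<Sum>m=1..b. m * Y m \<omega>))" for \<omega>
  proof -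
    have "?u \<omega> = of_nat (\<Sum>m=1..b. m * Y m \<omega>)" by simp
    then show ?thesis by (simp only: ennreal_of_nat_eq_real_of_nat)
  qed
  have "measure (law M ?X) {a. length a = b \<and> R < real (\<Sum>m=1..b. m * a ! (m - 1))} =
      measure M (?X -` {a. length a = b \<and> R < real (\<Sum>m=1..b. m * a ! (m - 1))} \<inter> space M)"
    unfolding law_def using Xm by (subst measure_distr) auto
  also have "\<dots> \<le> measure M ?D"
  proof (rule finite_measure_mono)
    show "?X -` {a. length a = b \<and> R < real (\<Sum>m=1..b. m * a ! (m - 1))} \<inter> space M \<subseteq> ?D"
    proof
      fix \<omega> assume \<omega>: "\<omega> \<in> ?X -` {a. length a = b \<and> R < real (\<Sum>m=1..b. m * a ! (m - 1))} \<inter> space M"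
      have "(\<Sum>m=1..b. m * ?X \<omega> ! (m - 1)) = (\<Sum>m=1..b. m * Y m \<omega>)"
        by (intro sum.cong refl) (auto simp del: upt_Suc)
      moreover have "R < real (\<Sum>m=1..b. m * ?X \<omega> ! (m - 1))"
        using \<omega> by (simp only: Int_iff vimage_eq mem_Collect_eq)
      ultimately have "R < real (\<Sum>m=1..b. m * Y m \<omega>)" by (simp only:)
      then have "1 \<le> 1 / R * real (\<Sum>m=1..b. m * Y m \<omega>)" using R by (simp add: field_simps)
      then have "ennreal 1 \<le> ennreal (1 / R * real (\<Sum>m=1..b. m * Y m \<omega>))" by (rule ennreal_leI)
      also have "\<dots> = ennreal (1 / R) * ?u \<omega>" unfolding u_real using R by (intro ennreal_mult) (auto intro: sum_nonneg)
      finally show "\<omega> \<in> ?D" using \<omega> by simp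
    qed
    show "?D \<in> sets M" using um by measurable
  qed
  also have "\<dots> \<le> (\<Sum>m=1..b. \<theta> m) / R"
  proof -
    have "emeasure M ?D \<le> ennreal (1 / R) * (\<integral>\<^sup>+\<omega>. ?u \<omega> * indicator (space M) \<omega> \<partial>M)"
      by (rule nn_integral_Markov_inequality) (use um in auto)
    also have "(\<integral>\<^sup>+\<omega>. ?u \<omega> * indicator (space M) \<omega> \<partial>M) = (\<integral>\<^sup>+\<omega>. ?u \<omega> \<partial>M)"
      by (intro nn_integral_cong) auto
    also have "\<dots> = (\<Sum>m=1..b. \<integral>\<^sup>+\<omega>. of_nat m * of_nat (Y m \<omega>) \<partial>M)"
      by (intro nn_integral_sum borel_measurable_times_ennreal borel_measurable_const measurable_compose[OF Ym]) auto
    also have "\<dots> = (\<Sum>m=1..b. ennreal (\<theta> m))"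
    proof (rule sum.cong[OF refl])
      fix m assume "m \<in> {1..b}"
      then have m: "1 \<le> m" by simp
      have "(\<integral>\<^sup>+\<omega>. of_nat m * of_nat (Y m \<omega>) \<partial>M) = of_nat m * (\<integral>\<^sup>+\<omega>. of_nat (Y m \<omega>) \<partial>M)"
        by (intro nn_integral_cmult measurable_compose[OF Ym[OF m]]) auto
      also have "\<dots> = of_nat m * ennreal (\<theta> m / real m)"
        using nn[OF m] by (subst nn_integral_poisson[OF M Y[OF m]]) auto
      also have "\<dots> = ennreal (real m * (\<theta> m / real m))"
        unfolding ennreal_of_nat_eq_real_of_nat using nn[OF m] by (intro ennreal_mult[symmetric]) auto
      finally show "(\<integral>\<^sup>+\<omega>. of_nat m * of_nat (Y m \<omega>) \<partial>M) = ennreal (\<theta> m)" using m by simp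
    qed
    also have "\<dots> = ennreal (\<Sum>m=1..b. \<theta> m)" using nn by (intro sum_ennreal) auto
    also have "ennreal (1 / R) * \<dots> = ennreal (1 / R * (\<Sum>m=1..b. \<theta> m))"
      using R nn by (intro ennreal_mult[symmetric] sum_nonneg) auto
    finally have "ennreal (measure M ?D) \<le> ennreal (1 / R * (\<Sum>m=1..b. \<theta> m))"
      unfolding emeasure_eq_measure .
    moreover have "0 \<le> 1 / R * (\<Sum>m=1..b. \<theta> m)" using R nn by (intro mult_nonneg_nonneg sum_nonneg) auto
    ultimately show ?thesis by (subst (asm) ennreal_le_iff) auto
  qed
  finally show ?thesis .
qed

context saddle
begin

lemma tv_cycles_poisson_tendsto:
  assumes M: "prob_space M" and ind: "prob_space.indep_vars M (\<lambda>_. count_space UNIV) Y {1..}"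
    and Y: "\<And>m. 1 \<le> m \<Longrightarrow> poisson_distributed M (Y m) (\<theta> m / real m)"
    and c': "0 < c1" "c1 < c2" "c2 < d" and d: "d < 1" "5 * d ^ (k + 1) < 1"
    and b1: "\<And>n. 1 \<le> n \<Longrightarrow> 1 \<le> b n \<and> b n \<le> n"
    and b: "eventually (\<lambda>n. real (b n) \<le> real n powr c1) sequentially"
  shows "(\<lambda>n. tv_cycles_poisson \<theta> M Y (b n) n) \<longlonglongrightarrow> 0"
proof -
  have d0: "d > 0" using c' by linarith
  define \<rho> where "\<rho> n r = exp (g1 (b n)) * norm_const (truncate_low (b n) \<theta>) (n - r) / norm_const \<theta> n" for n r
  define S where "S n = {r. r \<le> n \<and> real r \<le> real n powr c2}" for n
  \<comment> \<open>The admissible shift of smallest density. Being a sequence in \<open>n\<close>,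
    it can be fed to the ratio limit, which thereby becomes a lower bound uniform in
    \<open>r\<close>.\<close>
  define rr where "rr n = arg_min_on (\<rho> n) (S n)" for n
  have S: "finite (S n)" "S n \<noteq> {}" for n
    by (auto simp: S_def intro: finite_subset[of _ "{..n}"] exI[of _ 0])
  have rrS: "rr n \<in> S n" for n unfolding rr_def by (rule arg_min_if_finite(1)[OF S])
  have rr_least: "\<rho> n (rr n) \<le> \<rho> n r" if "r \<in> S n" for n r
    unfolding rr_def by (rule arg_min_least[OF S that])
  have ratio: "(\<lambda>n. \<rho> n (rr n)) \<longlonglongrightarrow> 1" and nz: "eventually (\<lambda>n. norm_const \<theta> n \<noteq> 0) sequentially"
    unfolding \<rho>_def using rrS
    by (auto intro!: norm_const_ratio_tendsto[OF c' d b, of rr] simp: S_def)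
  \<comment> \<open>Markov's bound at the level \<open>n powr c2\<close>: the mean is at most
    \<open>b * g1 b \<le> n powr c1 * g1 b\<close>.\<close>
  define tail where "tail n = g1 (b n) * real n powr (- (c2 - c1))" for n
  have bd: "eventually (\<lambda>n. real (b n) \<le> real n powr d) sequentially"
    using b eventually_ge_at_top[of 1]
  proof eventually_elim
    case (elim n)
    have "real n powr c1 \<le> real n powr d" using elim c' by (intro powr_mono) auto
    then show ?case using elim by linarith
  qed
  have tail0: "tail \<longlonglongrightarrow> 0"
    unfolding tail_def by (rule g1_powr_tendsto_0[OF _ d0 bd]) (use c' in simp)
  have bound: "eventually (\<lambda>n. tv_cycles_poisson \<theta> M Y (b n) n \<le> \<epsilon> + tail n) sequentially" if \<epsilon>: "\<epsilon> > 0" for \<epsilon>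
  proof -
    have "eventually (\<lambda>n. 1 - \<epsilon> < \<rho> n (rr n)) sequentially"
      using order_tendstoD(1)[OF ratio, of "1 - \<epsilon>"] \<epsilon> by simp
    then show ?thesis using nz b eventually_ge_at_top[of 1]
    proof eventually_elim
      case (elim n)
      have bn: "1 \<le> b n" "b n \<le> n" using b1[of n] elim by auto
      let ?X = "\<lambda>\<sigma>. map (\<lambda>m. cycle_count n \<sigma> m) [1..<Suc (b n)]"
      let ?Z = "\<lambda>\<omega>. map (\<lambda>m. Y m \<omega>) [1..<Suc (b n)]"
      define R where "R = real n powr c2"
      have R: "R > 0" "R \<le> real n"
      proof -
        show "R > 0" using elim by (simp add: R_def)
        have "real n powr c2 \<le> real n powr 1" using elim c' d by (intro powr_mono) auto
        then show "R \<le> real n" using elim by (simp add: R_def)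
      qed
      let ?r = "\<lambda>a. \<Sum>m=1..b n. m * a ! (m - 1)"
      let ?B = "{a. length a = b n \<and> R < real (?r a)}"
      have Xm: "?X \<in> measurable (perm_measure \<theta> n) (count_space UNIV)"
        unfolding perm_measure_def by (auto simp: measurable_def space_point_measure sets_point_measure)
      have PM: "prob_space (perm_measure \<theta> n)"
        by (rule prob_space_perm_measure) (use \<theta>_nonneg elim in auto)
      have Z: "measure (law M ?Z) {a} =
          (\<Prod>m=1..b n. (\<theta> m / real m) ^ (a ! (m - 1)) / fact (a ! (m - 1))) * exp (- (\<Sum>m=1..b n. \<theta> m / real m))"
        if "length a = b n" for a
        by (rule law_poisson_vector(1)[OF M ind Y bn(1) that])
      have Zm: "?Z \<in> measurable M (count_space UNIV)"
        by (rule law_poisson_vector(2)[OF M ind Y bn(1), of "replicate (b n) 0"]) auto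
      have "tv_cycles_poisson \<theta> M Y (b n) n \<le> \<epsilon> + measure (law M ?Z) ?B"
        unfolding tv_cycles_poisson_def
      proof (rule total_variation_le[OF prob_space_law[OF PM Xm] prob_space_law[OF M Zm]])
        show "0 \<le> \<epsilon>" using \<epsilon> by simp
        fix a assume a: "a \<notin> ?B"
        show "(1 - \<epsilon>) * measure (law M ?Z) {a} \<le> measure (law (perm_measure \<theta> n) ?X) {a}"
        proof (cases "length a = b n")
          case True
          then have rR: "real (?r a) \<le> R" using a by (simp add: not_less)
          then have rn: "?r a \<le> n" using R(2) by linarith
          have "?r a \<in> S n" using rR rn by (simp add: S_def R_def)
          then have "1 - \<epsilon> \<le> \<rho> n (?r a)" using rr_least elim by (meson less_le_trans less_imp_le)
          moreover have "measure (law (perm_measure \<theta> n) ?X) {a} = \<rho> n (?r a) * measure (law M ?Z) {a}"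
            unfolding Z[OF True] \<rho>_def g1_def[symmetric]
            by (subst law_cycle_counts[OF _ elim(2) bn(2) True rn]) (simp_all add: exp_minus \<theta>_nonneg)
          ultimately show ?thesis by (simp only: mult_right_mono[OF _ measure_nonneg])
        next
          \<comment> \<open>Lists of the wrong length have Poisson mass 0, so the inequality is
            trivial.\<close>
          case False
          then have "?Z -` {a} \<inter> space M = {}" by (auto simp del: upt_Suc)
          then show ?thesis using measure_law_singleton[OF Zm, of a] by simp
        qed
      qed
      also have "measure (law M ?Z) ?B \<le> (\<Sum>m=1..b n. \<theta> m) / R"
        by (rule law_poisson_vector_tail[OF M Y \<theta>_nonneg Zm R(1)])
      also have "\<dots> \<le> (real (b n) * g1 (b n)) / R"
      proof (rule divide_right_mono)
        have "\<theta> m \<le> real (b n) * (\<theta> m / real m)" if "m \<in> {1..b n}" for m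
        proof -
          have "1 * \<theta> m \<le> (real (b n) / real m) * \<theta> m"
            using that \<theta>_nonneg[of m] by (intro mult_right_mono) auto
          then show ?thesis by simp
        qed
        then show "(\<Sum>m=1..b n. \<theta> m) \<le> real (b n) * g1 (b n)"
          unfolding g1_def sum_distrib_left by (intro sum_mono) auto
      qed (use R in simp)
      also have "\<dots> \<le> (real n powr c1 * g1 (b n)) / R"
        using elim R g1_nonneg[of "b n"] by (intro divide_right_mono mult_right_mono) auto
      also have "\<dots> = tail n"
      proof -
        have "real n powr c1 / R = real n powr (- (c2 - c1))"
          unfolding R_def by (subst powr_diff[symmetric]) simp
        moreover have "real n powr c1 * g1 (b n) / R = g1 (b n) * (real n powr c1 / R)" by simp
        ultimately show ?thesis unfolding tail_def by (simp only:)
      qed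
      finally show ?case by simp
    qed
  qed
  show ?thesis
  proof (rule tendstoI)
    fix e :: real assume e: "e > 0"
    have "eventually (\<lambda>n. tail n < e / 2) sequentially" using order_tendstoD(2)[OF tail0, of "e / 2"] e by simp
    moreover have "eventually (\<lambda>n. tv_cycles_poisson \<theta> M Y (b n) n \<le> e / 2 + tail n) sequentially"
      using bound[of "e / 2"] e by simp
    ultimately show "eventually (\<lambda>n. dist (tv_cycles_poisson \<theta> M Y (b n) n) 0 < e) sequentially"
    proof eventually_elim
      case (elim n)
      have "0 \<le> tv_cycles_poisson \<theta> M Y (b n) n" unfolding tv_cycles_poisson_def by (rule total_variation_nonneg)
      then show ?case using elim by simp
    qed
  qed
qed

end

theorem theorem5p1:
  fixes \<theta> :: "nat \<Rightarrow> real" and k :: nat and c :: real and b :: "nat \<Rightarrow> nat"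
    and M :: "'a measure" and Y :: "nat \<Rightarrow> 'a \<Rightarrow> nat"
  assumes "standing_assumptions \<theta> k"
    and "prob_space M"
    and "prob_space.indep_vars M (\<lambda>_. count_space UNIV) Y {1..}"
    and "\<And>m. 1 \<le> m \<Longrightarrow> poisson_distributed M (Y m) (\<theta> m / real m)"
    and "\<And>n. 1 \<le> n \<Longrightarrow> 1 \<le> b n \<and> b n \<le> n"
    and "0 < c" and "c < real (3 * k + 3) powr (- 1 / real (k + 1))"
    and "(\<lambda>n. real (b n)) \<in> o(\<lambda>n. real n powr c)"
  shows "(\<lambda>n. tv_cycles_poisson \<theta> M Y (b n) n) \<in> o(\<lambda>_. 1)"
proof -
  from assms(1) obtain G a where GA: "\<forall>m\<ge>1. 0 \<le> \<theta> m"
     "\<forall>t::complex. norm t < 1 \<longrightarrow> summable (\<lambda>m. of_real (\<theta> (Suc m) / real (Suc m)) * t ^ Suc m)"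
     "1 \<le> k" "\<forall>t\<in>ball 0 1. G t = cycle_gf \<theta> t" "continuous_on (cball 0 1 - {1}) G"
     "(\<lambda>w. G (exp (- w)) -
             ((- Ln w) ^ (k + 1) / of_nat (k + 1) + (\<Sum>j\<le>k. of_real (a j) * (- Ln w) ^ j)))
          \<in> O[at 0 within {w. 0 \<le> Re w}](\<lambda>w. w)"
    unfolding standing_assumptions_def by blast
  interpret log_singularity \<theta> k G a
    by unfold_locales (use GA in auto)
  obtain L where L: "filterlim L at_top sequentially" "eventually (\<lambda>n. dP (L n) * exp (L n) = real n) sequentially"
    using obtain_saddle by blast
  interpret saddle \<theta> k G a L
    by unfold_locales (use L in auto)
  \<comment> \<open>\<open>D ^ (k + 1) = 1 / (3 * k + 3) \<le> 1 / 6\<close>, because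
    \<open>k \<ge> 1\<close>; this is below the 1/5 required of \<open>d\<close>.\<close>
  define D where "D = real (3 * k + 3) powr (- 1 / real (k + 1))"
  obtain d where d: "c < d" "d < D" using dense assms(7) unfolding D_def by blast
  have d0: "d > 0" using d assms(6) by linarith
  have "d ^ (k + 1) < D ^ (k + 1)" using d d0 by (intro power_strict_mono) auto
  also have "D ^ (k + 1) = D powr real (k + 1)" using d d0 by (intro powr_realpow[symmetric]) auto
  also have "\<dots> = real (3 * k + 3) powr (- 1)" unfolding D_def powr_powr by simp
  also have "\<dots> = 1 / real (3 * k + 3)" by (simp add: powr_minus_divide)
  also have "\<dots> \<le> 1 / 6" using GA(3) by (intro divide_left_mono) auto
  finally have dk: "5 * d ^ (k + 1) < 1" by simp
  have d1: "d < 1"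
  proof (rule ccontr)
    assume "\<not> d < 1"
    then have "1 \<le> d ^ (k + 1)" by (intro one_le_power) auto
    with dk show False by simp
  qed
  have "eventually (\<lambda>n. norm (real (b n)) \<le> 1 * norm (real n powr c)) sequentially"
    using landau_o.smallD[OF assms(8), of 1] by simp
  then have b: "eventually (\<lambda>n. real (b n) \<le> real n powr c) sequentially" by simp
  \<comment> \<open>The midpoint \<open>(c + d) / 2\<close> serves as the exponent for
    \<open>r\<close>, strictly between those for \<open>b\<close> and for the window.\<close>
  have "(\<lambda>n. tv_cycles_poisson \<theta> M Y (b n) n) \<longlonglongrightarrow> 0"
    by (rule tv_cycles_poisson_tendsto[OF assms(2-4), of c "(c + d) / 2" d]) (use assms(5,6) d d1 dk b in auto)
  then show ?thesis by (intro smalloI_tendsto) auto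
qed

end
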